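(* Let $d\ge 1$, let $\Lambda_\Phi\subset[0,1]^d$ be a self-affine sponge, where $\Phi=(\phi_{\mathbf{a}})_{\mathbf{a}\in E}$, and let $\mathbf{p}$ be an irreducible good probability measure on $E$ with distinct Lyapunov exponents. Then there exists a sequence of strongly Lalley–Gatzouras sponges $\Lambda_{\Psi_N}\subset\Lambda_\Phi$ that are hyperplane diffuse and satisfy $$\underline{\dim}_A(\Lambda_{\Psi_N})\ \to\ \dim_H(\nu_{\mathbf{p}})\qquad (N\to\infty),$$ where $\underline{\dim}_A$ denotes the lower Assouad dimension.
   Context: $\dim_H$ denotes Hausdorff dimension; the Hausdorff dimension of a measure is the infimum of the Hausdorff dimensions of sets of full measure. Diagonal IFS and self-affine sponge. Let $D=\{1,\ldots,d\}$. For each $i\in D$ let $A_i$ be a finite index set and $\Phi_i=(\phi_{i,a})_{a\in A_i}$ a finite collection of contracting similarities $[0,1]\to[0,1]$ (the base IFS in coordinate $i$). Let $A=\prod_{i\in D}A_i$, and for $\mathbf{a}=(a_1,\ldots,a_d)\in A$ let $\phi_{\mathbf{a}}(x_1,\ldots,x_d)=(\phi_{\mathbf{a},1}(x_1),\ldots,\phi_{\mathbf{a},d}(x_d))$, where $\phi_{\mathbf{a},i}:=\phi_{i,a_i}$. The constant $|\phi_{\mathbf{a},i}'|\in(0,1)$ is the contraction ratio of $\phi_{\mathbf{a},i}$. For nonempty $E\subset A$ the collection $\Phi=(\phi_{\mathbf{a}})_{\mathbf{a}\in E}$ is called a diagonal IFS. Its coding map is $\pi:E^{\mathbb{N}}\to[0,1]^d$,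 $\pi(\omega)=\lim_{n\to\infty}\phi_{\omega_1}\circ\cdots\circ\phi_{\omega_n}(\mathbf{0})$, and its limit set $\Lambda_\Phi=\pi(E^{\mathbb{N}})$ is called a self-affine sponge. Each $\Psi_N$ is a diagonal IFS on $[0,1]^d$ (with its own base IFSes and index set). Properties of the data $\Phi$ are, by abuse of language, attributed to $\Lambda_\Phi$. Let $\mathbf{p}$ be a probability measure on $E$. The Bernoulli measure $\nu_{\mathbf{p}}=\pi_*[\mathbf{p}^{\mathbb{N}}]$ is the pushforward of the product measure $\mathbf{p}^{\mathbb{N}}$ under $\pi$. The Lyapunov exponent of $\mathbf{p}$ in coordinate $i\in D$ is $\chi_i(\mathbf{p})=-\int\log|\phi_{\mathbf{a},i}'|\,d\mathbf{p}(\mathbf{a})$. The measure $\mathbf{p}$ has distinct Lyapunov exponents if the numbers $\chi_i(\mathbf{p})$ ($i\in D$) are all distinct. Write $i\prec_{\mathbf{p}}j$ (equivalently $j\succ_{\mathbf{p}}i$) if $\chi_i(\mathbf{p})\le\chi_j(\mathbf{p})$. The measure $\mathbf{p}$ is irreducible if for every $i\in D$ there exist $\mathbf{a},\mathbf{b}\in E$ such that $a_i\ne b_i$ and $\{j\in D:a_j\ne b_j\}\subset\{j\in D: j\succ_{\mathbf{p}}i\}$. For $I\subset D$ let $\pi_I:A\to\prod_{i\in I}A_i$ be the projection, and for $\mathbf{a}\in\pi_I(E)$ let $\phi_{I,\mathbf{a}}:[0,1]^I\to[0,1]^I$, $\phi_{I,\mathbf{a}}(\mathbf{x})=(\phi_{i,a_i}(x_i))_{i\in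 I}$. The set $I$ is good (resp. strongly good) if the sets $\phi_{I,\mathbf{a}}(\mathbb{I}^I)$, $\mathbf{a}\in\pi_I(E)$, are pairwise disjoint, where $\mathbb{I}=(0,1)$ (resp. $\mathbb{I}=[0,1]$). The measure $\mathbf{p}$ is good if for every $x>0$ the set $I(\mathbf{p},x)=\{i\in D:\chi_i(\mathbf{p})\le x\}$ is good. A self-affine sponge $\Lambda_\Phi$ is strongly Lalley–Gatzouras if there is a permutation $\sigma$ of $D$ such that (coordinate ordering) $|\phi_{\mathbf{a},\sigma(1)}'|>|\phi_{\mathbf{a},\sigma(2)}'|>\cdots>|\phi_{\mathbf{a},\sigma(d)}'|$ for all $\mathbf{a}\in E$, and (disjointness) the coordinate sets $\sigma(\{1,\ldots,i\})$, $i=1,\ldots,d$, are all strongly good. A set $K\subset\mathbb{R}^d$ is hyperplane diffuse if there exists $\beta>0$ such that for all $0<\rho\le1$, all $\mathbf{x}\in K$ and every affine hyperplane $\mathcal{L}\subset\mathbb{R}^d$, the set $(B(\mathbf{x},\rho)\cap K)\setminus\{\mathbf{y}:\mathrm{dist}(\mathbf{y},\mathcal{L})\le\beta\rho\}$ is nonempty. For $\rho>0$ and $S\subset\mathbb{R}^d$, $N_\rho(S)$ denotes the cardinality of a maximal $\rho$-separated subset of $S$ (well defined up to a constant factor). The lower Assouad dimension $\underline{\dim}_A(K)$ of a nonempty closed set $K\subset\mathbb{R}^d$ is the supremum of those $s\ge0$ for which there is $c>0$ such that $N_{\beta\rho}(B(\mathbf{x},\rho)\cap K)\ge c\beta^{-s}$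 for all $\mathbf{x}\in K$ and $0<\beta,\rho\le1$. *)

theory Defs
  imports "HOL-Probability.Probability"
begin

text \<open>
  The case distinction in the gauge implements the conventions that the empty set contributes
  nothing and that \<open>diam(U)\<^sup>0 = 1\<close> for every nonempty \<open>U\<close>
  (whereas \<open>0 powr 0 = 0\<close> in the library).
\<close>

definition hausdorff_gauge :: "real \<Rightarrow> 'v::euclidean_space set \<Rightarrow> ennreal" where
  "hausdorff_gauge s U =
     (if U = {} then 0 else if s = 0 then 1 else ennreal (diameter U powr s))"

definition hausdorff_premeasure :: "real \<Rightarrow> real \<Rightarrow> 'v::euclidean_space set \<Rightarrow> ennreal" where
  "hausdorff_premeasure s \<delta> S =
     (INF U \<in> {U :: nat \<Rightarrow> 'v set. S \<subseteq> (\<Union>k. U k) \<and> (\<forall>k. bounded (U k) \<and> diameter (U k) \<le> \<delta>)}.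
        \<Sum>k. hausdorff_gauge s (U k))"

definition hausdorff_measure :: "real \<Rightarrow> 'v::euclidean_space set \<Rightarrow> ennreal" where
  "hausdorff_measure s S = (SUP \<delta> \<in> {0<..}. hausdorff_premeasure s \<delta> S)"

text \<open>
  In a Euclidean space every \<open>s > DIM('v)\<close> belongs to the set below, so the infimum is taken over
  a nonempty set of reals that is bounded below.
\<close>

definition hausdorff_dim :: "'v::euclidean_space set \<Rightarrow> real" where
  "hausdorff_dim S = Inf {s. 0 \<le> s \<and> hausdorff_measure s S = 0}"

definition hausdorff_dim_measure :: "'v::euclidean_space measure \<Rightarrow> real" where
  "hausdorff_dim_measure \<mu> = Inf {hausdorff_dim S | S. S \<in> sets \<mu> \<and> (AE x in \<mu>. x \<in> S)}"

definition separated :: "real \<Rightarrow> 'v::metric_space set \<Rightarrow> bool" where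
  "separated \<rho> T \<longleftrightarrow> (\<forall>x\<in>T. \<forall>y\<in>T. x \<noteq> y \<longrightarrow> \<rho> \<le> dist x y)"

text \<open>
  Inclusion-maximal \<open>\<rho>\<close>-separated subsets may have different cardinalities, comparable up to a
  constant factor; the one chosen here has largest cardinality.  The supremum is only meaningful
  (and only used) for bounded subsets of a Euclidean space, where it is a maximum.
\<close>

definition separation_number :: "real \<Rightarrow> 'v::euclidean_space set \<Rightarrow> nat" where
  "separation_number \<rho> S = Sup {card T | T. T \<subseteq> S \<and> finite T \<and> separated \<rho> T}"

text \<open>
  For nonempty \<open>K\<close> the set below contains \<open>0\<close> and is bounded above by \<open>DIM('v)\<close>.
\<close>

definition lower_assouad_dim :: "'v::euclidean_space set \<Rightarrow> real" where
  "lower_assouad_dim K =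
     Sup {s. 0 \<le> s \<and> (\<exists>c>0. \<forall>x\<in>K. \<forall>\<beta>\<in>{0<..1}. \<forall>\<rho>\<in>{0<..1}.
            real (separation_number (\<beta> * \<rho>) (cball x \<rho> \<inter> K)) \<ge> c * \<beta> powr (- s))}"

definition hyperplane_diffuse :: "'v::euclidean_space set \<Rightarrow> bool" where
  "hyperplane_diffuse K \<longleftrightarrow>
     (\<exists>\<beta>>0. \<forall>\<rho>\<in>{0<..1}. \<forall>x\<in>K. \<forall>L. affine L \<and> aff_dim L = int DIM('v) - 1 \<longrightarrow>
        (cball x \<rho> \<inter> K) - {y. infdist y L \<le> \<beta> * \<rho>} \<noteq> {})"

definition contracting_similarity :: "(real \<Rightarrow> real) \<Rightarrow> bool" where
  "contracting_similarity f \<longleftrightarrow>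
     f ` {0..1} \<subseteq> {0..1} \<and>
     (\<exists>r. 0 < r \<and> r < 1 \<and> (\<forall>x\<in>{0..1}. \<forall>y\<in>{0..1}. dist (f x) (f y) = r * dist x y))"

definition contraction_ratio :: "(real \<Rightarrow> real) \<Rightarrow> real" where
  "contraction_ratio f =
     (THE r. \<forall>x\<in>{0..1}. \<forall>y\<in>{0..1}. dist (f x) (f y) = r * dist x y)"

text \<open>
  The coordinate set \<open>D\<close> is the finite type \<open>'n\<close>, so that the sponge lives in \<open>real ^ 'n\<close>.
  All index sets \<open>A\<^sub>i\<close> are subsets of one type \<open>'a\<close>, and a multi-index is a function \<open>'n \<Rightarrow> 'a\<close>.
  Only the restriction of a base map to the unit interval is relevant.
\<close>

record ('n, 'a) diag_ifs =
  base_index :: "'n \<Rightarrow> 'a set"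
  base_map :: "'n \<Rightarrow> 'a \<Rightarrow> real \<Rightarrow> real"
  index_set :: "('n \<Rightarrow> 'a) set"

definition diagonal_ifs :: "('n::finite, 'a) diag_ifs \<Rightarrow> bool" where
  "diagonal_ifs \<Phi> \<longleftrightarrow>
     (\<forall>i. finite (base_index \<Phi> i)) \<and>
     (\<forall>i. \<forall>a\<in>base_index \<Phi> i. contracting_similarity (base_map \<Phi> i a)) \<and>
     index_set \<Phi> \<noteq> {} \<and> index_set \<Phi> \<subseteq> Pi UNIV (base_index \<Phi>)"

definition ifs_map :: "('n::finite, 'a) diag_ifs \<Rightarrow> ('n \<Rightarrow> 'a) \<Rightarrow> real ^ 'n \<Rightarrow> real ^ 'n" where
  "ifs_map \<Phi> a x = (\<chi> i. base_map \<Phi> i (a i) (x $ i))"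

definition ifs_ratio :: "('n::finite, 'a) diag_ifs \<Rightarrow> ('n \<Rightarrow> 'a) \<Rightarrow> 'n \<Rightarrow> real" where
  "ifs_ratio \<Phi> a i = contraction_ratio (base_map \<Phi> i (a i))"

primrec ifs_comp ::
    "('n::finite, 'a) diag_ifs \<Rightarrow> (nat \<Rightarrow> 'n \<Rightarrow> 'a) \<Rightarrow> nat \<Rightarrow> real ^ 'n \<Rightarrow> real ^ 'n" where
  "ifs_comp \<Phi> \<omega> 0 = id"
| "ifs_comp \<Phi> \<omega> (Suc n) = ifs_comp \<Phi> \<omega> n \<circ> ifs_map \<Phi> (\<omega> n)"

definition coding_map :: "('n::finite, 'a) diag_ifs \<Rightarrow> (nat \<Rightarrow> 'n \<Rightarrow> 'a) \<Rightarrow> real ^ 'n" where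
  "coding_map \<Phi> \<omega> = lim (\<lambda>n. ifs_comp \<Phi> \<omega> n 0)"

definition limit_set :: "('n::finite, 'a) diag_ifs \<Rightarrow> (real ^ 'n) set" where
  "limit_set \<Phi> = coding_map \<Phi> ` (UNIV \<rightarrow> index_set \<Phi>)"

text \<open>
  Points of \<open>[0,1]\<^sup>I\<close> and elements of \<open>\<pi>\<^sub>I(E)\<close> are extensional functions on \<open>I\<close>.
  The parameter \<open>J\<close> is the open or the closed unit interval.
\<close>

definition sub_map ::
    "('n::finite, 'a) diag_ifs \<Rightarrow> 'n set \<Rightarrow> ('n \<Rightarrow> 'a) \<Rightarrow> ('n \<Rightarrow> real) \<Rightarrow> ('n \<Rightarrow> real)" where
  "sub_map \<Phi> I a x = (\<lambda>i\<in>I. base_map \<Phi> i (a i) (x i))"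

definition disjoint_images :: "('n::finite, 'a) diag_ifs \<Rightarrow> real set \<Rightarrow> 'n set \<Rightarrow> bool" where
  "disjoint_images \<Phi> J I \<longleftrightarrow>
     disjoint_family_on (\<lambda>a. sub_map \<Phi> I a ` (I \<rightarrow>\<^sub>E J)) ((\<lambda>a. restrict a I) ` index_set \<Phi>)"

definition good_set :: "('n::finite, 'a) diag_ifs \<Rightarrow> 'n set \<Rightarrow> bool" where
  "good_set \<Phi> I \<longleftrightarrow> disjoint_images \<Phi> {0<..<1} I"

definition strongly_good_set :: "('n::finite, 'a) diag_ifs \<Rightarrow> 'n set \<Rightarrow> bool" where
  "strongly_good_set \<Phi> I \<longleftrightarrow> disjoint_images \<Phi> {0..1} I"

text \<open>
  As the coordinates are not numbered, a permutation of \<open>{1,\<dots>,d}\<close> becomes an enumeration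
  \<open>\<sigma>(1),\<dots>,\<sigma>(d)\<close> of the coordinate type.
\<close>

definition strongly_lalley_gatzouras :: "('n::finite, 'a) diag_ifs \<Rightarrow> bool" where
  "strongly_lalley_gatzouras \<Phi> \<longleftrightarrow>
     (\<exists>\<sigma> :: nat \<Rightarrow> 'n. bij_betw \<sigma> {1..CARD('n)} UNIV \<and>
        (\<forall>a\<in>index_set \<Phi>. \<forall>i\<in>{1..<CARD('n)}. ifs_ratio \<Phi> a (\<sigma> i) > ifs_ratio \<Phi> a (\<sigma> (Suc i))) \<and>
        (\<forall>i\<in>{1..CARD('n)}. strongly_good_set \<Phi> (\<sigma> ` {1..i})))"

definition prob_measure_on :: "'b set \<Rightarrow> 'b measure \<Rightarrow> bool" where
  "prob_measure_on E p \<longleftrightarrow> prob_space p \<and> sets p = Pow E"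

definition bernoulli_measure ::
    "('n::finite, 'a) diag_ifs \<Rightarrow> ('n \<Rightarrow> 'a) measure \<Rightarrow> (real ^ 'n) measure" where
  "bernoulli_measure \<Phi> p = distr (\<Pi>\<^sub>M k\<in>(UNIV :: nat set). p) borel (coding_map \<Phi>)"

definition lyapunov :: "('n::finite, 'a) diag_ifs \<Rightarrow> ('n \<Rightarrow> 'a) measure \<Rightarrow> 'n \<Rightarrow> real" where
  "lyapunov \<Phi> p i = - (\<integral>a. ln (ifs_ratio \<Phi> a i) \<partial>p)"

definition distinct_lyapunov :: "('n::finite, 'a) diag_ifs \<Rightarrow> ('n \<Rightarrow> 'a) measure \<Rightarrow> bool" where
  "distinct_lyapunov \<Phi> p \<longleftrightarrow> inj (lyapunov \<Phi> p)"

definition irreducible_measure :: "('n::finite, 'a) diag_ifs \<Rightarrow> ('n \<Rightarrow> 'a) measure \<Rightarrow> bool" where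
  "irreducible_measure \<Phi> p \<longleftrightarrow>
     (\<forall>i. \<exists>a\<in>index_set \<Phi>. \<exists>b\<in>index_set \<Phi>.
        a i \<noteq> b i \<and> {j. a j \<noteq> b j} \<subseteq> {j. lyapunov \<Phi> p i \<le> lyapunov \<Phi> p j})"

definition good_measure :: "('n::finite, 'a) diag_ifs \<Rightarrow> ('n \<Rightarrow> 'a) measure \<Rightarrow> bool" where
  "good_measure \<Phi> p \<longleftrightarrow> (\<forall>x>0. good_set \<Phi> {i. lyapunov \<Phi> p i \<le> x})"

end

theory Submission
  imports Defs "HOL-Combinatorics.Multiset_Permutations"
begin

text \<open>
  List the coordinates in order of increasing Lyapunov exponent \<open>\<chi>\<^sub>i\<close>, write \<open>h\<^sub>i\<close> for the entropy of
  the projection of \<open>p\<close> to the first \<open>i\<close> coordinates, and put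
  \<open>\<delta> = \<Sum>\<^sub>i (h\<^sub>i - h\<^sub>i\<^sub>-\<^sub>1) / \<chi>\<^sub>i\<close>.  By the Ledrappier--Young formula \<open>\<delta>\<close> is the dimension of the
  Bernoulli measure, but only the bound \<open>dim\<^sub>H \<le> \<delta>\<close> is needed: every \<open>t\<close> in \<open>[0, \<delta>]\<close> is a limit
  of lower Assouad dimensions of suitable subsponges.

  The subsponges use all words of a fixed type, i.e. in which every letter \<open>a\<close> occurs about
  \<open>n p(a)\<close> times (and at least once).  All these words have the same contraction ratios, and the
  symmetric group acts on them, so that all fibres of the coordinate projections have the same
  size; for such a sponge the lower Assouad dimension is given by an explicit formula.  Appending
  to all words a fixed word that maps the cube into its interior turns goodness into strong
  goodness, and a long fixed suffix lowers the dimension to any prescribed value.  Irreducibility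
  makes every fibre have at least two points, whence the sponge is hyperplane diffuse.

  The bound \<open>dim\<^sub>H \<le> \<delta>\<close> comes from covering typical points by approximate cubes, whose
  number is controlled by the fact that their measures add up to at most 1.
\<close>

section \<open>Compositions of similarities and the coding map\<close>

text \<open>The obstacle is uniformity. The lower Assouad dimension is governed by the sparsest ball
  at any point and any scale, so it does not suffice that typical words have the right ratios and
  typical fibres the right size. Words of one type leave no exceptions: a ratio depends on the
  letter counts only, and permuting positions makes the fibres equal exactly, not just up to a
  subexponential factor. In such a sponge the number of pieces of size
  \<open>\<beta> * \<rho>\<close> in a ball of radius \<open>\<rho>\<close> is, up to constants, a
  product over the coordinates of the fibre size \<open>m i\<close>, raised to the number of levels
  that coordinate \<open>i\<close> spends between the two scales. This gives the exponent
  \<open>\<Sum> ln (m i) / - ln (r i)\<close>. Dividing each logarithm by the word length and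
  passing to the limit turns \<open>ln (m i)\<close> into an entropy increment and
  \<open>- ln (r i)\<close> into a Lyapunov exponent. Distinct exponents enter through the same
  limit: they force a strict order of the ratios once the words are long.\<close>

lemma contracting_similarity_affine:
  assumes "contracting_similarity f"
  obtains s where "\<bar>s\<bar> = contraction_ratio f" "0 < \<bar>s\<bar>" "\<bar>s\<bar> < 1"
    "\<And>x. x \<in> {0..1} \<Longrightarrow> f x = f 0 + s * x"
proof -
  obtain r where r: "0 < r" "r < 1" "\<And>x y. x \<in> {0..1} \<Longrightarrow> y \<in> {0..1} \<Longrightarrow> dist (f x) (f y) = r * dist x y"
    using assms unfolding contracting_similarity_def by blast
  have cr: "contraction_ratio f = r"
    unfolding contraction_ratio_def
  proof (rule the_equality)
    fix r' assume "\<forall>x\<in>{0..1}. \<forall>y\<in>{0..1}. dist (f x) (f y) = r' * dist x y"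
    then have "dist (f 0) (f 1) = r' * dist 0 (1::real)" by simp
    moreover have "dist (f 0) (f 1) = r * dist 0 (1::real)" by (rule r(3)) auto
    ultimately show "r' = r" by simp
  qed (use r in blast)
  define s where "s = f 1 - f 0"
  have s: "\<bar>s\<bar> = r" using r(3)[of 1 0] by (simp add: s_def dist_real_def)
  have "f x = f 0 + s * x" if x: "x \<in> {0..1}" for x
  proof -
    \<comment> \<open>The distances from \<open>f x\<close> to \<open>f 0\<close> and to
      \<open>f 1\<close> add up to \<open>\<bar>s\<bar>\<close>, so \<open>f x\<close> lies between
      the two and the sign of \<open>s\<close> decides its position.\<close>
    have a: "\<bar>f x - f 0\<bar> = r * x" using r(3)[of x 0] x by (simp add: dist_real_def)
    have b: "\<bar>f 1 - f x\<bar> = r * (1 - x)" using r(3)[of 1 x] x by (simp add: dist_real_def)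
    have rx: "r * (1 - x) = r - r * x" by (simp add: algebra_simps)
    have "0 \<le> r * x" "0 \<le> r - r * x" using r x rx by (auto simp: mult_left_le)
    show ?thesis
    proof (cases "s \<ge> 0")
      case True
      then have sr: "s = r" using s by simp
      then show ?thesis using a b rx s_def \<open>0 \<le> r * x\<close> \<open>0 \<le> r - r * x\<close> by simp
    next
      case False
      then have sr: "s = - r" using s by simp
      then show ?thesis using a b rx s_def \<open>0 \<le> r * x\<close> \<open>0 \<le> r - r * x\<close> by simp
    qed
  qed
  then show thesis using that[of s] s cr r(1,2) by (simp only: simp_thms)
qed

lemma contraction_ratio_bounds:
  "contracting_similarity f \<Longrightarrow> 0 < contraction_ratio f"
  "contracting_similarity f \<Longrightarrow> contraction_ratio f < 1"
  by (erule contracting_similarity_affine, simp)+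

lemma contracting_similarity_dist:
  assumes "contracting_similarity f" "x \<in> {0..1}" "y \<in> {0..1}"
  shows "\<bar>f x - f y\<bar> = contraction_ratio f * \<bar>x - y\<bar>"
proof -
  obtain s where s: "\<bar>s\<bar> = contraction_ratio f" "\<And>x. x \<in> {0..1} \<Longrightarrow> f x = f 0 + s * x"
    using contracting_similarity_affine[OF assms(1)] by metis
  have "f x - f y = s * (x - y)" using s(2)[OF assms(2)] s(2)[OF assms(3)] by (simp add: algebra_simps)
  then show ?thesis using s(1) by (simp add: abs_mult)
qed

lemma contracting_similarity_mem:
  "contracting_similarity f \<Longrightarrow> x \<in> {0..1} \<Longrightarrow> f x \<in> {0..1}"
  unfolding contracting_similarity_def by blast

lemma contracting_similarity_open_mem:
  assumes "contracting_similarity f" "x \<in> {0<..<1}"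
  shows "f x \<in> {0<..<1}"
proof -
  obtain s where s: "\<bar>s\<bar> = contraction_ratio f" "0 < \<bar>s\<bar>" "\<And>x. x \<in> {0..1} \<Longrightarrow> f x = f 0 + s * x"
    using contracting_similarity_affine[OF assms(1)] by metis
  have 0: "f 0 \<in> {0..1}" "f 1 \<in> {0..1}" using contracting_similarity_mem[OF assms(1)] by auto
  have 1: "f 1 = f 0 + s" using s(3)[of 1] by simp
  have x: "f x = f 0 + s * x" using s(3)[of x] assms(2) by simp
  show ?thesis
  proof (cases "s > 0")
    case True
    then have "0 < s * x" "s * x < s" using assms(2) by auto
    then show ?thesis using 0 1 x by auto
  next
    case False
    then have "s < 0" using s(2) by auto
    then have "s * x < 0" "s < s * x" using assms(2) by (auto simp: mult_less_0_iff)
    then show ?thesis using 0 1 x by auto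
  qed
qed

lemma contracting_similarityI:
  assumes "\<And>x. x \<in> {0..1} \<Longrightarrow> f x \<in> {0..1}" "0 < r" "r < 1"
    "\<And>x y. x \<in> {0..1} \<Longrightarrow> y \<in> {0..1} \<Longrightarrow> \<bar>f x - f y\<bar> = r * \<bar>x - y\<bar>"
  shows "contracting_similarity f" "contraction_ratio f = r"
proof -
  show 1: "contracting_similarity f"
    unfolding contracting_similarity_def dist_real_def using assms by blast
  show "contraction_ratio f = r"
    using contracting_similarity_dist[OF 1, of 1 0] assms(4)[of 1 0] by simp
qed

lemma contracting_similarity_comp:
  assumes f: "contracting_similarity f" and g: "contracting_similarity g"
  shows "contracting_similarity (f \<circ> g)" "contraction_ratio (f \<circ> g) = contraction_ratio f * contraction_ratio g"
proof -
  have 1: "f (g x) \<in> {0..1}" if "x \<in> {0..1}" for x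
    using contracting_similarity_mem f g that by blast
  have 2: "\<bar>f (g x) - f (g y)\<bar> = contraction_ratio f * contraction_ratio g * \<bar>x - y\<bar>"
    if "x \<in> {0..1}" "y \<in> {0..1}" for x y
    using contracting_similarity_dist[OF f contracting_similarity_mem[OF g that(1)] contracting_similarity_mem[OF g that(2)]]
      contracting_similarity_dist[OF g that] by simp
  have 3: "0 < contraction_ratio f * contraction_ratio g"
    using contraction_ratio_bounds f g by simp
  have 4: "contraction_ratio f * contraction_ratio g < 1"
    using contraction_ratio_bounds[OF f] contraction_ratio_bounds[OF g] mult_strict_mono'[of "contraction_ratio f" 1 "contraction_ratio g" 1] by simp
  show "contracting_similarity (f \<circ> g)" "contraction_ratio (f \<circ> g) = contraction_ratio f * contraction_ratio g"
    using contracting_similarityI[of "f \<circ> g", OF _ 3 4] 1 2 by auto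
qed

text \<open>The coding map of a diagonal IFS splits into coordinates (\<open>ifs_comp_nth\<close>),
  so its analysis takes place in one dimension.\<close>

primrec scomp :: "(nat \<Rightarrow> real \<Rightarrow> real) \<Rightarrow> nat \<Rightarrow> real \<Rightarrow> real" where
  "scomp g 0 = id"
| "scomp g (Suc n) = scomp g n \<circ> g n"

lemma scomp_add: "scomp g (n + m) = scomp g n \<circ> scomp (\<lambda>k. g (n + k)) m"
  by (induction m) (auto simp: fun_eq_iff)

lemma scomp_cong: "(\<And>k. k < n \<Longrightarrow> g k = h k) \<Longrightarrow> scomp g n = scomp h n"
  by (induction n) auto

locale similarity_seq =
  fixes g :: "nat \<Rightarrow> real \<Rightarrow> real" and c :: real
  assumes sim: "contracting_similarity (g k)"
    and ratio_le: "contraction_ratio (g k) \<le> c"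
    and c_less: "c < 1"
begin

lemma c_pos: "0 < c"
  using contraction_ratio_bounds[OF sim, of 0] ratio_le[of 0] by simp

lemma scomp_mem: "x \<in> {0..1} \<Longrightarrow> scomp g n x \<in> {0..1}"
  by (induction n arbitrary: x) (use contracting_similarity_mem[OF sim] in auto)

lemma scomp_dist:
  "x \<in> {0..1} \<Longrightarrow> y \<in> {0..1} \<Longrightarrow>
     \<bar>scomp g n x - scomp g n y\<bar> = (\<Prod>k<n. contraction_ratio (g k)) * \<bar>x - y\<bar>"
  by (induction n arbitrary: x y)
    (use contracting_similarity_mem[OF sim] contracting_similarity_dist[OF sim] in \<open>auto simp: mult_ac\<close>)

lemma prod_ratio_le: "(\<Prod>k<n. contraction_ratio (g k)) \<le> c ^ n"
proof -
  have "(\<Prod>k<n. contraction_ratio (g k)) \<le> (\<Prod>k<n. c)"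
    by (intro prod_mono) (use contraction_ratio_bounds(1)[OF sim] ratio_le in \<open>auto intro: less_imp_le\<close>)
  then show ?thesis by simp
qed

lemma scomp_continuous: "continuous_on {0..1} (scomp g n)"
proof (rule lipschitz_on_continuous_on[of "\<Prod>k<n. contraction_ratio (g k)"], rule lipschitz_onI)
  show "0 \<le> (\<Prod>k<n. contraction_ratio (g k))"
    by (intro prod_nonneg) (use contraction_ratio_bounds(1)[OF sim] in \<open>auto intro: less_imp_le\<close>)
qed (simp add: dist_real_def scomp_dist)

lemma shift: "similarity_seq (\<lambda>k. g (n + k)) c"
  by unfold_locales (use sim ratio_le c_less in auto)

text \<open>All later approximations stay in the image of the unit interval under
  \<open>scomp g n\<close>, whose length is at most \<open>c ^ n\<close>.\<close>

lemma convergent_scomp: "convergent (\<lambda>n. scomp g n 0)"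
proof -
  have d: "\<bar>scomp g (n + m) 0 - scomp g n 0\<bar> \<le> c ^ n" for n m
  proof -
    interpret s: similarity_seq "\<lambda>k. g (n + k)" c by (rule shift)
    have m: "scomp (\<lambda>k. g (n + k)) m 0 \<in> {0..1}" by (rule s.scomp_mem) simp
    then have "\<bar>scomp g (n + m) 0 - scomp g n 0\<bar> = (\<Prod>k<n. contraction_ratio (g k)) * \<bar>scomp (\<lambda>k. g (n + k)) m 0 - 0\<bar>"
      by (simp add: scomp_add scomp_dist)
    also have "\<dots> \<le> c ^ n * 1"
      by (intro mult_mono prod_ratio_le) (use m c_pos in auto)
    finally show ?thesis by simp
  qed
  have "Cauchy (\<lambda>n. scomp g n 0)"
  proof (rule metric_CauchyI)
    fix e :: real assume "e > 0"
    obtain N where N: "c ^ N < e / 2"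
      using real_arch_pow_inv[OF _ c_less, of "e/2"] \<open>e > 0\<close> by auto
    have "dist (scomp g m 0) (scomp g n 0) < e" if "m \<ge> N" "n \<ge> N" for m n
      using d[of N "m - N"] d[of N "n - N"] N that by (simp add: dist_real_def)
    then show "\<exists>M. \<forall>m\<ge>M. \<forall>n\<ge>M. dist (scomp g m 0) (scomp g n 0) < e" by blast
  qed
  then show ?thesis by (simp add: Cauchy_convergent_iff)
qed

lemma lim_scomp_mem: "lim (\<lambda>n. scomp g n 0) \<in> {0..1}"
proof -
  have *: "(\<lambda>n. scomp g n 0) \<longlonglongrightarrow> lim (\<lambda>n. scomp g n 0)"
    using convergent_scomp by (simp add: convergent_LIMSEQ_iff)
  have "\<forall>n. scomp g n 0 \<in> {0..1}" using scomp_mem by simp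
  then show ?thesis using closed_sequentially[OF _ _ *, of "{0..1}"] by auto
qed

text \<open>Self-similarity of the coding. All distance estimates for codes with a common prefix
  rest on it.\<close>

lemma lim_scomp_shift:
  "lim (\<lambda>n. scomp g n 0) = scomp g n (lim (\<lambda>m. scomp (\<lambda>k. g (n + k)) m 0))"
proof -
  interpret s: similarity_seq "\<lambda>k. g (n + k)" c by (rule shift)
  have "(\<lambda>m. scomp g (n + m) 0) \<longlonglongrightarrow> lim (\<lambda>n. scomp g n 0)"
    using LIMSEQ_ignore_initial_segment[of "\<lambda>n. scomp g n 0" _ n] convergent_scomp
    by (simp add: convergent_LIMSEQ_iff add.commute)
  moreover have "(\<lambda>m. scomp g n (scomp (\<lambda>k. g (n + k)) m 0)) \<longlonglongrightarrow>
      scomp g n (lim (\<lambda>m. scomp (\<lambda>k. g (n + k)) m 0))"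
    by (rule continuous_on_tendsto_compose[OF scomp_continuous])
      (use s.convergent_scomp s.lim_scomp_mem s.scomp_mem in \<open>auto simp: convergent_LIMSEQ_iff\<close>)
  ultimately show ?thesis
    by (auto simp: scomp_add intro: LIMSEQ_unique)
qed

end

section \<open>Coordinates of the coding map\<close>

lemma diagonal_ifs_sim:
  "diagonal_ifs \<Phi> \<Longrightarrow> a \<in> index_set \<Phi> \<Longrightarrow> contracting_similarity (base_map \<Phi> i (a i))"
  unfolding diagonal_ifs_def by blast

lemma finite_index_set:
  assumes "diagonal_ifs (\<Phi> :: ('n::finite, 'a) diag_ifs)"
  shows "finite (index_set \<Phi>)"
proof -
  have "finite (PiE UNIV (base_index \<Phi>))"
    using assms by (intro finite_PiE) (auto simp: diagonal_ifs_def)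
  then show ?thesis
    using assms by (auto simp: diagonal_ifs_def PiE_UNIV_domain intro: finite_subset)
qed

definition ratio_bound :: "('n::finite, 'a) diag_ifs \<Rightarrow> real" where
  "ratio_bound \<Phi> = Max ((\<lambda>(a, i). ifs_ratio \<Phi> a i) ` (index_set \<Phi> \<times> UNIV))"

lemma ifs_ratio_bounds:
  assumes "diagonal_ifs \<Phi>" "a \<in> index_set \<Phi>"
  shows "0 < ifs_ratio \<Phi> a i" "ifs_ratio \<Phi> a i < 1" "ifs_ratio \<Phi> a i \<le> ratio_bound \<Phi>"
proof -
  show "0 < ifs_ratio \<Phi> a i" "ifs_ratio \<Phi> a i < 1"
    unfolding ifs_ratio_def using contraction_ratio_bounds[OF diagonal_ifs_sim[OF assms]] by auto
  show "ifs_ratio \<Phi> a i \<le> ratio_bound \<Phi>"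
    unfolding ratio_bound_def using finite_index_set[OF assms(1)] assms(2) by (intro Max_ge) auto
qed

lemma ratio_bound_less:
  assumes "diagonal_ifs \<Phi>"
  shows "ratio_bound \<Phi> < 1"
proof -
  have "index_set \<Phi> \<noteq> {}" using assms by (simp add: diagonal_ifs_def)
  then show ?thesis
    unfolding ratio_bound_def
    using finite_index_set[OF assms] ifs_ratio_bounds(2)[OF assms] by (subst Max_less_iff) auto
qed

abbreviation coord :: "('n::finite, 'a) diag_ifs \<Rightarrow> (nat \<Rightarrow> 'n \<Rightarrow> 'a) \<Rightarrow> 'n \<Rightarrow> nat \<Rightarrow> real \<Rightarrow> real" where
  "coord \<Phi> \<omega> i \<equiv> \<lambda>k. base_map \<Phi> i (\<omega> k i)"

lemma similarity_seq_coordinate: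
  assumes "diagonal_ifs \<Phi>" "\<And>k. \<omega> k \<in> index_set \<Phi>"
  shows "similarity_seq (coord \<Phi> \<omega> i) (ratio_bound \<Phi>)"
  by unfold_locales
    (use diagonal_ifs_sim[OF assms(1) assms(2)] ratio_bound_less[OF assms(1)]
       ifs_ratio_bounds(3)[OF assms(1) assms(2)] in \<open>auto simp: ifs_ratio_def\<close>)

lemma ifs_comp_nth: "ifs_comp \<Phi> \<omega> n x $ i = scomp (coord \<Phi> \<omega> i) n (x $ i)"
  by (induction n arbitrary: x) (auto simp: ifs_map_def)

text \<open>\<open>coding_map\<close> is defined by \<open>lim\<close>, which carries information
  only once convergence is known; this is obtained coordinate by coordinate.\<close>

lemma tendsto_coding_map:
  assumes "diagonal_ifs \<Phi>" "\<And>k. \<omega> k \<in> index_set \<Phi>"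
  shows "(\<lambda>n. ifs_comp \<Phi> \<omega> n 0) \<longlonglongrightarrow> coding_map \<Phi> \<omega>"
    and coding_map_nth: "coding_map \<Phi> \<omega> $ i = lim (\<lambda>n. scomp (coord \<Phi> \<omega> i) n 0)"
proof -
  define l where "l = (\<chi> i. lim (\<lambda>n. scomp (coord \<Phi> \<omega> i) n 0))"
  have "(\<lambda>n. ifs_comp \<Phi> \<omega> n 0) \<longlonglongrightarrow> l"
  proof (rule vec_tendstoI)
    fix i
    interpret similarity_seq "coord \<Phi> \<omega> i" "ratio_bound \<Phi>"
      by (rule similarity_seq_coordinate[OF assms])
    show "(\<lambda>n. ifs_comp \<Phi> \<omega> n 0 $ i) \<longlonglongrightarrow> l $ i"
      using convergent_scomp by (simp add: l_def ifs_comp_nth convergent_LIMSEQ_iff)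
  qed
  then show "(\<lambda>n. ifs_comp \<Phi> \<omega> n 0) \<longlonglongrightarrow> coding_map \<Phi> \<omega>"
    and "coding_map \<Phi> \<omega> $ i = lim (\<lambda>n. scomp (coord \<Phi> \<omega> i) n 0)"
    by (auto simp: coding_map_def limI l_def)
qed

lemma coding_map_shift_nth:
  assumes "diagonal_ifs \<Phi>" "\<And>k. \<omega> k \<in> index_set \<Phi>"
  shows "coding_map \<Phi> \<omega> $ i =
    scomp (coord \<Phi> \<omega> i) n (coding_map \<Phi> (\<lambda>k. \<omega> (n + k)) $ i)"
proof -
  interpret similarity_seq "coord \<Phi> \<omega> i" "ratio_bound \<Phi>"
    by (rule similarity_seq_coordinate[OF assms])
  show ?thesis
    using lim_scomp_shift[of n] assms by (simp add: coding_map_nth)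
qed

lemma coding_map_mem:
  assumes "diagonal_ifs \<Phi>" "\<And>k. \<omega> k \<in> index_set \<Phi>"
  shows "coding_map \<Phi> \<omega> $ i \<in> {0..1}"
proof -
  interpret similarity_seq "coord \<Phi> \<omega> i" "ratio_bound \<Phi>"
    by (rule similarity_seq_coordinate[OF assms])
  show ?thesis using lim_scomp_mem assms by (simp add: coding_map_nth)
qed

section \<open>Sponges with constant ratios and uniform fibres\<close>

lemma finite_obtain_min:
  fixes f :: "'a \<Rightarrow> 'b::linorder"
  assumes "finite S" "S \<noteq> {}"
  obtains i where "i \<in> S" "\<And>j. j \<in> S \<Longrightarrow> f i \<le> f j"
  using arg_min_if_finite(1)[OF assms, of f] arg_min_least[OF assms, of _ f] by blast

text \<open>The abstract outcome of the type construction, with coordinates ordered by decreasing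
  ratio. By \<open>fibre\<close>, once the coordinates of larger ratio are prescribed by some digit,
  exactly \<open>m i\<close> values remain for coordinate \<open>i\<close>, whichever digit was
  used. The bound \<open>2 \<le> m i\<close> is what makes the limit set hyperplane diffuse.\<close>

locale hom_sponge =
  fixes \<Psi> :: "('n::finite, 'b) diag_ifs" and r :: "'n \<Rightarrow> real" and m :: "'n \<Rightarrow> nat"
  assumes ifs: "diagonal_ifs \<Psi>"
    and ratio: "\<And>a i. a \<in> index_set \<Psi> \<Longrightarrow> ifs_ratio \<Psi> a i = r i"
    and inj_r: "inj r"
    and good: "\<And>i. strongly_good_set \<Psi> {j. r i \<le> r j}"
    and fibre: "\<And>a i. a \<in> index_set \<Psi> \<Longrightarrow>
      card ((\<lambda>b. restrict b {j. r i \<le> r j}) ` {b \<in> index_set \<Psi>. \<forall>j. r i < r j \<longrightarrow> b j = a j}) = m i"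
    and m_ge: "\<And>i. 2 \<le> m i"
begin

abbreviation "digits \<equiv> index_set \<Psi>"

lemma finite_digits: "finite digits" and digits_ne: "digits \<noteq> {}"
  using finite_index_set[OF ifs] ifs by (auto simp: diagonal_ifs_def)

lemma r_bounds: "0 < r i" "r i < 1"
proof -
  obtain a where "a \<in> digits" using digits_ne by auto
  then show "0 < r i" "r i < 1" using ifs_ratio_bounds[OF ifs] ratio by metis+
qed

text \<open>At a given level an approximate cube still depends on exactly those coordinates that
  contract slowly, see \<open>upclosed_lv\<close>. The nonempty sets of this kind are the sets in
  \<open>good\<close>.\<close>

definition upclosed :: "'n set \<Rightarrow> bool" where
  "upclosed J \<longleftrightarrow> (\<forall>i\<in>J. \<forall>j. r i \<le> r j \<longrightarrow> j \<in> J)"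

lemma upclosed_eq:
  assumes "upclosed J" "i \<in> J" "\<And>j. j \<in> J \<Longrightarrow> r i \<le> r j"
  shows "J = {j. r i \<le> r j}"
  using assms unfolding upclosed_def by blast

text \<open>Induction on the number of coordinates added: the one of smallest ratio is dropped, and
  by \<open>fibre\<close> every remaining pattern has exactly \<open>m i\<close> extensions. Hence
  the count does not depend on the digit \<open>a\<close>.\<close>

lemma card_ext:
  assumes J: "upclosed J" and a: "a \<in> digits"
  shows "upclosed J' \<Longrightarrow> J \<subseteq> J' \<Longrightarrow>
    card ((\<lambda>b. restrict b J') ` {b \<in> digits. \<forall>j\<in>J. b j = a j}) = (\<Prod>i\<in>J' - J. m i)"
proof (induction "card (J' - J)" arbitrary: J')
  case 0
  then have "J' = J" by auto
  moreover have "(\<lambda>b. restrict b J) ` {b \<in> digits. \<forall>j\<in>J. b j = a j} = {restrict a J}"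
    using a by (auto simp: fun_eq_iff image_iff restrict_def)
  ultimately show ?case by (simp only: Diff_cancel prod.empty card_1_singleton_iff One_nat_def) blast
next
  case (Suc n)
  then have ne: "J' - J \<noteq> {}" by (metis card.empty nat.distinct(1))
  obtain i where i: "i \<in> J' - J" "\<And>j. j \<in> J' - J \<Longrightarrow> r i \<le> r j"
    using finite_obtain_min[of "J' - J" r] ne by auto
  \<comment> \<open>Minimality over \<open>J' - J\<close> extends to \<open>J'\<close>: a ratio in
    \<open>J\<close> that is at most \<open>r i\<close> would force \<open>i\<close> into the
    upclosed set \<open>J\<close>.\<close>
  have le: "r i \<le> r j" if "j \<in> J'" for j
  proof (cases "j \<in> J")
    case True
    then show ?thesis using J i(1) unfolding upclosed_def by (metis DiffD2 linear)
  qed (use i that in auto)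
  have J': "J' = {j. r i \<le> r j}" using upclosed_eq[OF Suc.prems(1)] i le by blast
  define J'' where "J'' = J' - {i}"
  have J'': "J'' = {j. r i < r j}"
    using inj_r unfolding J''_def J' by (auto simp: less_le inj_def)
  have up: "upclosed J''" unfolding upclosed_def J'' by auto
  have sub: "J \<subseteq> J''" using Suc.prems i by (auto simp: J''_def)
  have "n = card (J'' - J)"
  proof -
    have "J'' - J = (J' - J) - {i}" by (auto simp: J''_def)
    then show ?thesis using Suc.hyps(2) i(1) by simp
  qed
  then have IH: "card ((\<lambda>b. restrict b J'') ` {b \<in> digits. \<forall>j\<in>J. b j = a j}) = (\<Prod>i\<in>J'' - J. m i)"
    using Suc.hyps(1)[OF _ up sub] by simp
  define A where "A = (\<lambda>b. restrict b J') ` {b \<in> digits. \<forall>j\<in>J. b j = a j}"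
  have finA: "finite A" unfolding A_def using finite_digits by auto
  have r2: "restrict (restrict b J') J'' = restrict b J''" for b :: "'n \<Rightarrow> 'b"
    by (auto simp: J''_def restrict_def fun_eq_iff)
  have im: "(\<lambda>u. restrict u J'') ` A = (\<lambda>b. restrict b J'') ` {b \<in> digits. \<forall>j\<in>J. b j = a j}"
    unfolding A_def image_image r2 ..
  have "card A = (\<Sum>v\<in>(\<lambda>u. restrict u J'') ` A. card {u \<in> A. restrict u J'' = v})"
    unfolding card_eq_sum by (rule sum.image_gen[OF finA])
  also have "\<dots> = (\<Sum>v\<in>(\<lambda>u. restrict u J'') ` A. m i)"
  proof (rule sum.cong[OF refl])
    fix v assume "v \<in> (\<lambda>u. restrict u J'') ` A"
    then obtain b where b: "b \<in> digits" "\<forall>j\<in>J. b j = a j" "v = restrict b J''"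
      unfolding im by auto
    have "{u \<in> A. restrict u J'' = v} = (\<lambda>b. restrict b J') ` {c \<in> digits. \<forall>j. r i < r j \<longrightarrow> c j = b j}"
    proof (intro equalityI subsetI)
      fix u assume "u \<in> {u \<in> A. restrict u J'' = v}"
      then obtain c where c: "c \<in> digits" "u = restrict c J'" "restrict c J'' = restrict b J''"
        unfolding A_def b(3) using r2 by auto
      have "c j = b j" if "r i < r j" for j
        using fun_cong[OF c(3), of j] that by (simp add: J'')
      then show "u \<in> (\<lambda>b. restrict b J') ` {c \<in> digits. \<forall>j. r i < r j \<longrightarrow> c j = b j}"
        using c by auto
    next
      fix u assume "u \<in> (\<lambda>b. restrict b J') ` {c \<in> digits. \<forall>j. r i < r j \<longrightarrow> c j = b j}"
      then obtain c where c: "c \<in> digits" "u = restrict c J'" "\<forall>j. r i < r j \<longrightarrow> c j = b j" by auto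
      have "\<forall>j\<in>J. c j = a j" using c(3) b(2) sub unfolding J'' by auto
      moreover have "restrict u J'' = v" unfolding c(2) r2 b(3) using c(3) by (auto simp: J'' restrict_def fun_eq_iff)
      ultimately show "u \<in> {u \<in> A. restrict u J'' = v}" unfolding A_def using c by auto
    qed
    then show "card {u \<in> A. restrict u J'' = v} = m i" using fibre[OF b(1), of i] by (simp add: J')
  qed
  also have "\<dots> = (\<Prod>i\<in>J'' - J. m i) * m i" using IH by (simp add: im)
  also have "\<dots> = (\<Prod>i\<in>J' - J. m i)"
  proof -
    have "J' - J = insert i (J'' - J)" using i(1) by (auto simp: J''_def)
    moreover have "i \<notin> J'' - J" by (auto simp: J''_def)
    ultimately show ?thesis by (simp add: mult.commute)
  qed
  finally show ?case by (simp add: A_def)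
qed

text \<open>The coordinate \<open>j\<close> may not depend on the points \<open>x\<close> and
  \<open>y\<close>: this lets a difference between two digits be read off in a single coordinate, at
  the scale of that coordinate.\<close>

definition gap_const :: "real \<Rightarrow> bool" where
  "gap_const \<eta> \<longleftrightarrow> 0 < \<eta> \<and> \<eta> \<le> 1 \<and>
    (\<forall>J. \<forall>a\<in>digits. \<forall>b\<in>digits. upclosed J \<longrightarrow> restrict a J \<noteq> restrict b J \<longrightarrow>
      (\<exists>j\<in>J. \<forall>x\<in>{0..1}. \<forall>y\<in>{0..1}. \<eta> \<le> \<bar>base_map \<Psi> j (a j) x - base_map \<Psi> j (b j) y\<bar>))"

lemma gap_constD:
  assumes "gap_const \<eta>"
  shows "0 < \<eta>" "\<eta> \<le> 1"
    "upclosed J \<Longrightarrow> a \<in> digits \<Longrightarrow> b \<in> digits \<Longrightarrow> restrict a J \<noteq> restrict b J \<Longrightarrow>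
      \<exists>j\<in>J. \<forall>x\<in>{0..1}. \<forall>y\<in>{0..1}. \<eta> \<le> \<bar>base_map \<Psi> j (a j) x - base_map \<Psi> j (b j) y\<bar>"
  using assms unfolding gap_const_def by blast+

text \<open>Two disjoint products of compact intervals are already disjoint in one factor, and there
  at positive distance. Finitely many pairs of digits and sets \<open>J\<close> occur, so one
  \<open>\<eta>\<close> serves all.\<close>

lemma ex_gap_const: "\<exists>\<eta>. gap_const \<eta>"
proof -
  define Q where "Q = (\<lambda>(J, a, b) \<eta>. \<exists>j\<in>J. \<forall>x\<in>{0..1}. \<forall>y\<in>{0..1}. \<eta> \<le> \<bar>base_map \<Psi> j (a j) x - base_map \<Psi> j (b j) y\<bar>)"
  define T where "T = {(J, a, b). upclosed J \<and> a \<in> digits \<and> b \<in> digits \<and> restrict a J \<noteq> restrict b J}"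
  have finT: "finite T"
  proof (rule finite_subset)
    show "T \<subseteq> UNIV \<times> digits \<times> digits" unfolding T_def by auto
    show "finite ((UNIV :: 'n set set) \<times> digits \<times> digits)"
      using finite_digits by (intro finite_cartesian_product) auto
  qed
  have ex: "\<exists>\<eta>>0. Q t \<eta>" if "t \<in> T" for t
  proof -
    obtain J a b where t: "t = (J, a, b)" and J: "upclosed J"
      and a: "a \<in> digits" and b: "b \<in> digits" and ne: "restrict a J \<noteq> restrict b J"
      using \<open>t \<in> T\<close> unfolding T_def by auto
    have "J \<noteq> {}" using ne by auto
    then obtain i where i: "i \<in> J" "\<And>j. j \<in> J \<Longrightarrow> r i \<le> r j"
      using finite_obtain_min[of J r] by auto
    have Je: "J = {j. r i \<le> r j}" by (rule upclosed_eq[OF J i])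
    have dj: "disjoint_images \<Psi> {0..1} J" using good[of i] by (simp add: strongly_good_set_def Je)
    have "\<exists>j\<in>J. base_map \<Psi> j (a j) ` {0..1} \<inter> base_map \<Psi> j (b j) ` {0..1} = {}"
    proof (rule ccontr)
      assume "\<not> ?thesis"
      then have "\<forall>j\<in>J. \<exists>x y. x \<in> {0..1} \<and> y \<in> {0..1} \<and> base_map \<Psi> j (a j) x = base_map \<Psi> j (b j) y"
        by blast
      then obtain x y where xy: "\<And>j. j \<in> J \<Longrightarrow> x j \<in> {0..1}" "\<And>j. j \<in> J \<Longrightarrow> y j \<in> {0..1}"
        "\<And>j. j \<in> J \<Longrightarrow> base_map \<Psi> j (a j) (x j) = base_map \<Psi> j (b j) (y j)" by metis
      have "sub_map \<Psi> J (restrict a J) (restrict x J) = sub_map \<Psi> J (restrict b J) (restrict y J)"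
        unfolding sub_map_def using xy(3) by (auto simp: fun_eq_iff)
      moreover have "restrict x J \<in> J \<rightarrow>\<^sub>E {0..1}" "restrict y J \<in> J \<rightarrow>\<^sub>E {0..1}" using xy(1,2) by auto
      ultimately have "sub_map \<Psi> J (restrict a J) ` (J \<rightarrow>\<^sub>E {0..1}) \<inter> sub_map \<Psi> J (restrict b J) ` (J \<rightarrow>\<^sub>E {0..1}) \<noteq> {}"
        by (metis (no_types, lifting) IntI empty_iff imageI)
      then show False using dj ne a b unfolding disjoint_images_def disjoint_family_on_def by blast
    qed
    then obtain j where j: "j \<in> J" "base_map \<Psi> j (a j) ` {0..1} \<inter> base_map \<Psi> j (b j) ` {0..1} = {}" by auto
    have comp: "compact (base_map \<Psi> j (c j) ` {0..1})" if "c \<in> digits" for c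
    proof (rule compact_continuous_image)
      have s: "contracting_similarity (base_map \<Psi> j (c j))" using diagonal_ifs_sim[OF ifs that] .
      show "continuous_on {0..1} (base_map \<Psi> j (c j))"
        by (rule lipschitz_on_continuous_on[of "contraction_ratio (base_map \<Psi> j (c j))"], rule lipschitz_onI)
          (use contracting_similarity_dist[OF s] contraction_ratio_bounds[OF s] in \<open>auto simp: dist_real_def\<close>)
    qed auto
    obtain d where d: "d > 0" "\<forall>x\<in>base_map \<Psi> j (a j) ` {0..1}. \<forall>y\<in>base_map \<Psi> j (b j) ` {0..1}. d \<le> dist x y"
      using separate_compact_closed[OF comp[OF a] compact_imp_closed[OF comp[OF b]] j(2)] by auto
    then show ?thesis unfolding t Q_def using j(1) by (intro exI[of _ d]) (auto simp: dist_real_def)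
  qed
  then obtain e where e: "\<And>t. t \<in> T \<Longrightarrow> e t > 0" "\<And>t. t \<in> T \<Longrightarrow> Q t (e t)" by metis
  \<comment> \<open>The inserted 1 provides \<open>\<eta> \<le> 1\<close> and a nonempty set for
    \<open>Min\<close>.\<close>
  define \<eta> where "\<eta> = Min (insert 1 (e ` T))"
  have 1: "\<eta> > 0" unfolding \<eta>_def using finT e by (subst Min_gr_iff) auto
  have 2: "\<eta> \<le> 1" unfolding \<eta>_def using finT by (intro Min_le) auto
  have 3: "Q t \<eta>" if "t \<in> T" for t
  proof -
    have "\<eta> \<le> e t" unfolding \<eta>_def using finT that by (intro Min_le) auto
    then show ?thesis using e(2)[OF that] unfolding Q_def by (auto split: prod.splits) (meson order_trans atLeastAtMost_iff)
  qed
  have "gap_const \<eta>"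
    unfolding gap_const_def using 1 2 3 by (auto simp: T_def Q_def)
  then show ?thesis ..
qed

section \<open>Distances between coded points, and approximate cubes\<close>

lemma prod_ratio:
  assumes "\<And>k. \<omega> k \<in> digits"
  shows "(\<Prod>k<n. contraction_ratio (base_map \<Psi> i (\<omega> k i))) = r i ^ n"
  using ratio[OF assms] by (simp add: ifs_ratio_def)

abbreviation "point \<equiv> coding_map \<Psi>"

lemma coding_dist_le:
  assumes w: "\<And>k. \<omega> k \<in> digits" "\<And>k. \<tau> k \<in> digits"
    and eq: "\<And>k. k < n \<Longrightarrow> \<omega> k i = \<tau> k i"
  shows "\<bar>point \<omega> $ i - point \<tau> $ i\<bar> \<le> r i ^ n"
proof -
  interpret similarity_seq "coord \<Psi> \<omega> i" "ratio_bound \<Psi>"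
    by (rule similarity_seq_coordinate[OF ifs w(1)])
  have s: "scomp (coord \<Psi> \<tau> i) n = scomp (coord \<Psi> \<omega> i) n"
    by (rule scomp_cong) (use eq in auto)
  have m: "point (\<lambda>k. \<omega> (n + k)) $ i \<in> {0..1}" "point (\<lambda>k. \<tau> (n + k)) $ i \<in> {0..1}"
    using coding_map_mem[OF ifs] w by auto
  have "\<bar>point \<omega> $ i - point \<tau> $ i\<bar> =
    r i ^ n * \<bar>point (\<lambda>k. \<omega> (n + k)) $ i - point (\<lambda>k. \<tau> (n + k)) $ i\<bar>"
    by (subst (1) coding_map_shift_nth[OF ifs w(1), where i = i and n = n],
        subst (1) coding_map_shift_nth[OF ifs w(2), where i = i and n = n])
      (simp add: s scomp_dist[OF m] prod_ratio[where \<omega> = \<omega>, OF w(1)])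
  also have "\<dots> \<le> r i ^ n * 1"
    by (rule mult_left_mono) (use m r_bounds[of i] in auto)
  finally show ?thesis by simp
qed

text \<open>Once the common prefix is removed, the next symbols put the points into images at
  distance at least \<open>\<eta>\<close>; the prefix scales this by \<open>r i ^ n\<close>.\<close>

lemma coding_dist_ge:
  assumes w: "\<And>k. \<omega> k \<in> digits" "\<And>k. \<tau> k \<in> digits"
    and eq: "\<And>k. k < n \<Longrightarrow> \<omega> k i = \<tau> k i"
    and gap: "\<forall>x\<in>{0..1}. \<forall>y\<in>{0..1}. \<eta> \<le> \<bar>base_map \<Psi> i (\<omega> n i) x - base_map \<Psi> i (\<tau> n i) y\<bar>"
  shows "\<eta> * r i ^ n \<le> \<bar>point \<omega> $ i - point \<tau> $ i\<bar>"
proof -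
  interpret similarity_seq "coord \<Psi> \<omega> i" "ratio_bound \<Psi>"
    by (rule similarity_seq_coordinate[OF ifs w(1)])
  have s: "scomp (coord \<Psi> \<tau> i) n = scomp (coord \<Psi> \<omega> i) n"
    by (rule scomp_cong) (use eq in auto)
  define u v where "u = point (\<lambda>k. \<omega> (n + k)) $ i" and "v = point (\<lambda>k. \<tau> (n + k)) $ i"
  have m: "u \<in> {0..1}" "v \<in> {0..1}"
    unfolding u_def v_def using coding_map_mem[OF ifs] w by auto
  have u: "u = base_map \<Psi> i (\<omega> n i) (point (\<lambda>k. \<omega> (n + (1 + k))) $ i)"
    unfolding u_def by (subst coding_map_shift_nth[where n = 1]) (auto simp: ifs w)
  have v: "v = base_map \<Psi> i (\<tau> n i) (point (\<lambda>k. \<tau> (n + (1 + k))) $ i)"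
    unfolding v_def by (subst coding_map_shift_nth[where n = 1]) (auto simp: ifs w)
  have "\<eta> \<le> \<bar>u - v\<bar>"
    unfolding u v by (rule gap[rule_format]) (rule coding_map_mem[OF ifs], simp add: w)+
  then have "\<eta> * r i ^ n \<le> r i ^ n * \<bar>u - v\<bar>" using r_bounds[of i] by (simp add: mult.commute)
  also have "\<dots> = \<bar>point \<omega> $ i - point \<tau> $ i\<bar>"
    by (subst (1) coding_map_shift_nth[OF ifs w(1), where i = i and n = n],
        subst (1) coding_map_shift_nth[OF ifs w(2), where i = i and n = n])
      (simp add: s u_def[symmetric] v_def[symmetric] scomp_dist[OF m] prod_ratio[where \<omega> = \<omega>, OF w(1)])
  finally show ?thesis .
qed

text \<open>The number of symbols after which side \<open>i\<close> of a cylinder has length at most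
  \<open>t\<close>. Fixing \<open>lv t i\<close> symbols in each coordinate \<open>i\<close> yields
  an approximate cube of side \<open>t\<close>.\<close>

definition lv :: "real \<Rightarrow> 'n \<Rightarrow> nat" where
  "lv t i = (LEAST l. r i ^ l \<le> t)"

lemma lv_iff:
  assumes "0 < t" shows "k < lv t i \<longleftrightarrow> t < r i ^ k"
proof -
  have "\<exists>l. r i ^ l \<le> t"
    using real_arch_pow_inv[OF assms r_bounds(2)[of i]] by (auto intro: less_imp_le)
  then have 1: "r i ^ lv t i \<le> t" unfolding lv_def by (rule LeastI_ex)
  have 2: "r i ^ k \<le> t \<Longrightarrow> lv t i \<le> k" for k unfolding lv_def by (rule Least_le)
  have 3: "lv t i \<le> k \<Longrightarrow> r i ^ k \<le> t"
    by (rule order_trans[OF power_decreasing[of "lv t i" k "r i"] 1]) (use r_bounds[of i] in auto)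
  show ?thesis using 2 3 by (meson not_le)
qed

lemma lv_le: "0 < t \<Longrightarrow> r i ^ lv t i \<le> t"
  using lv_iff[of t "lv t i" i] by simp

lemma upclosed_lv: "0 < t \<Longrightarrow> upclosed {i. k < lv t i}"
  unfolding upclosed_def by (auto simp: lv_iff) (meson less_imp_le less_le_trans power_mono r_bounds(1))

lemma lv_ge_log:
  assumes "0 < t" shows "- ln t / - ln (r i) \<le> lv t i"
proof -
  have "ln (r i ^ lv t i) \<le> ln t" using lv_le[OF assms, of i] r_bounds[of i] assms by simp
  moreover have "ln (r i) < 0" using r_bounds[of i] by simp
  ultimately show ?thesis using r_bounds[of i] by (simp add: ln_realpow neg_divide_le_eq divide_le_eq)
qed

lemma lv_le_log:
  assumes "0 < t" "t \<le> 1" shows "lv t i \<le> - ln t / - ln (r i) + 1"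
proof (cases "lv t i")
  case 0
  have "0 \<le> - ln t / - ln (r i)" using assms r_bounds[of i] by (intro divide_nonneg_nonneg) auto
  then show ?thesis using 0 by simp
next
  case (Suc n)
  then have "t < r i ^ n" using lv_iff[OF assms(1), of n i] by simp
  then have "ln t < n * ln (r i)" using assms r_bounds[of i] ln_less_cancel_iff[of t "r i ^ n"] by (simp add: ln_realpow)
  moreover have "ln (r i) < 0" using r_bounds[of i] by simp
  ultimately have "n < ln t / ln (r i)" by (simp add: neg_less_divide_eq)
  then show ?thesis using Suc by simp
qed

text \<open>Counting by levels becomes counting by coordinates: coordinate \<open>i\<close>
  contributes a factor \<open>m i\<close> at each level in \<open>{l i..<l' i}\<close>. The
  truncated subtraction is intended, an empty range contributing 1.\<close>

lemma prod_levels: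
  assumes "\<And>i. l' i \<le> K"
  shows "(\<Prod>k<K. \<Prod>i\<in>{i. l i \<le> k \<and> k < l' i}. m i) = (\<Prod>i\<in>UNIV. m i ^ (l' i - l i))"
proof -
  have "(\<Prod>k<K. \<Prod>i\<in>{i. l i \<le> k \<and> k < l' i}. m i) = (\<Prod>k<K. \<Prod>i\<in>UNIV. if l i \<le> k \<and> k < l' i then m i else 1)"
    by (simp add: prod.If_cases)
  also have "\<dots> = (\<Prod>i\<in>UNIV. \<Prod>k<K. if l i \<le> k \<and> k < l' i then m i else 1)" by (rule prod.swap)
  also have "\<dots> = (\<Prod>i\<in>UNIV. m i ^ (l' i - l i))"
  proof (rule prod.cong[OF refl])
    fix i
    have "{..<K} \<inter> {k. l i \<le> k \<and> k < l' i} = {l i..<l' i}" using assms[of i] by auto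
    then show "(\<Prod>k<K. if l i \<le> k \<and> k < l' i then m i else 1) = m i ^ (l' i - l i)"
      by (simp add: prod.If_cases)
  qed
  finally show ?thesis .
qed

lemma dist_le_card:
  fixes x y :: "real ^ 'n"
  assumes "\<And>i. \<bar>x $ i - y $ i\<bar> \<le> t / CARD('n)"
  shows "dist x y \<le> t"
proof -
  have "dist x y \<le> (\<Sum>i\<in>UNIV. \<bar>(x - y) $ i\<bar>)" unfolding dist_norm by (rule norm_le_l1_cart)
  also have "\<dots> \<le> (\<Sum>i\<in>(UNIV :: 'n set). t / CARD('n))" using assms by (intro sum_mono) auto
  finally show ?thesis by simp
qed

lemma limit_setD: "x \<in> limit_set \<Psi> \<Longrightarrow> \<exists>\<omega>. (\<forall>k. \<omega> k \<in> digits) \<and> x = point \<omega>"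
  unfolding limit_set_def by (auto simp: Pi_def)

lemma limit_setI: "(\<And>k. \<omega> k \<in> digits) \<Longrightarrow> point \<omega> \<in> limit_set \<Psi>"
  unfolding limit_set_def by auto

text \<open>Separated points have different approximate cubes, and these are counted level by level
  with \<open>card_ext\<close>, nothing being prescribed.\<close>

lemma card_separated_le:
  assumes t: "0 < t" and T: "T \<subseteq> limit_set \<Psi>" "finite T" "separated t T"
  shows "card T \<le> (\<Prod>i\<in>UNIV. m i ^ lv (t / (2 * CARD('n))) i)"
proof -
  \<comment> \<open>The dimension in the denominator turns coordinate bounds into a bound for
    \<open>dist\<close>; the 2 leaves \<open>t / 2\<close>, strictly below the separation
    \<open>t\<close>.\<close>
  define u where "u = t / (2 * CARD('n))"
  have u: "u > 0" using t by (simp add: u_def)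
  define J where "J = (\<lambda>k. {i. k < lv u i})"
  define K where "K = Max (range (lv u))"
  have K: "lv u i \<le> K" for i unfolding K_def by (rule Max_ge) auto
  obtain w where w: "\<And>x k. x \<in> T \<Longrightarrow> w x k \<in> digits" "\<And>x. x \<in> T \<Longrightarrow> x = point (w x)"
  proof -
    have "\<forall>x\<in>T. \<exists>\<omega>. (\<forall>k. \<omega> k \<in> digits) \<and> x = point \<omega>"
      using T(1) limit_setD by blast
    from bchoice[OF this] show ?thesis using that by blast
  qed
  define D where "D = (\<lambda>x. \<lambda>k\<in>{..<K}. restrict (w x k) (J k))"
  have inj: "inj_on D T"
  proof (rule inj_onI, rule ccontr)
    fix x y assume xy: "x \<in> T" "y \<in> T" "D x = D y" "x \<noteq> y"
    have "\<bar>x $ i - y $ i\<bar> \<le> (t / 2) / CARD('n)" for i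
    proof -
      have "w x k i = w y k i" if "k < lv u i" for k
      proof -
        have "k < K" using that K[of i] by simp
        then have "restrict (w x k) (J k) = restrict (w y k) (J k)"
          using fun_cong[OF xy(3), of k] by (simp add: D_def)
        from fun_cong[OF this, of i] that show ?thesis by (simp add: J_def)
      qed
      then have "\<bar>point (w x) $ i - point (w y) $ i\<bar> \<le> r i ^ lv u i"
        by (rule coding_dist_le[OF w(1)[OF xy(1)] w(1)[OF xy(2)]])
      then have "\<bar>x $ i - y $ i\<bar> \<le> r i ^ lv u i"
        unfolding w(2)[OF xy(1), symmetric] w(2)[OF xy(2), symmetric] .
      then show ?thesis using lv_le[OF u, of i] by (simp add: u_def)
    qed
    then have "dist x y \<le> t / 2" by (rule dist_le_card)
    moreover have "t \<le> dist x y" using T(3) xy unfolding separated_def by blast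
    ultimately show False using t by simp
  qed
  obtain a where a: "a \<in> digits" using digits_ne by auto
  have "card T = card (D ` T)" using inj by (simp add: card_image)
  also have "\<dots> \<le> card (PiE {..<K} (\<lambda>k. (\<lambda>b. restrict b (J k)) ` digits))"
    by (rule card_mono) (use finite_digits w in \<open>auto intro!: finite_PiE simp: D_def\<close>)
  also have "\<dots> = (\<Prod>k<K. card ((\<lambda>b. restrict b (J k)) ` digits))" by (simp add: card_PiE)
  also have "\<dots> = (\<Prod>k<K. \<Prod>i\<in>{i. 0 \<le> k \<and> k < lv u i}. m i)"
    using card_ext[of "{}" a "J k" for k] a upclosed_lv[OF u] by (auto simp: J_def upclosed_def)
  also have "\<dots> = (\<Prod>i\<in>UNIV. m i ^ lv u i)" using prod_levels[of "lv u" K "\<lambda>_. 0"] K by simp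
  finally show ?thesis by (simp add: u_def)
qed

lemma separation_number_le:
  assumes "0 < t" "S \<subseteq> limit_set \<Psi>"
  shows "separation_number t S \<le> (\<Prod>i\<in>UNIV. m i ^ lv (t / (2 * CARD('n))) i)"
  unfolding separation_number_def
  by (rule cSup_least) (use card_separated_le[OF assms(1)] assms(2) in \<open>auto simp: separated_def intro: exI[of _ "{}"]\<close>)

lemma card_le_separation_number:
  assumes "0 < t" "S \<subseteq> limit_set \<Psi>" "T \<subseteq> S" "finite T" "separated t T"
  shows "card T \<le> separation_number t S"
  unfolding separation_number_def
proof (rule cSup_upper)
  show "bdd_above {card T | T. T \<subseteq> S \<and> finite T \<and> separated t T}"
  proof (rule bdd_aboveI[where M = "\<Prod>i\<in>UNIV. m i ^ lv (t / (2 * CARD('n))) i"])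
    fix n assume "n \<in> {card T | T. T \<subseteq> S \<and> finite T \<and> separated t T}"
    then obtain T' where T': "n = card T'" "T' \<subseteq> S" "finite T'" "separated t T'" by auto
    show "n \<le> (\<Prod>i\<in>UNIV. m i ^ lv (t / (2 * CARD('n))) i)"
      unfolding T'(1) by (rule card_separated_le[OF assms(1) _ T'(3,4)]) (use T'(2) assms(2) in simp)
  qed
qed (use assms in blast)

text \<open>The Ledrappier--Young sum for the uniform distribution on the digits:
  \<open>ln (m i)\<close> is the entropy gained by coordinate \<open>i\<close>, and
  \<open>- ln (r i)\<close> its Lyapunov exponent.\<close>

definition dimval :: real where
  "dimval = (\<Sum>i\<in>UNIV. ln (m i) / - ln (r i))"

lemma exp_bound_factor: "real (m i) ^ n = exp (ln (m i) * real n)"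
  using m_ge[of i] by (simp add: exp_of_nat_mult mult.commute)

lemma ln_m_nonneg: "0 \<le> ln (real (m i))"
  using m_ge[of i] by simp

text \<open>The symbols of \<open>x\<close> that fix its approximate cube of side \<open>t1\<close>
  are kept, which keeps the point in the ball; the further ones visible at scale \<open>t2\<close>
  are varied freely. Different choices are separated at the first level where they differ.\<close>

lemma separation_number_ge:
  obtains c where "0 < c"
    "\<And>x \<beta> \<rho>. x \<in> limit_set \<Psi> \<Longrightarrow> 0 < \<beta> \<Longrightarrow> \<beta> \<le> 1 \<Longrightarrow> 0 < \<rho> \<Longrightarrow> \<rho> \<le> 1 \<Longrightarrow>
      c * \<beta> powr (- dimval) \<le> separation_number (\<beta> * \<rho>) (cball x \<rho> \<inter> limit_set \<Psi>)"
proof -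
  obtain \<eta> where gc: "gap_const \<eta>" using ex_gap_const ..
  note \<eta> = gap_constD(1,2)[OF gc] and sep = gap_constD(3)[OF gc]
  define d where "d = real CARD('n)"
  have d: "d \<ge> 1" by (simp add: d_def)
  \<comment> \<open>The loss in levels of coordinate \<open>i\<close>: 1 for rounding, the rest from
    the factors \<open>d\<close> and \<open>\<eta>\<close> in \<open>t1\<close> and
    \<open>t2\<close>. It is free of \<open>\<rho>\<close>, which cancels in
    \<open>t2 / t1\<close>.\<close>
  define C where "C = (\<lambda>i. 1 - ln (\<eta> / d) / - ln (r i))"
  define c where "c = exp (- (\<Sum>i\<in>UNIV. ln (m i) * C i))"
  have "c * \<beta> powr (- dimval) \<le> separation_number (\<beta> * \<rho>) (cball x \<rho> \<inter> limit_set \<Psi>)"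
    if x: "x \<in> limit_set \<Psi>" and \<beta>: "0 < \<beta>" "\<beta> \<le> 1" and \<rho>: "0 < \<rho>" "\<rho> \<le> 1" for x \<beta> \<rho>
  proof -
    obtain \<omega> where \<omega>: "\<And>k. \<omega> k \<in> digits" "x = point \<omega>" using limit_setD[OF x] by blast
    define t1 t2 where "t1 = \<rho> / d" and "t2 = \<beta> * \<rho> / \<eta>"
    have t1: "0 < t1" "t1 \<le> 1" using \<rho> d by (auto simp: t1_def divide_le_eq)
    have t2: "0 < t2" using \<rho> \<beta> \<eta> by (simp add: t2_def)
    define K where "K = Max (range (lv t2))"
    have K: "lv t2 i \<le> K" for i unfolding K_def by (rule Max_ge) auto
    \<comment> \<open>For \<open>\<beta>\<close> close to 1 the scale \<open>t2\<close> can exceed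
      \<open>t1\<close>; the union keeps \<open>J k \<subseteq> J' k\<close> in that case
      too.\<close>
    define J J' where "J = (\<lambda>k. {i. k < lv t1 i})" and "J' = (\<lambda>k. J k \<union> {i. k < lv t2 i})"
    have up: "upclosed (J k)" "upclosed (J' k)" for k
      using upclosed_lv[OF t1(1)] upclosed_lv[OF t2] unfolding J_def J'_def upclosed_def by blast+
    define B where "B = (\<lambda>k. {b \<in> digits. \<forall>j\<in>J k. b j = \<omega> k j})"
    \<comment> \<open>A set of representatives: one digit for each pattern on \<open>J' k\<close>
      that is compatible with the symbols of \<open>x\<close> on \<open>J k\<close>.\<close>
    have "\<forall>k. \<exists>T. T \<subseteq> B k \<and> inj_on (\<lambda>b. restrict b (J' k)) T \<and>
        (\<lambda>b. restrict b (J' k)) ` B k = (\<lambda>b. restrict b (J' k)) ` T"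
      using subset_image_inj by blast
    from choice[OF this] obtain T where T': "\<forall>k. T k \<subseteq> B k \<and> inj_on (\<lambda>b. restrict b (J' k)) (T k) \<and>
        (\<lambda>b. restrict b (J' k)) ` B k = (\<lambda>b. restrict b (J' k)) ` T k" ..
    have T: "T k \<subseteq> {b \<in> digits. \<forall>j\<in>J k. b j = \<omega> k j}"
      "inj_on (\<lambda>b. restrict b (J' k)) (T k)" "card (T k) = (\<Prod>i\<in>J' k - J k. m i)" for k
    proof -
      show "T k \<subseteq> {b \<in> digits. \<forall>j\<in>J k. b j = \<omega> k j}" "inj_on (\<lambda>b. restrict b (J' k)) (T k)"
        using T' by (auto simp: B_def)
      then have "card (T k) = card ((\<lambda>b. restrict b (J' k)) ` B k)"
        using T' by (metis card_image)
      then show "card (T k) = (\<Prod>i\<in>J' k - J k. m i)"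
        using card_ext[OF up(1) \<omega>(1) up(2), of k k k] by (simp add: B_def J'_def)
    qed
    have TW: "b \<in> digits" and TJ: "j \<in> J k \<Longrightarrow> b j = \<omega> k j" if "b \<in> T k" for b j k
      using T(1)[of k] that by auto
    have finT: "finite (T k)" for k by (rule finite_subset[OF T(1)]) (use finite_digits in auto)
    define P where "P = PiE {..<K} T"
    define ext where "ext = (\<lambda>\<tau> k. if k < K then \<tau> k else \<omega> k)"
    have ext_W: "ext \<tau> k \<in> digits" if "\<tau> \<in> P" for \<tau> k
      using that TW[of "\<tau> k" k] \<omega>(1) by (auto simp: ext_def P_def)
    have ext_J: "ext \<tau> k j = \<omega> k j" if "\<tau> \<in> P" "j \<in> J k" for \<tau> k j
      using that TJ[of "\<tau> k" k j] by (auto simp: ext_def P_def)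
    have ball: "dist x (point (ext \<tau>)) \<le> \<rho>" if "\<tau> \<in> P" for \<tau>
    proof (rule dist_le_card)
      fix i
      have "\<bar>point \<omega> $ i - point (ext \<tau>) $ i\<bar> \<le> r i ^ lv t1 i"
        by (rule coding_dist_le) (use \<omega>(1) ext_W[OF that] ext_J[OF that] in \<open>auto simp: J_def\<close>)
      then show "\<bar>x $ i - point (ext \<tau>) $ i\<bar> \<le> \<rho> / CARD('n)"
        using lv_le[OF t1(1), of i] \<omega>(2) by (simp add: t1_def d_def)
    qed
    have far: "\<beta> * \<rho> < dist (point (ext \<tau>)) (point (ext \<tau>'))"
      if \<tau>: "\<tau> \<in> P" "\<tau>' \<in> P" "\<tau> \<noteq> \<tau>'" for \<tau> \<tau>'
    proof -
      have "\<exists>k. k < K \<and> \<tau> k \<noteq> \<tau>' k"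
        using \<tau> PiE_ext[of \<tau> "{..<K}" T \<tau>'] unfolding P_def by auto
      then obtain k where k: "k < K" "\<tau> k \<noteq> \<tau>' k" "\<And>l. l < k \<Longrightarrow> \<not> (l < K \<and> \<tau> l \<noteq> \<tau>' l)"
        using exists_least_iff[of "\<lambda>k. k < K \<and> \<tau> k \<noteq> \<tau>' k"] by blast
      have ki: "\<tau> k \<in> T k" "\<tau>' k \<in> T k" using \<tau> k(1) by (auto simp: P_def)
      then have "restrict (\<tau> k) (J' k) \<noteq> restrict (\<tau>' k) (J' k)"
        using inj_onD[OF T(2)] k(2) by blast
      moreover have W: "\<tau> k \<in> digits" "\<tau>' k \<in> digits" using ki TW by auto
      ultimately obtain j where j: "j \<in> J' k"
        "\<forall>x\<in>{0..1}. \<forall>y\<in>{0..1}. \<eta> \<le> \<bar>base_map \<Psi> j (\<tau> k j) x - base_map \<Psi> j (\<tau>' k j) y\<bar>"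
        using sep[OF up(2)] by blast
      \<comment> \<open>On \<open>J k\<close> all candidates share the symbol of \<open>x\<close>;
        the gap, tested at one common point, would then read \<open>\<eta> \<le> 0\<close>.\<close>
      have "j \<notin> J k"
      proof
        assume "j \<in> J k"
        then have "\<tau> k j = \<tau>' k j" using ki TJ[of "\<tau> k" k j] TJ[of "\<tau>' k" k j] by simp
        then show False using j(2)[rule_format, of 0 0] \<eta> by simp
      qed
      then have lt: "t2 < r j ^ k" using j(1) lv_iff[OF t2] by (auto simp: J'_def)
      have "\<beta> * \<rho> = \<eta> * t2" using \<eta> by (simp add: t2_def)
      also have "\<dots> < \<eta> * r j ^ k" using lt \<eta> by simp
      also have "\<dots> \<le> \<bar>point (ext \<tau>) $ j - point (ext \<tau>') $ j\<bar>"
        by (rule coding_dist_ge) (use ext_W \<tau> k j in \<open>auto simp: ext_def\<close>)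
      also have "\<dots> \<le> dist (point (ext \<tau>)) (point (ext \<tau>'))"
        using component_le_norm_cart[of "point (ext \<tau>) - point (ext \<tau>')" j]
        by (simp add: dist_norm)
      finally show ?thesis .
    qed
    define S where "S = (\<lambda>\<tau>. point (ext \<tau>)) ` P"
    have inj: "inj_on (\<lambda>\<tau>. point (ext \<tau>)) P"
    proof (rule inj_onI, rule ccontr)
      fix \<tau> \<tau>' assume "\<tau> \<in> P" "\<tau>' \<in> P" "point (ext \<tau>) = point (ext \<tau>')" "\<tau> \<noteq> \<tau>'"
      moreover have "0 < \<beta> * \<rho>" using \<beta> \<rho> by simp
      ultimately show False using far[of \<tau> \<tau>'] by simp
    qed
    have finS: "finite S" unfolding S_def P_def using finT by (intro finite_imageI finite_PiE) auto
    have "S \<subseteq> cball x \<rho> \<inter> limit_set \<Psi>"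
      unfolding S_def using ball ext_W limit_setI by auto
    moreover have "separated (\<beta> * \<rho>) S"
      unfolding separated_def S_def
    proof (intro ballI impI)
      fix x y assume "x \<in> (\<lambda>\<tau>. point (ext \<tau>)) ` P" "y \<in> (\<lambda>\<tau>. point (ext \<tau>)) ` P" "x \<noteq> y"
      then obtain \<tau> \<tau>' where "x = point (ext \<tau>)" "y = point (ext \<tau>')" "\<tau> \<in> P" "\<tau>' \<in> P" "\<tau> \<noteq> \<tau>'"
        by blast
      then show "\<beta> * \<rho> \<le> dist x y" using far[of \<tau> \<tau>'] by simp
    qed
    ultimately have "card S \<le> separation_number (\<beta> * \<rho>) (cball x \<rho> \<inter> limit_set \<Psi>)"
      using card_le_separation_number[of "\<beta> * \<rho>"] \<beta> \<rho> finS by simp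
    moreover have "card S = (\<Prod>i\<in>UNIV. m i ^ (lv t2 i - lv t1 i))"
    proof -
      have "card S = card P" unfolding S_def using inj by (rule card_image)
      also have "\<dots> = (\<Prod>k<K. \<Prod>i\<in>J' k - J k. m i)" by (simp add: P_def card_PiE T(3))
      also have "\<dots> = (\<Prod>k<K. \<Prod>i\<in>{i. lv t1 i \<le> k \<and> k < lv t2 i}. m i)"
        by (intro prod.cong refl) (auto simp: J_def J'_def)
      also have "\<dots> = (\<Prod>i\<in>UNIV. m i ^ (lv t2 i - lv t1 i))" by (rule prod_levels[OF K])
      finally show ?thesis .
    qed
    moreover have "c * \<beta> powr (- dimval) \<le> real (\<Prod>i\<in>UNIV. m i ^ (lv t2 i - lv t1 i))"
    proof -
      have "c * \<beta> powr (- dimval) = exp (- (\<Sum>i\<in>UNIV. ln (m i) * C i) - dimval * ln \<beta>)"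
        using \<beta> by (simp add: c_def powr_def exp_diff exp_minus divide_inverse)
      also have "- (\<Sum>i\<in>UNIV. ln (m i) * C i) - dimval * ln \<beta> =
          (\<Sum>i\<in>UNIV. ln (m i) * (- ln \<beta> / - ln (r i) - C i))"
      proof -
        have "(\<Sum>i\<in>UNIV. ln (m i) * (- ln \<beta> / - ln (r i) - C i)) =
            (\<Sum>i\<in>UNIV. - (ln (m i) * C i) - ln (m i) / - ln (r i) * ln \<beta>)"
          by (intro sum.cong refl) (simp add: algebra_simps)
        then show ?thesis by (simp only: dimval_def sum_distrib_right sum_subtractf sum_negf)
      qed
      also have "\<dots> \<le> (\<Sum>i\<in>UNIV. ln (m i) * real (lv t2 i - lv t1 i))"
      proof (intro sum_mono mult_left_mono ln_m_nonneg)
        fix i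
        have "lv t1 i \<le> - ln t1 / - ln (r i) + 1" by (rule lv_le_log[OF t1])
        moreover have "- ln t2 / - ln (r i) \<le> lv t2 i" by (rule lv_ge_log[OF t2])
        moreover have "- ln \<beta> / - ln (r i) - C i = - ln t2 / - ln (r i) - (- ln t1 / - ln (r i) + 1)"
          using \<beta> \<rho> \<eta> d r_bounds[of i]
          by (simp add: C_def t1_def t2_def ln_mult ln_div diff_divide_distrib add_divide_distrib)
        ultimately show "- ln \<beta> / - ln (r i) - C i \<le> real (lv t2 i - lv t1 i)" by linarith
      qed
      finally have "c * \<beta> powr (- dimval) \<le> exp (\<Sum>i\<in>UNIV. ln (m i) * real (lv t2 i - lv t1 i))" by simp
      also have "\<dots> = real (\<Prod>i\<in>UNIV. m i ^ (lv t2 i - lv t1 i))"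
        by (simp add: exp_sum exp_bound_factor)
      finally show ?thesis .
    qed
    ultimately show ?thesis using of_nat_mono order_trans by metis
  qed
  then show ?thesis using that[of c] by (simp add: c_def)
qed

text \<open>For the upper bound a single ball of radius 1 suffices: with
  \<open>\<beta> = exp (- L)\<close> the exponent \<open>s\<close> is compared with
  \<open>dimval\<close> up to constants, and \<open>L\<close> is made large.\<close>

lemma lower_assouad_dim_limit_set: "lower_assouad_dim (limit_set \<Psi>) = dimval"
  unfolding lower_assouad_dim_def
proof (rule cSup_eq_maximum)
  obtain c where "0 < c" "\<And>x \<beta> \<rho>. x \<in> limit_set \<Psi> \<Longrightarrow> 0 < \<beta> \<Longrightarrow> \<beta> \<le> 1 \<Longrightarrow> 0 < \<rho> \<Longrightarrow> \<rho> \<le> 1 \<Longrightarrow>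
      c * \<beta> powr (- dimval) \<le> separation_number (\<beta> * \<rho>) (cball x \<rho> \<inter> limit_set \<Psi>)"
    using separation_number_ge by blast
  moreover have "0 \<le> dimval"
    unfolding dimval_def using ln_m_nonneg r_bounds by (intro sum_nonneg divide_nonneg_nonneg) (auto intro: less_imp_le)
  ultimately show "dimval \<in> {s. 0 \<le> s \<and> (\<exists>c>0. \<forall>x\<in>limit_set \<Psi>. \<forall>\<beta>\<in>{0<..1}. \<forall>\<rho>\<in>{0<..1}.
            real (separation_number (\<beta> * \<rho>) (cball x \<rho> \<inter> limit_set \<Psi>)) \<ge> c * \<beta> powr (- s))}"
    by auto
next
  fix s assume "s \<in> {s. 0 \<le> s \<and> (\<exists>c>0. \<forall>x\<in>limit_set \<Psi>. \<forall>\<beta>\<in>{0<..1}. \<forall>\<rho>\<in>{0<..1}.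
            real (separation_number (\<beta> * \<rho>) (cball x \<rho> \<inter> limit_set \<Psi>)) \<ge> c * \<beta> powr (- s))}"
  then obtain c where c: "c > 0" "\<And>x \<beta> \<rho>. x \<in> limit_set \<Psi> \<Longrightarrow> 0 < \<beta> \<Longrightarrow> \<beta> \<le> 1 \<Longrightarrow> 0 < \<rho> \<Longrightarrow> \<rho> \<le> 1 \<Longrightarrow>
      c * \<beta> powr (- s) \<le> separation_number (\<beta> * \<rho>) (cball x \<rho> \<inter> limit_set \<Psi>)" by auto
  obtain a where "a \<in> digits" using digits_ne by auto
  then have x: "point (\<lambda>_. a) \<in> limit_set \<Psi>" by (intro limit_setI)
  define C where "C = (\<Sum>i\<in>UNIV. ln (m i) * (ln (2 * CARD('n)) / - ln (r i) + 1))"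
  have le: "ln c + s * L \<le> dimval * L + C" if L: "L \<ge> 0" for L
  proof -
    define \<beta> where "\<beta> = exp (- L)"
    define t where "t = \<beta> / (2 * CARD('n))"
    have \<beta>: "0 < \<beta>" "\<beta> \<le> 1" using L by (auto simp: \<beta>_def)
    have "1 \<le> real CARD('n)" by simp
    then have t: "0 < t" "t \<le> 1" using \<beta> by (auto simp: t_def divide_le_eq simp del: One_nat_def)
    have "exp (ln c + s * L) = c * \<beta> powr (- s)"
      using c(1) by (simp add: \<beta>_def powr_def exp_add)
    also have "\<dots> \<le> separation_number (\<beta> * 1) (cball (point (\<lambda>_. a)) 1 \<inter> limit_set \<Psi>)"
      by (rule c(2)[OF x]) (use \<beta> in auto)
    also have "\<dots> \<le> real (\<Prod>i\<in>UNIV. m i ^ lv t i)"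
      using separation_number_le[of "\<beta> * 1"] \<beta> unfolding t_def by (intro of_nat_mono) auto
    also have "\<dots> = exp (\<Sum>i\<in>UNIV. ln (m i) * real (lv t i))"
      by (simp add: exp_sum exp_bound_factor)
    also have "\<dots> \<le> exp (\<Sum>i\<in>UNIV. ln (m i) * (- ln t / - ln (r i) + 1))"
      using lv_le_log[OF t] ln_m_nonneg by (intro iffD2[OF exp_le_cancel_iff] sum_mono mult_left_mono) auto
    also have "(\<Sum>i\<in>UNIV. ln (m i) * (- ln t / - ln (r i) + 1)) = dimval * L + C"
    proof -
      have "- ln t = L + ln (2 * CARD('n))" by (simp add: t_def \<beta>_def ln_div)
      then show ?thesis
        unfolding dimval_def C_def sum_distrib_right sum.distrib[symmetric]
        by (intro sum.cong refl) (simp add: algebra_simps add_divide_distrib)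
    qed
    finally show ?thesis by simp
  qed
  show "s \<le> dimval"
  proof (rule ccontr)
    assume "\<not> s \<le> dimval"
    then have pos: "s - dimval > 0" by simp
    \<comment> \<open>Chosen so that \<open>(s - dimval) * L\<close> exceeds \<open>C - ln c\<close>
      by at least 1.\<close>
    define L where "L = (\<bar>C - ln c\<bar> + 1) / (s - dimval)"
    have "L \<ge> 0" using pos by (simp add: L_def)
    from le[OF this] have "(s - dimval) * L \<le> C - ln c" by (simp add: algebra_simps)
    moreover have "(s - dimval) * L = \<bar>C - ln c\<bar> + 1" using pos by (simp add: L_def)
    ultimately show False by linarith
  qed
qed

text \<open>Two points of the ball are produced that agree in the coordinates of larger ratio and
  differ by at least \<open>\<kappa> * \<rho>\<close> in coordinate \<open>i\<close>. If
  \<open>v $ i\<close> dominates the normal components of smaller ratio, then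
  \<open>v \<bullet> (y1 - y2)\<close> is too large for both points to be near the
  hyperplane.\<close>

lemma hyperplane_diffuse_limit_set: "hyperplane_diffuse (limit_set \<Psi>)"
proof -
  obtain \<eta> where gc: "gap_const \<eta>" using ex_gap_const ..
  note \<eta> = gap_constD(1,2)[OF gc]
  define d where "d = real CARD('n)"
  have d: "d \<ge> 1" by (simp add: d_def)
  define rm where "rm = Min (range r)"
  have rm: "0 < rm" "rm \<le> 1" "\<And>i. rm \<le> r i"
  proof -
    show "0 < rm" unfolding rm_def using r_bounds by (subst Min_gr_iff) auto
    show *: "\<And>i. rm \<le> r i" unfolding rm_def by (rule Min_le) auto
    show "rm \<le> 1" using *[of undefined] r_bounds(2)[of undefined] by simp
  qed
  \<comment> \<open>The displacement per unit of \<open>\<rho>\<close>: \<open>\<eta>\<close> is the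
    gap, \<open>rm\<close> appears because \<open>r i ^ lv t i\<close> may fall below
    \<open>t\<close> by one factor, and \<open>d\<close> comes from
    \<open>t = \<rho> / d\<close>.\<close>
  define \<kappa> where "\<kappa> = \<eta> * rm / d"
  have \<kappa>: "0 < \<kappa>" "\<kappa> \<le> 1"
  proof -
    show "0 < \<kappa>" using \<eta> rm d by (simp add: \<kappa>_def)
    have "\<eta> * rm \<le> 1 * 1" using \<eta> rm by (intro mult_mono) auto
    then show "\<kappa> \<le> 1" using d by (simp add: \<kappa>_def divide_le_eq)
  qed
  \<comment> \<open>With this \<open>M\<close> the coordinates other than \<open>i\<close>
    contribute at most half of the main term; the choice of \<open>\<beta>\<close> then makes the
    two distances to the hyperplane account for at most a quarter of it.\<close>
  define M where "M = 4 * d / \<kappa>"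
  have M: "M \<ge> 1" using \<kappa> d by (simp add: M_def le_divide_eq)
  define \<beta> where "\<beta> = \<kappa> / (8 * d * M ^ CARD('n))"
  have \<beta>: "\<beta> > 0" using \<kappa> d M by (simp add: \<beta>_def)
  have "(cball x \<rho> \<inter> limit_set \<Psi>) - {y. infdist y L \<le> \<beta> * \<rho>} \<noteq> {}"
    if \<rho>: "\<rho> \<in> {0<..1}" and x: "x \<in> limit_set \<Psi>" and L: "affine L" "aff_dim L = int DIM(real ^ 'n) - 1"
    for \<rho> x and L :: "(real ^ 'n) set"
  proof (rule ccontr)
    assume neg: "\<not> ?thesis"
    obtain v b where v: "v \<noteq> 0" and Lv: "L = {y. v \<bullet> y = b}"
    proof -
      have "affine hull L = L" using L(1) by (simp add: affine_hull_eq)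
      moreover have "aff_dim L = int (DIM(real ^ 'n) - 1)"
        using L(2) by (simp add: of_nat_diff Suc_leI)
      ultimately have "\<exists>v b. v \<noteq> 0 \<and> L = {y. v \<bullet> y = b}"
        using aff_dim_eq_hyperplane[of L] by (simp only:)
      then show ?thesis using that by blast
    qed
    \<comment> \<open>Varying coordinate \<open>i\<close> also moves the coordinates with smaller ratio; the weights \<open>M ^ rk\<close> select
      a coordinate whose normal component dominates those of all of them.\<close>
    define rk where "rk = (\<lambda>i. card {j. r i \<le> r j})"
    have rk_le: "rk i \<le> CARD('n)" for i unfolding rk_def by (rule card_mono) auto
    obtain i where i: "\<And>j. \<bar>v $ j\<bar> * M ^ rk j \<le> \<bar>v $ i\<bar> * M ^ rk i"
      using finite_obtain_min[of UNIV "\<lambda>i. - (\<bar>v $ i\<bar> * M ^ rk i)"] by auto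
    have later: "\<bar>v $ j\<bar> \<le> \<bar>v $ i\<bar> / M" if "r j < r i" for j
    proof -
      have "{k. r i \<le> r k} \<subseteq> {k. r j \<le> r k}" "j \<in> {k. r j \<le> r k}" "j \<notin> {k. r i \<le> r k}" using that by auto
      then have "{k. r i \<le> r k} \<subset> {k. r j \<le> r k}" by blast
      then have "Suc (rk i) \<le> rk j" unfolding rk_def by (simp add: psubset_card_mono Suc_le_eq)
      then have "\<bar>v $ j\<bar> * M ^ Suc (rk i) \<le> \<bar>v $ j\<bar> * M ^ rk j"
        using M by (intro mult_left_mono power_increasing) auto
      also note i[of j]
      finally have "(\<bar>v $ j\<bar> * M) * M ^ rk i \<le> \<bar>v $ i\<bar> * M ^ rk i" by (simp add: mult_ac)
      then show ?thesis using M by (simp add: le_divide_eq)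
    qed
    have vj: "\<bar>v $ j\<bar> \<le> \<bar>v $ i\<bar> * M ^ CARD('n)" for j
    proof -
      have "\<bar>v $ j\<bar> * 1 \<le> \<bar>v $ j\<bar> * M ^ rk j" using M by (intro mult_left_mono one_le_power) auto
      also note i[of j]
      also have "\<bar>v $ i\<bar> * M ^ rk i \<le> \<bar>v $ i\<bar> * M ^ CARD('n)"
        using M rk_le by (intro mult_left_mono power_increasing) auto
      finally show ?thesis by simp
    qed
    have nv: "norm v \<le> d * (\<bar>v $ i\<bar> * M ^ CARD('n))"
    proof -
      have "norm v \<le> (\<Sum>j\<in>UNIV. \<bar>v $ j\<bar>)" by (rule norm_le_l1_cart)
      also have "\<dots> \<le> (\<Sum>j\<in>(UNIV :: 'n set). \<bar>v $ i\<bar> * M ^ CARD('n))" by (rule sum_mono) (rule vj)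
      finally show ?thesis by (simp add: d_def)
    qed
    have vi: "0 < \<bar>v $ i\<bar>"
    proof (rule ccontr)
      assume "\<not> 0 < \<bar>v $ i\<bar>"
      then have "norm v \<le> 0" using nv by simp
      then show False using v by simp
    qed
    obtain \<omega> where \<omega>: "\<And>k. \<omega> k \<in> digits" "x = point \<omega>" using limit_setD[OF x] by blast
    define t where "t = \<rho> / d"
    have t: "0 < t" "t \<le> 1" using \<rho> d by (auto simp: t_def divide_le_eq)
    \<comment> \<open>At this level a change of symbol moves coordinate \<open>i\<close> by about
      \<open>t\<close>. Coordinates of larger ratio could move too far, so the digits in
      \<open>A\<close> leave them unchanged.\<close>
    define k where "k = lv t i"
    define I where "I = {j. r i \<le> r j}"
    define A where "A = {c \<in> digits. \<forall>j. r i < r j \<longrightarrow> c j = \<omega> k j}"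
    have "\<not> card ((\<lambda>c. restrict c I) ` A) \<le> Suc 0"
      using fibre[of "\<omega> k" i, OF \<omega>(1)] m_ge[of i] by (simp add: A_def I_def)
    moreover have "finite ((\<lambda>c. restrict c I) ` A)" using finite_digits by (simp add: A_def)
    ultimately obtain c1 c2 where c: "c1 \<in> A" "c2 \<in> A" "restrict c1 I \<noteq> restrict c2 I"
      by (subst (asm) card_le_Suc0_iff_eq) auto
    have eqj: "c1 j = \<omega> k j" "c2 j = \<omega> k j" if "r i < r j" for j using c(1,2) that by (auto simp: A_def)
    have cW: "c1 \<in> digits" "c2 \<in> digits" using c by (auto simp: A_def)
    have "upclosed I" by (auto simp: upclosed_def I_def)
    from gap_constD(3)[OF gc this cW c(3)] obtain j where j: "j \<in> I"
      "\<forall>x\<in>{0..1}. \<forall>y\<in>{0..1}. \<eta> \<le> \<bar>base_map \<Psi> j (c1 j) x - base_map \<Psi> j (c2 j) y\<bar>" by blast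
    have "j = i"
    proof (rule ccontr)
      assume "j \<noteq> i"
      then have "r i < r j" using j(1) inj_r by (auto simp: I_def less_le inj_def)
      then show False using eqj j(2)[rule_format, of 0 0] \<eta> by simp
    qed
    note gap = j(2)[unfolded this]
    have near: "\<bar>x $ j - point (fun_upd \<omega> k c) $ j\<bar> \<le> \<rho> / d"
      if "c \<in> A" for c j
    proof -
      have cw: "(fun_upd \<omega> k c) l \<in> digits" for l using \<omega>(1) that by (auto simp: A_def)
      have "\<bar>point \<omega> $ j - point (fun_upd \<omega> k c) $ j\<bar> \<le> r j ^ lv t j"
      proof (rule coding_dist_le[OF \<omega>(1) cw])
        fix l assume l: "l < lv t j"
        show "\<omega> l j = (fun_upd \<omega> k c) l j"
        proof (cases "l = k")
          case True
          then have "t < r j ^ k" using l lv_iff[OF t(1)] by simp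
          moreover have "r i ^ k \<le> t" unfolding k_def by (rule lv_le[OF t(1)])
          ultimately have "r i ^ k < r j ^ k" by simp
          then have "r i < r j" using power_less_imp_less_base r_bounds(1)[of j] by (metis less_imp_le)
          then show ?thesis using that True by (simp add: A_def)
        qed simp
      qed
      then show ?thesis using lv_le[OF t(1), of j] \<omega>(2) by (simp add: t_def)
    qed
    define y1 y2 where "y1 = point (fun_upd \<omega> k c1)" and "y2 = point (fun_upd \<omega> k c2)"
    have w1: "(fun_upd \<omega> k c1) l \<in> digits" and w2: "(fun_upd \<omega> k c2) l \<in> digits" for l
      using \<omega>(1) cW by auto
    have D0: "y1 $ j - y2 $ j = 0" if "r i < r j" for j
    proof -
      have "(fun_upd \<omega> k c1) l j = (fun_upd \<omega> k c2) l j" for l using eqj[OF that] by simp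
      then show ?thesis
        unfolding y1_def y2_def coding_map_nth[OF ifs w1] coding_map_nth[OF ifs w2] by simp
    qed
    have Dj: "\<bar>y1 $ j - y2 $ j\<bar> \<le> 2 * \<rho> / d" for j
      using near[OF c(1), of j] near[OF c(2), of j] unfolding y1_def y2_def by simp
    have Di: "\<kappa> * \<rho> \<le> \<bar>y1 $ i - y2 $ i\<bar>"
    proof -
      have "rm * t \<le> r i ^ k"
      proof (cases k)
        case 0
        have "rm * t \<le> 1 * 1" using rm t by (intro mult_mono) auto
        then show ?thesis using 0 by simp
      next
        case (Suc n)
        then have "t < r i ^ n" using lv_iff[OF t(1), of n i] by (simp add: k_def)
        then have "rm * t \<le> r i * r i ^ n" using rm t r_bounds[of i] by (intro mult_mono) auto
        then show ?thesis using Suc by simp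
      qed
      then have "\<eta> * (rm * t) \<le> \<eta> * r i ^ k" using \<eta> by (intro mult_left_mono) auto
      also have "\<dots> \<le> \<bar>y1 $ i - y2 $ i\<bar>"
        unfolding y1_def y2_def by (rule coding_dist_ge[OF w1 w2]) (use gap in auto)
      finally show ?thesis by (simp add: \<kappa>_def t_def)
    qed
    have rest: "\<bar>v $ j * (y1 $ j - y2 $ j)\<bar> \<le> \<bar>v $ i\<bar> / M * (2 * \<rho> / d)" if "j \<noteq> i" for j
    proof (cases "r i < r j")
      case True
      have "0 \<le> \<bar>v $ i\<bar> / M * (2 * \<rho> / d)" using M \<rho> d by simp
      then show ?thesis using D0[OF True] by simp
    next
      case False
      then have "r j < r i" using that inj_r by (auto simp: less_le inj_def not_less)
      from later[OF this] Dj[of j] show ?thesis unfolding abs_mult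
        using M by (intro mult_mono) auto
    qed
    have "\<bar>v $ i\<bar> * \<kappa> * \<rho> / 2 \<le> \<bar>v \<bullet> (y1 - y2)\<bar>"
    proof -
      have eq: "v \<bullet> (y1 - y2) = v $ i * (y1 $ i - y2 $ i) + (\<Sum>j\<in>UNIV - {i}. v $ j * (y1 $ j - y2 $ j))"
        by (simp add: inner_vec_def sum.remove[of UNIV i])
      have "\<bar>\<Sum>j\<in>UNIV - {i}. v $ j * (y1 $ j - y2 $ j)\<bar> \<le> (\<Sum>j\<in>UNIV - {i}. \<bar>v $ i\<bar> / M * (2 * \<rho> / d))"
        using rest by (intro order_trans[OF sum_abs] sum_mono) auto
      also have "\<dots> \<le> (\<Sum>j\<in>(UNIV :: 'n set). \<bar>v $ i\<bar> / M * (2 * \<rho> / d))"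
        using M \<rho> d by (intro sum_mono2) auto
      also have "\<dots> = \<bar>v $ i\<bar> * (2 * \<rho>) / M" using d by (simp add: d_def[symmetric])
      also have "\<dots> = \<bar>v $ i\<bar> * \<kappa> * \<rho> / (2 * d)" using \<kappa> d by (simp add: M_def field_simps)
      also have "\<dots> \<le> \<bar>v $ i\<bar> * \<kappa> * \<rho> / 2" using d \<kappa> \<rho> by (intro divide_left_mono) auto
      finally have 1: "\<bar>\<Sum>j\<in>UNIV - {i}. v $ j * (y1 $ j - y2 $ j)\<bar> \<le> \<bar>v $ i\<bar> * \<kappa> * \<rho> / 2" .
      have "\<bar>v $ i\<bar> * \<kappa> * \<rho> \<le> \<bar>v $ i * (y1 $ i - y2 $ i)\<bar>"
        using Di by (simp add: abs_mult mult.assoc mult_left_mono)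
      with 1 show ?thesis unfolding eq by linarith
    qed
    moreover have "\<bar>v \<bullet> y - b\<bar> \<le> norm v * (\<beta> * \<rho>)" if "y \<in> {y1, y2}" for y
    proof -
      have "y \<in> cball x \<rho> \<inter> limit_set \<Psi>"
      proof
        show "y \<in> cball x \<rho>"
          using that near[OF c(1)] near[OF c(2)] dist_le_card[of x y \<rho>] by (auto simp: y1_def y2_def d_def)
        show "y \<in> limit_set \<Psi>" using that limit_setI[of "fun_upd \<omega> k c1", OF w1] limit_setI[of "fun_upd \<omega> k c2", OF w2]
          by (auto simp: y1_def y2_def)
      qed
      then have le: "infdist y L \<le> \<beta> * \<rho>" using neg by auto
      have "L \<noteq> {}" using L by auto
      moreover have "closed L" unfolding Lv by (rule closed_hyperplane)
      ultimately obtain z where z: "z \<in> L" "infdist y L = dist y z" using infdist_attains_inf by blast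
      have "v \<bullet> y - b = v \<bullet> (y - z)" using z(1) by (simp add: Lv inner_diff_right)
      then have "\<bar>v \<bullet> y - b\<bar> \<le> norm v * norm (y - z)" using Cauchy_Schwarz_ineq2 by metis
      also have "\<dots> \<le> norm v * (\<beta> * \<rho>)" using le z(2) by (intro mult_left_mono) (auto simp: dist_norm)
      finally show ?thesis .
    qed
    from this[of y1] this[of y2] have "\<bar>v \<bullet> (y1 - y2)\<bar> \<le> 2 * (norm v * (\<beta> * \<rho>))"
      by (simp add: inner_diff_right)
    moreover have "2 * (norm v * (\<beta> * \<rho>)) \<le> \<bar>v $ i\<bar> * \<kappa> * \<rho> / 4"
    proof -
      have "2 * (norm v * (\<beta> * \<rho>)) \<le> 2 * (d * (\<bar>v $ i\<bar> * M ^ CARD('n)) * (\<beta> * \<rho>))"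
        using nv \<beta> \<rho> by (intro mult_left_mono mult_right_mono) auto
      also have "\<dots> = \<bar>v $ i\<bar> * \<kappa> * \<rho> / 4" using d M by (simp add: \<beta>_def field_simps)
      finally show ?thesis .
    qed
    moreover have "0 < \<bar>v $ i\<bar> * \<kappa> * \<rho>" using vi \<kappa> \<rho> by simp
    ultimately show False by linarith
  qed
  then show ?thesis unfolding hyperplane_diffuse_def using \<beta> by (intro exI[of _ \<beta>]) blast
qed

text \<open>\<open>R\<close> is the rank by decreasing ratio, a bijection onto
  \<open>{1..CARD('n)}\<close> because \<open>r\<close> is injective. Its inverse enumerates the
  coordinates, and the initial segments of this enumeration are the sets in
  \<open>good\<close>.\<close>

lemma strongly_lalley_gatzouras_sponge: "strongly_lalley_gatzouras \<Psi>"
proof -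
  define R where "R = (\<lambda>i. card {j. r i \<le> r j})"
  have lt: "R i < R j" if "r j < r i" for i j
  proof -
    have "{k. r i \<le> r k} \<subseteq> {k. r j \<le> r k}" "j \<in> {k. r j \<le> r k}" "j \<notin> {k. r i \<le> r k}" using that by auto
    then have "{k. r i \<le> r k} \<subset> {k. r j \<le> r k}" by blast
    then show ?thesis unfolding R_def by (intro psubset_card_mono) auto
  qed
  have less_iff: "R i < R j \<longleftrightarrow> r j < r i" for i j
  proof -
    have "r i = r j \<Longrightarrow> R i = R j" by (simp add: R_def)
    then show ?thesis using lt[of j i] lt[of i j] by linarith
  qed
  have le_iff: "R i \<le> R j \<longleftrightarrow> r j \<le> r i" for i j
    using less_iff[of j i] by linarith
  have injR: "inj R"
  proof (rule injI)
    fix i j assume "R i = R j"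
    then have "r i = r j" using less_iff[of i j] less_iff[of j i] by linarith
    then show "i = j" using inj_r by (rule injD[rotated])
  qed
  then have cardR: "card (range R) = CARD('n)" by (rule card_image)
  have "range R \<subseteq> {1..CARD('n)}"
  proof
    fix k assume "k \<in> range R"
    then obtain i where i: "k = R i" by auto
    have "card {i} \<le> R i" unfolding R_def by (rule card_mono) auto
    moreover have "R i \<le> CARD('n)" unfolding R_def by (rule card_mono) auto
    ultimately show "k \<in> {1..CARD('n)}" by (simp add: i)
  qed
  then have rangeR: "range R = {1..CARD('n)}"
    by (rule card_subset_eq[rotated]) (auto simp: cardR)
  define \<sigma> where "\<sigma> = inv R"
  have R\<sigma>: "R (\<sigma> k) = k" if "k \<in> {1..CARD('n)}" for k
    unfolding \<sigma>_def by (rule f_inv_into_f) (use that rangeR in auto)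
  have bij: "bij_betw \<sigma> {1..CARD('n)} UNIV"
    unfolding \<sigma>_def rangeR[symmetric] using injR by (intro bij_betw_inv_into inj_on_imp_bij_betw)
  have "ifs_ratio \<Psi> a (\<sigma> i) > ifs_ratio \<Psi> a (\<sigma> (Suc i))"
    if "a \<in> digits" "i \<in> {1..<CARD('n)}" for a i
  proof -
    show ?thesis using R\<sigma>[of i] R\<sigma>[of "Suc i"] that less_iff[of "\<sigma> i" "\<sigma> (Suc i)"] by (simp add: ratio)
  qed
  moreover have "strongly_good_set \<Psi> (\<sigma> ` {1..i})" if "i \<in> {1..CARD('n)}" for i
  proof -
    have "\<sigma> ` {1..i} = {j. r (\<sigma> i) \<le> r j}"
    proof (intro equalityI subsetI)
      fix j assume "j \<in> \<sigma> ` {1..i}"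
      then obtain k where k: "k \<in> {1..i}" "j = \<sigma> k" by auto
      then show "j \<in> {j. r (\<sigma> i) \<le> r j}" using R\<sigma>[of k] R\<sigma>[of i] k that le_iff[of "\<sigma> k" "\<sigma> i"] by simp
    next
      fix j assume j: "j \<in> {j. r (\<sigma> i) \<le> r j}"
      obtain k where k: "k \<in> {1..CARD('n)}" "j = \<sigma> k" using bij by (metis UNIV_I bij_betw_imp_surj_on imageE)
      have "k \<le> i"
      proof (rule ccontr)
        assume "\<not> k \<le> i"
        then show False using j R\<sigma>[of k] R\<sigma>[of i] k that less_iff[of "\<sigma> i" "\<sigma> k"] by simp
      qed
      then show "j \<in> \<sigma> ` {1..i}" using k by auto
    qed
    then show ?thesis using good by simp
  qed
  ultimately show ?thesis unfolding strongly_lalley_gatzouras_def using bij by (intro exI[of _ \<sigma>]) auto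
qed

end

section \<open>Subsystems of words of a fixed type\<close>

lemma mset_map_eq_lift:
  assumes "mset v = image_mset f A"
  obtains w where "mset w = A" "map f w = v"
proof -
  obtain w0 where w0: "mset w0 = A" using ex_mset by blast
  then have "mset v = mset (map f w0)" using assms by simp
  \<comment> \<open>The permutation of positions that takes \<open>map f w0\<close> to
    \<open>v\<close> is applied to \<open>w0\<close> itself.\<close>
  then obtain p where p: "p permutes {..<length (map f w0)}" "permute_list p (map f w0) = v"
    by (rule mset_eq_permutation)
  have p': "p permutes {..<length w0}" using p(1) by simp
  have "mset (permute_list p w0) = A" using mset_permute_list[OF p'] w0 by simp
  moreover have "map f (permute_list p w0) = v" using permute_list_map[OF p', of f] p(2) by simp
  ultimately show ?thesis by (rule that)
qed

abbreviation "perms \<equiv> permutations_of_multiset"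

text \<open>A permutation of positions that carries \<open>c'\<close> to \<open>c\<close> carries
  one fibre onto the other; its inverse leads back.\<close>

lemma card_fibre_permutations_eq:
  assumes "mset c = mset c'"
  shows "card {v \<in> perms A. map h v = c} = card {v \<in> perms A. map h v = c'}"
proof -
  obtain p where p: "p permutes {..<length c'}" "permute_list p c' = c"
    using assms by (rule mset_eq_permutation)
  have len: "length v = length c'" if "map h v = c'" for v using that by auto
  have "bij_betw (permute_list p) {v \<in> perms A. map h v = c'} {v \<in> perms A. map h v = c}"
  proof (rule bij_betwI[where g = "permute_list (inv p)"])
    have ip: "inv p permutes {..<length c'}" using p(1) by (rule permutes_inv)
    have lc: "length c = length c'" using assms by (metis size_mset)
    have pc: "permute_list (inv p) c = c'"
      unfolding p(2)[symmetric] using p(1) ip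
      by (metis permute_list_compose permutes_inv_o(1) permute_list_id)
    show "permute_list p \<in> {v \<in> perms A. map h v = c'} \<rightarrow> {v \<in> perms A. map h v = c}"
    proof
      fix v assume v: "v \<in> {v \<in> perms A. map h v = c'}"
      then have "p permutes {..<length v}" using p(1) len by simp
      then show "permute_list p v \<in> {v \<in> perms A. map h v = c}"
        using v p(2) permute_list_map[of p v h] by (auto simp: permutations_of_multiset_def)
    qed
    show "permute_list (inv p) \<in> {v \<in> perms A. map h v = c} \<rightarrow> {v \<in> perms A. map h v = c'}"
    proof
      fix v assume v: "v \<in> {v \<in> perms A. map h v = c}"
      then have "length v = length c" by auto
      then have "inv p permutes {..<length v}" using ip lc by simp
      then show "permute_list (inv p) v \<in> {v \<in> perms A. map h v = c'}"
        using v pc permute_list_map[of "inv p" v h] by (auto simp: permutations_of_multiset_def)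
    qed
    show "permute_list (inv p) (permute_list p v) = v" if "v \<in> {v \<in> perms A. map h v = c'}" for v
      using that p(1) ip len[of v] by (metis (mono_tags, lifting) mem_Collect_eq permute_list_compose permutes_inv_o(1) permute_list_id)
    show "permute_list p (permute_list (inv p) v) = v" if "v \<in> {v \<in> perms A. map h v = c}" for v
    proof -
      have "length v = length c'" using that lc by auto
      then show ?thesis using p(1) ip by (metis permute_list_compose permutes_inv_o(2) permute_list_id)
    qed
  qed
  then show ?thesis by (simp add: bij_betw_same_card)
qed

text \<open>Every rearrangement of \<open>image_mset h A\<close> is hit
  (\<open>mset_map_eq_lift\<close>) and all fibres have the same size, so the total is a
  product.\<close>

lemma card_fibre_permutations:
  assumes "mset c = image_mset h A"
  shows "card {v \<in> perms A. map h v = c} * card (perms (image_mset h A)) =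
    card (perms A)"
proof -
  have im: "map h ` perms A = perms (image_mset h A)"
  proof (intro equalityI subsetI)
    fix v assume "v \<in> perms (image_mset h A)"
    then have "mset v = image_mset h A" by (simp add: permutations_of_multiset_def)
    then obtain w where "mset w = A" "map h w = v" by (rule mset_map_eq_lift)
    then show "v \<in> map h ` perms A" by (auto simp: permutations_of_multiset_def)
  qed (auto simp: permutations_of_multiset_def)
  have "card (perms A) =
      (\<Sum>v\<in>map h ` perms A. card {w \<in> perms A. map h w = v})"
    unfolding card_eq_sum by (rule sum.image_gen) simp
  also have "\<dots> = (\<Sum>v\<in>perms (image_mset h A). card {v \<in> perms A. map h v = c})"
    unfolding im by (rule sum.cong[OF refl], rule card_fibre_permutations_eq)
      (use assms in \<open>simp add: permutations_of_multiset_def\<close>)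
  finally show ?thesis by simp
qed

text \<open>Restricted digits of the word system are encoded words; this counts them by the lists of
  restricted letters, which have the same coincidences.\<close>

lemma card_image_cong_kernel:
  assumes "\<And>x y. x \<in> S \<Longrightarrow> y \<in> S \<Longrightarrow> f x = f y \<longleftrightarrow> g x = g y"
  shows "card (f ` S) = card (g ` S)"
proof -
  have "bij_betw (\<lambda>u. g (inv_into S f u)) (f ` S) (g ` S)"
  proof (rule bij_betw_imageI)
    have inv: "inv_into S f (f x) \<in> S" "f (inv_into S f (f x)) = f x" if "x \<in> S" for x
      using that by (auto intro: inv_into_into f_inv_into_f)
    show "inj_on (\<lambda>u. g (inv_into S f u)) (f ` S)"
    proof (rule inj_onI)
      fix u v assume uv: "u \<in> f ` S" "v \<in> f ` S" "g (inv_into S f u) = g (inv_into S f v)"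
      then have "f (inv_into S f u) = f (inv_into S f v)" using assms inv by auto
      then show "u = v" using uv by (simp add: f_inv_into_f)
    qed
    have "g (inv_into S f (f x)) = g x" if "x \<in> S" for x using assms inv that by blast
    then show "(\<lambda>u. g (inv_into S f u)) ` f ` S = g ` S" unfolding image_image by (intro image_cong) auto
  qed
  then show ?thesis by (rule bij_betw_same_card)
qed

section \<open>Words as maps, and the IFS whose digits are words\<close>

definition wmap :: "('n::finite, 'a) diag_ifs \<Rightarrow> 'n \<Rightarrow> 'a list \<Rightarrow> real \<Rightarrow> real" where
  "wmap \<Phi> i xs = foldr (\<lambda>a f. base_map \<Phi> i a \<circ> f) xs id"

lemma wmap_simps [simp]:
  "wmap \<Phi> i [] = id" "wmap \<Phi> i (x # xs) = base_map \<Phi> i x \<circ> wmap \<Phi> i xs"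
  by (auto simp: wmap_def)

lemma wmap_append: "wmap \<Phi> i (xs @ ys) = wmap \<Phi> i xs \<circ> wmap \<Phi> i ys"
  by (induction xs) (auto simp: comp_assoc)

lemma wmap_eq_scomp: "wmap \<Phi> i xs = scomp (\<lambda>k. base_map \<Phi> i (xs ! k)) (length xs)"
proof (induction xs)
  case (Cons x xs)
  have "scomp (\<lambda>k. base_map \<Phi> i ((x # xs) ! k)) (1 + length xs) =
      scomp (\<lambda>k. base_map \<Phi> i ((x # xs) ! k)) 1 \<circ> scomp (\<lambda>k. base_map \<Phi> i ((x # xs) ! (1 + k))) (length xs)"
    by (rule scomp_add)
  then show ?case using Cons by simp
qed simp

abbreviation word_coord :: "'n \<Rightarrow> ('n \<Rightarrow> 'a) list \<Rightarrow> 'a list" where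
  "word_coord i w \<equiv> map (\<lambda>a. a i) w"

definition word_ratio :: "('n::finite, 'a) diag_ifs \<Rightarrow> ('n \<Rightarrow> 'a) list \<Rightarrow> 'n \<Rightarrow> real" where
  "word_ratio \<Phi> w i = prod_list (map (\<lambda>a. ifs_ratio \<Phi> a i) w)"

lemma wmap_mem:
  assumes "diagonal_ifs \<Phi>" "set w \<subseteq> index_set \<Phi>" "x \<in> {0..1}"
  shows "wmap \<Phi> i (word_coord i w) x \<in> {0..1}"
  using assms(2,3)
proof (induction w)
  case (Cons a w)
  then show ?case
    using contracting_similarity_mem[OF diagonal_ifs_sim[OF assms(1), of a i]] by (simp del: atLeastAtMost_iff)
qed simp

lemma wmap_open_mem:
  assumes "diagonal_ifs \<Phi>" "set w \<subseteq> index_set \<Phi>" "x \<in> {0<..<1}"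
  shows "wmap \<Phi> i (word_coord i w) x \<in> {0<..<1}"
  using assms(2,3)
proof (induction w)
  case (Cons a w)
  then show ?case
    using contracting_similarity_open_mem[OF diagonal_ifs_sim[OF assms(1), of a i]] by (simp del: greaterThanLessThan_iff)
qed simp

lemma wmap_similarity:
  assumes "diagonal_ifs \<Phi>" "set w \<subseteq> index_set \<Phi>" "w \<noteq> []"
  shows "contracting_similarity (wmap \<Phi> i (word_coord i w))"
    "contraction_ratio (wmap \<Phi> i (word_coord i w)) = word_ratio \<Phi> w i"
proof -
  have "contracting_similarity (wmap \<Phi> i (word_coord i w)) \<and>
      contraction_ratio (wmap \<Phi> i (word_coord i w)) = word_ratio \<Phi> w i"
    using assms(2,3)
  proof (induction w)
    case (Cons a w)
    have a: "contracting_similarity (base_map \<Phi> i (a i))" using Cons.prems diagonal_ifs_sim[OF assms(1)] by simp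
    show ?case
    \<comment> \<open>The one-letter word is treated apart: the empty word acts as
      \<open>id\<close>, of ratio 1, and is no contraction.\<close>
    proof (cases "w = []")
      case False
      then have "contracting_similarity (wmap \<Phi> i (word_coord i w))"
        "contraction_ratio (wmap \<Phi> i (word_coord i w)) = word_ratio \<Phi> w i" using Cons by auto
      then show ?thesis unfolding list.map wmap_simps
        using contracting_similarity_comp[OF a, of "wmap \<Phi> i (word_coord i w)"]
        by (simp only: word_ratio_def ifs_ratio_def list.map prod_list.Cons simp_thms)
    qed (use a in \<open>simp add: word_ratio_def ifs_ratio_def\<close>)
  qed simp
  then show "contracting_similarity (wmap \<Phi> i (word_coord i w))"
    "contraction_ratio (wmap \<Phi> i (word_coord i w)) = word_ratio \<Phi> w i" by auto
qed

text \<open>In coordinate \<open>i\<close> a word is represented by the list of its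
  \<open>i\<close>-th letters, since a base map of a diagonal IFS may depend on the symbol of its
  own coordinate only. Codes in \<open>nat\<close> give all subsystems one alphabet type, whatever
  the word length.\<close>

definition word_ifs ::
    "('n::finite, 'a) diag_ifs \<Rightarrow> ('n \<Rightarrow> 'a) list set \<Rightarrow> ('a list \<Rightarrow> nat) \<Rightarrow> ('n, nat) diag_ifs" where
  "word_ifs \<Phi> W enc = \<lparr> base_index = (\<lambda>i. (\<lambda>w. enc (word_coord i w)) ` W),
     base_map = (\<lambda>i k. wmap \<Phi> i (inv_into (\<Union>i. word_coord i ` W) enc k)),
     index_set = (\<lambda>w i. enc (word_coord i w)) ` W \<rparr>"

locale word_system =
  fixes \<Phi> :: "('n::finite, 'a) diag_ifs" and W :: "('n \<Rightarrow> 'a) list set" and enc :: "'a list \<Rightarrow> nat" and len :: nat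
  assumes ifs: "diagonal_ifs \<Phi>"
    and letters: "\<And>w. w \<in> W \<Longrightarrow> set w \<subseteq> index_set \<Phi>"
    and len: "\<And>w. w \<in> W \<Longrightarrow> length w = len" and len_pos: "0 < len"
    and W_ne: "W \<noteq> {}" and fin: "finite W"
    and enc: "inj_on enc (\<Union>i. word_coord i ` W)"
begin

abbreviation "words \<equiv> word_ifs \<Phi> W enc"

lemma W_not_Nil: "w \<in> W \<Longrightarrow> w \<noteq> []"
  using len len_pos by fastforce

lemma base_map_word_ifs: "w \<in> W \<Longrightarrow> base_map words i (enc (word_coord i w)) = wmap \<Phi> i (word_coord i w)"
proof -
  assume "w \<in> W"
  then have "word_coord i w \<in> (\<Union>i. word_coord i ` W)" by blast
  from inv_into_f_f[OF enc this] show ?thesis unfolding word_ifs_def by simp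
qed

lemma index_set_word_ifs: "index_set words = (\<lambda>w i. enc (word_coord i w)) ` W"
  by (simp add: word_ifs_def)

lemma diagonal_word_ifs: "diagonal_ifs words"
proof -
  have "contracting_similarity (base_map words i (enc (word_coord i w)))" if "w \<in> W" for i w
    using base_map_word_ifs[OF that] wmap_similarity(1)[OF ifs letters W_not_Nil] that by simp
  then show ?thesis
    unfolding diagonal_ifs_def index_set_word_ifs using fin W_ne by (auto simp: word_ifs_def)
qed

lemma ifs_ratio_word_ifs: "w \<in> W \<Longrightarrow> ifs_ratio words (\<lambda>i. enc (word_coord i w)) i = word_ratio \<Phi> w i"
  unfolding ifs_ratio_def using base_map_word_ifs wmap_similarity(2)[OF ifs letters W_not_Nil] by simp

lemma limit_set_word_ifs: "limit_set words \<subseteq> limit_set \<Phi>"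
proof
  fix x assume "x \<in> limit_set words"
  then obtain \<tau> where \<tau>: "\<tau> \<in> UNIV \<rightarrow> index_set words" "x = coding_map words \<tau>"
    unfolding limit_set_def by auto
  have \<tau>W: "\<tau> k \<in> index_set words" for k using \<tau>(1) by auto
  then have "\<forall>k. \<exists>w\<in>W. \<tau> k = (\<lambda>i. enc (word_coord i w))" by (auto simp: index_set_word_ifs)
  from bchoice[of UNIV, simplified, OF this[unfolded Bex_def]] obtain w
    where w: "\<And>k. w k \<in> W" "\<And>k. \<tau> k = (\<lambda>i. enc (word_coord i (w k)))" by auto
  \<comment> \<open>Concatenation of the words; by their common length position \<open>k\<close> is
    found with \<open>div\<close> and \<open>mod\<close>.\<close>
  define \<omega> where "\<omega> = (\<lambda>k. w (k div len) ! (k mod len))"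
  have \<omega>E: "\<omega> k \<in> index_set \<Phi>" for k
  proof -
    have "k mod len < length (w (k div len))" using len[OF w(1)] len_pos by simp
    then show ?thesis using letters[OF w(1)] nth_mem unfolding \<omega>_def by blast
  qed
  have sc: "scomp (\<lambda>k. base_map words i (\<tau> k i)) n = scomp (coord \<Phi> \<omega> i) (n * len)" for i n
  proof (induction n)
    case (Suc n)
    have "scomp (\<lambda>k. base_map \<Phi> i (\<omega> (n * len + k) i)) len = scomp (\<lambda>k. base_map \<Phi> i (word_coord i (w n) ! k)) len"
      by (rule scomp_cong) (use len[OF w(1)] in \<open>auto simp: \<omega>_def\<close>)
    also have "\<dots> = wmap \<Phi> i (word_coord i (w n))" using wmap_eq_scomp[of \<Phi> i "word_coord i (w n)"] len[OF w(1)] by simp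
    also have "\<dots> = base_map words i (\<tau> n i)" using base_map_word_ifs[OF w(1)] w(2) by simp
    finally show ?case using Suc scomp_add[of "coord \<Phi> \<omega> i" "n * len" len] by (simp add: add.commute)
  qed simp
  have "coding_map words \<tau> = coding_map \<Phi> \<omega>"
  proof (rule LIMSEQ_unique)
    show "(\<lambda>n. ifs_comp words \<tau> n 0) \<longlonglongrightarrow> coding_map words \<tau>"
      by (rule tendsto_coding_map(1)[OF diagonal_word_ifs \<tau>W])
    \<comment> \<open>At multiples of \<open>len\<close> the two approximating sequences agree, and
      a subsequence has the same limit.\<close>
    have "(\<lambda>n. ifs_comp \<Phi> \<omega> (n * len) 0) \<longlonglongrightarrow> coding_map \<Phi> \<omega>"
      using LIMSEQ_subseq_LIMSEQ[OF tendsto_coding_map(1)[OF ifs \<omega>E], of "\<lambda>n. n * len"] len_pos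
      by (simp add: comp_def strict_mono_def)
    moreover have "ifs_comp \<Phi> \<omega> (n * len) 0 = ifs_comp words \<tau> n 0" for n
      by (rule vec_eq_iff[THEN iffD2]) (simp add: ifs_comp_nth sc)
    ultimately show "(\<lambda>n. ifs_comp words \<tau> n 0) \<longlonglongrightarrow> coding_map \<Phi> \<omega>" by simp
  qed
  then show "x \<in> limit_set \<Phi>" unfolding limit_set_def \<tau>(2) using \<omega>E by auto
qed

end

section \<open>A word that maps the closed cube into its interior\<close>

lemma nonpos_of_less_mult:
  fixes u K :: real
  assumes "\<And>e. 0 < e \<Longrightarrow> e \<le> 1 \<Longrightarrow> u < e * K"
  shows "u \<le> 0"
proof (rule ccontr)
  assume "\<not> u \<le> 0"
  then have u: "u > 0" by simp
  have K: "u < K" using assms[of 1] by simp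
  \<comment> \<open>\<open>e = u / K\<close> is admissible because the case \<open>e = 1\<close>
    gave \<open>u < K\<close>.\<close>
  then have "u < u / K * K" using u by (intro assms) (auto simp: divide_le_eq)
  then show False using u K by simp
qed

text \<open>The image of \<open>g\<close> lies to the right of that of \<open>f\<close> and has
  positive length, so \<open>f\<close> stays below 1. If \<open>f\<close> increases,
  \<open>f \<circ> g\<close> works, since \<open>g\<close> is at least \<open>f 1 > 0\<close>; if it
  decreases, \<open>f \<circ> f\<close> works, since \<open>f (f x) > f 1 \<ge> 0\<close>.\<close>

lemma separated_similarities_interior:
  assumes f: "contracting_similarity f" and g: "contracting_similarity g"
    and le: "\<And>x y. x \<in> {0<..<1} \<Longrightarrow> y \<in> {0<..<1} \<Longrightarrow> f x < g y"
  shows "\<exists>h\<in>{f, g}. \<forall>x\<in>{0..1}. f (h x) \<in> {0<..<1}"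
proof -
  obtain s where s: "0 < \<bar>s\<bar>" "\<And>x. x \<in> {0..1} \<Longrightarrow> f x = f 0 + s * x"
    using contracting_similarity_affine[OF f] by metis
  obtain t where t: "0 < \<bar>t\<bar>" "\<And>x. x \<in> {0..1} \<Longrightarrow> g x = g 0 + t * x"
    using contracting_similarity_affine[OF g] by metis
  have f01: "0 \<le> f 0" "f 0 \<le> 1" "0 \<le> f 1" "f 1 \<le> 1" "f 1 = f 0 + s"
    using contracting_similarity_mem[OF f, of 0] contracting_similarity_mem[OF f, of 1] s(2)[of 1] by auto
  have g01: "0 \<le> g 0" "g 0 \<le> 1" "0 \<le> g 1" "g 1 \<le> 1" "g 1 = g 0 + t"
    using contracting_similarity_mem[OF g, of 0] contracting_similarity_mem[OF g, of 1] t(2)[of 1] by auto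
  have fg: "f a \<le> g b" if ab: "a \<in> {0..1}" "b \<in> {0..1}" for a b
  proof -
    \<comment> \<open>Points of the closed interval are pushed towards 1/2 to meet the hypothesis;
      \<open>e\<close> tends to 0 afterwards.\<close>
    have "f a - g b < e * (t * (1 / 2 - b) - s * (1 / 2 - a))" if e: "0 < e" "e \<le> 1" for e
    proof -
      define x y where "x = (1 - e) * a + e * (1 / 2)" and "y = (1 - e) * b + e * (1 / 2)"
      have pos: "0 \<le> (1 - e) * a" "(1 - e) * a \<le> 1 - e" "0 \<le> (1 - e) * b" "(1 - e) * b \<le> 1 - e"
        using ab e by (auto simp: mult_left_le)
      then have "x \<in> {0<..<1}" "y \<in> {0<..<1}" using e by (auto simp: x_def y_def)
      then have "f x < g y" "x \<in> {0..1}" "y \<in> {0..1}" using le by auto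
      then have "f 0 + s * x < g 0 + t * y" using s(2)[of x] t(2)[of y] by simp
      then show ?thesis using s(2)[OF ab(1)] t(2)[OF ab(2)] by (simp add: x_def y_def algebra_simps)
    qed
    from nonpos_of_less_mult[OF this] show ?thesis by simp
  qed
  have lt1: "f y < 1" if "y \<in> {0..1}" for y
    using fg[OF that, of 0] fg[OF that, of 1] g01 t(1) by auto
  show ?thesis
  proof (cases "s > 0")
    case True
    have "f (g x) \<in> {0<..<1}" if x: "x \<in> {0..1}" for x
    proof -
      have gx: "g x \<in> {0..1}" using contracting_similarity_mem[OF g x] .
      have "0 < g x" using fg[of 1 x] x f01 True by auto
      then show ?thesis using lt1[OF gx] s(2)[OF gx] f01(1) True by (simp add: add_nonneg_pos)
    qed
    then show ?thesis by auto
  next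
    case False
    then have sn: "s < 0" using s(1) by simp
    have "f (f x) \<in> {0<..<1}" if x: "x \<in> {0..1}" for x
    proof -
      have fx: "f x \<in> {0..1}" using contracting_similarity_mem[OF f x] .
      have "s < s * f x" using lt1[OF x] sn by (simp add: mult_less_cancel_left2)
      then show ?thesis using lt1[OF fx] s(2)[OF fx] f01 by simp
    qed
    then show ?thesis by auto
  qed
qed

text \<open>Disjoint images of an open interval under affine maps are ordered on the line, so one
  map takes the left place required by \<open>separated_similarities_interior\<close>.\<close>

lemma disjoint_similarities_interior:
  assumes f: "contracting_similarity f" and g: "contracting_similarity g"
    and disj: "\<And>x y. x \<in> {0<..<1} \<Longrightarrow> y \<in> {0<..<1} \<Longrightarrow> f x \<noteq> g y"
  shows "\<exists>h\<in>{f, g}. \<exists>h'\<in>{f, g}. \<forall>x\<in>{0..1}. h (h' x) \<in> {0<..<1}"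
proof -
  obtain s where s: "\<And>x. x \<in> {0..1} \<Longrightarrow> f x = f 0 + s * x"
    using contracting_similarity_affine[OF f] by metis
  obtain t where t: "\<And>x. x \<in> {0..1} \<Longrightarrow> g x = g 0 + t * x"
    using contracting_similarity_affine[OF g] by metis
  have "(\<forall>x\<in>{0<..<1}. \<forall>y\<in>{0<..<1}. f x < g y) \<or> (\<forall>x\<in>{0<..<1}. \<forall>y\<in>{0<..<1}. g y < f x)"
  proof (rule ccontr)
    assume "\<not> ?thesis"
    then obtain x1 y1 x2 y2 where xy: "x1 \<in> {0<..<1}" "y1 \<in> {0<..<1}" "x2 \<in> {0<..<1}" "y2 \<in> {0<..<1}"
      "f x1 \<ge> g y1" "f x2 \<le> g y2" by (auto simp: not_less)
    then have "f x1 > g y1" "f x2 < g y2" using disj[of x1 y1] disj[of x2 y2] by auto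
    define u v where "u = f x1 - g y1" and "v = g y2 - f x2"
    have uv: "u > 0" "v > 0" using \<open>f x1 > g y1\<close> \<open>f x2 < g y2\<close> by (auto simp: u_def v_def)
    \<comment> \<open>This weight makes the signed differences \<open>u\<close> and
      \<open>- v\<close> cancel, which produces a common value of \<open>f\<close> and
      \<open>g\<close>.\<close>
    define l where "l = v / (u + v)"
    have l: "0 < l" "l < 1" using uv by (auto simp: l_def)
    define x y where "x = l * x1 + (1 - l) * x2" and "y = l * y1 + (1 - l) * y2"
    have conv: "l * a + (1 - l) * b \<in> {0<..<1}" if "a \<in> {0<..<1}" "b \<in> {0<..<1}" for a b
      using convexD[OF convex_real_interval(8), of a 0 1 b l "1 - l"] that l by auto
    have x: "x \<in> {0<..<1}" "y \<in> {0<..<1}" unfolding x_def y_def using conv xy by auto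
    have "f x - g y = l * (f x1 - g y1) + (1 - l) * (f x2 - g y2)"
      using s[of x] s[of x1] s[of x2] t[of y] t[of y1] t[of y2] x xy by (simp add: x_def y_def algebra_simps)
    also have "\<dots> = l * u - (1 - l) * v" by (simp add: u_def v_def algebra_simps)
    also have "\<dots> = 0" using uv by (simp add: l_def field_simps)
    finally show False using disj[OF x] by simp
  qed
  then show ?thesis
    using separated_similarities_interior[OF f g] separated_similarities_interior[OF g f] by blast
qed

text \<open>Here \<open>\<theta>\<close> serves to order the coordinates; it becomes the vector of
  Lyapunov exponents in \<open>weighted_sponge\<close>. A small exponent means slow contraction, so
  \<open>lower i\<close> will play the part of \<open>{j. r i \<le> r j}\<close> in
  \<open>hom_sponge\<close>.\<close>

locale ordered_sponge =
  fixes \<Phi> :: "('n::finite, 'a) diag_ifs" and \<theta> :: "'n \<Rightarrow> real"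
  assumes ifs: "diagonal_ifs \<Phi>" and inj_theta: "inj \<theta>"
    and good: "\<And>i. good_set \<Phi> {j. \<theta> j \<le> \<theta> i}"
    and irr: "\<And>i. \<exists>a\<in>index_set \<Phi>. \<exists>b\<in>index_set \<Phi>. a i \<noteq> b i \<and> (\<forall>j. a j \<noteq> b j \<longrightarrow> \<theta> i \<le> \<theta> j)"
begin

abbreviation "lower i \<equiv> {j. \<theta> j \<le> \<theta> i}"
abbreviation "below i \<equiv> {j. \<theta> j < \<theta> i}"

abbreviation "E \<equiv> index_set \<Phi>"
lemma good_open_images:
  assumes "a \<in> E" "b \<in> E"
    and "\<And>j. \<theta> j \<le> \<theta> i \<Longrightarrow> x j \<in> {0<..<1}" "\<And>j. \<theta> j \<le> \<theta> i \<Longrightarrow> y j \<in> {0<..<1}"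
    and eq: "\<And>j. \<theta> j \<le> \<theta> i \<Longrightarrow> base_map \<Phi> j (a j) (x j) = base_map \<Phi> j (b j) (y j)"
  shows "restrict a (lower i) = restrict b (lower i)"
proof (rule ccontr)
  define I where "I = lower i"
  assume "restrict a (lower i) \<noteq> restrict b (lower i)"
  then have ne: "restrict a I \<noteq> restrict b I" by (simp add: I_def)
  have dj: "disjoint_images \<Phi> {0<..<1} I" using good[of i] by (simp add: good_set_def I_def)
  have "sub_map \<Phi> I (restrict a I) (restrict x I) = sub_map \<Phi> I (restrict b I) (restrict y I)"
    unfolding sub_map_def using eq by (auto simp: fun_eq_iff I_def)
  moreover have "restrict x I \<in> I \<rightarrow>\<^sub>E {0<..<1}" "restrict y I \<in> I \<rightarrow>\<^sub>E {0<..<1}"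
    using assms(3,4) by (auto simp: I_def)
  ultimately have "sub_map \<Phi> I (restrict a I) ` (I \<rightarrow>\<^sub>E {0<..<1}) \<inter> sub_map \<Phi> I (restrict b I) ` (I \<rightarrow>\<^sub>E {0<..<1}) \<noteq> {}"
    by (metis (no_types, lifting) IntI empty_iff imageI)
  then show False using dj ne assms(1,2) unfolding disjoint_images_def disjoint_family_on_def by blast
qed

text \<open>Goodness passes to words. The tails map the open cube into itself, so the first letters
  agree on \<open>lower i\<close> by goodness; similarities are injective, so these letters can be
  cancelled and the induction continues.\<close>

lemma good_words:
  assumes "length w = length w'" "set w \<subseteq> E" "set w' \<subseteq> E"
    and x: "\<And>j. \<theta> j \<le> \<theta> i \<Longrightarrow> x j \<in> {0<..<1}" and y: "\<And>j. \<theta> j \<le> \<theta> i \<Longrightarrow> y j \<in> {0<..<1}"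
    and eq: "\<And>j. \<theta> j \<le> \<theta> i \<Longrightarrow> wmap \<Phi> j (word_coord j w) (x j) = wmap \<Phi> j (word_coord j w') (y j)"
  shows "map (\<lambda>a. restrict a (lower i)) w = map (\<lambda>a. restrict a (lower i)) w'"
  using assms(1-3) eq
proof (induction w w' rule: list_induct2)
  case (Cons a w b w')
  define p q where "p = (\<lambda>j. wmap \<Phi> j (word_coord j w) (x j))" and "q = (\<lambda>j. wmap \<Phi> j (word_coord j w') (y j))"
  have pq: "p j \<in> {0<..<1}" "q j \<in> {0<..<1}" if "\<theta> j \<le> \<theta> i" for j
    using wmap_open_mem[OF ifs _ x[OF that], of w j] wmap_open_mem[OF ifs _ y[OF that], of w' j] Cons.prems
    by (auto simp: p_def q_def simp del: greaterThanLessThan_iff)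
  have eq': "base_map \<Phi> j (a j) (p j) = base_map \<Phi> j (b j) (q j)" if "\<theta> j \<le> \<theta> i" for j
    using Cons.prems(3)[OF that] by (simp add: p_def q_def)
  have ab: "restrict a (lower i) = restrict b (lower i)"
    by (rule good_open_images[OF _ _ pq eq']) (use Cons.prems in auto)
  have "p j = q j" if j: "\<theta> j \<le> \<theta> i" for j
  proof -
    have "a j = b j" using fun_cong[OF ab, of j] j by simp
    then have "base_map \<Phi> j (a j) (p j) = base_map \<Phi> j (a j) (q j)" using eq'[OF j] by simp
    moreover have s: "contracting_similarity (base_map \<Phi> j (a j))" using Cons.prems diagonal_ifs_sim[OF ifs] by simp
    ultimately have "contraction_ratio (base_map \<Phi> j (a j)) * \<bar>p j - q j\<bar> = 0"
      using contracting_similarity_dist[OF s, of "p j" "q j"] pq[OF j] by simp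
    then show ?thesis using contraction_ratio_bounds(1)[OF s] by simp
  qed
  then have "map (\<lambda>a. restrict a (lower i)) w = map (\<lambda>a. restrict a (lower i)) w'"
    by (intro Cons.IH) (use Cons.prems in \<open>auto simp: p_def q_def\<close>)
  then show ?case using ab by (simp only: list.map)
qed simp

text \<open>Irreducibility provides two letters that agree on \<open>lower i\<close> except at
  \<open>i\<close>. Goodness then makes their images in coordinate \<open>i\<close> disjoint, and a
  two-letter word made of them does the job.\<close>

lemma ex_interior_word_coord:
  "\<exists>v. set v \<subseteq> E \<and> (\<forall>x\<in>{0..1}. wmap \<Phi> i (word_coord i v) x \<in> {0<..<1})"
proof -
  obtain a b where ab: "a \<in> E" "b \<in> E" "a i \<noteq> b i" "\<And>j. a j \<noteq> b j \<Longrightarrow> \<theta> i \<le> \<theta> j"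
    using irr[of i] by blast
  have dis: "base_map \<Phi> i (a i) x \<noteq> base_map \<Phi> i (b i) y" if "x \<in> {0<..<1}" "y \<in> {0<..<1}" for x y
  proof
    assume eq: "base_map \<Phi> i (a i) x = base_map \<Phi> i (b i) y"
    have "a j = b j" if "\<theta> j \<le> \<theta> i" "j \<noteq> i" for j
      using ab(4)[of j] that inj_theta by (metis antisym injD)
    \<comment> \<open>In the other coordinates of \<open>lower i\<close> the letters agree, so any
      interior point, here 1/2, is sent to a common image.\<close>
    then have "restrict a (lower i) = restrict b (lower i)"
      using good_open_images[OF ab(1,2), of i "\<lambda>j. if j = i then x else 1/2" "\<lambda>j. if j = i then y else 1/2"] that eq
      by auto
    from fun_cong[OF this, of i] ab(3) show False by simp
  qed
  from disjoint_similarities_interior[OF diagonal_ifs_sim[OF ifs ab(1)] diagonal_ifs_sim[OF ifs ab(2)] dis]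
  obtain c c' where "c \<in> {a, b}" "c' \<in> {a, b}" "\<forall>x\<in>{0..1}. base_map \<Phi> i (c i) (base_map \<Phi> i (c' i) x) \<in> {0<..<1}"
    by blast
  then show ?thesis using ab by (intro exI[of _ "[c, c']"]) auto
qed

text \<open>Words for single coordinates are concatenated. A coordinate once sent into the open
  interval keeps this property when letters are added on either side.\<close>

lemma ex_interior_word:
  "\<exists>u. set u \<subseteq> E \<and> (\<forall>i. \<forall>x\<in>{0..1}. wmap \<Phi> i (word_coord i u) x \<in> {0<..<1})"
proof -
  have "\<exists>u. set u \<subseteq> E \<and> (\<forall>i\<in>S. \<forall>x\<in>{0..1}. wmap \<Phi> i (word_coord i u) x \<in> {0<..<1})" if "finite S" for S
    using that
  proof induction
    case empty
    then show ?case by (intro exI[of _ "[]"]) auto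
  next
    case (insert i S)
    then obtain u where u: "set u \<subseteq> E" "\<And>j x. j \<in> S \<Longrightarrow> x \<in> {0..1} \<Longrightarrow> wmap \<Phi> j (word_coord j u) x \<in> {0<..<1}"
      by auto
    obtain v where v: "set v \<subseteq> E" "\<And>x. x \<in> {0..1} \<Longrightarrow> wmap \<Phi> i (word_coord i v) x \<in> {0<..<1}"
      using ex_interior_word_coord[of i] by auto
    have "wmap \<Phi> j (word_coord j (u @ v)) x \<in> {0<..<1}" if "j \<in> insert i S" "x \<in> {0..1}" for j x
    proof (cases "j = i")
      case True
      then show ?thesis using wmap_open_mem[OF ifs u(1) v(2)[OF that(2)], of i] by (simp add: wmap_append)
    next
      case False
      then show ?thesis using u(2)[OF _ wmap_mem[OF ifs v(1) that(2)], of j j] that by (simp add: wmap_append)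
    qed
    then show ?case using u(1) v(1) by (intro exI[of _ "u @ v"]) auto
  qed
  from this[of UNIV] show ?thesis by simp
qed

text \<open>A quotient of two multinomial coefficients, exact by
  \<open>card_fibre_permutations\<close>: the number of refinements of a prescribed arrangement on
  \<open>below i\<close> to one on \<open>lower i\<close>.\<close>

definition fibre_card :: "('n \<Rightarrow> 'a) multiset \<Rightarrow> 'n \<Rightarrow> nat" where
  "fibre_card M i =
    card (perms (image_mset (\<lambda>a. restrict a (lower i)) M)) div
    card (perms (image_mset (\<lambda>a. restrict a (below i)) M))"

text \<open>Projected to \<open>lower i\<close>, the words of type \<open>M\<close> are exactly the
  rearrangements of the projected type, so the fibre is one of those counted by
  \<open>card_fibre_permutations\<close>.\<close>

lemma card_word_fibre:
  assumes w: "mset w = M"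
  shows "card (map (\<lambda>a. restrict a (lower i)) ` {w'. mset w' = M \<and>
      map (\<lambda>a. restrict a (below i)) w' = map (\<lambda>a. restrict a (below i)) w}) = fibre_card M i"
    (is "card (map ?f ` ?S) = _")
proof -
  let ?g = "\<lambda>a. restrict a (below i)"
  have gf: "?g (?f a) = ?g a" for a :: "'n \<Rightarrow> 'a" by (auto simp: restrict_def fun_eq_iff)
  define A where "A = image_mset ?f M"
  have gA: "image_mset ?g A = image_mset ?g M" unfolding A_def multiset.map_comp comp_def gf ..
  have "map ?f ` ?S = {v \<in> perms A. map ?g v = map ?g w}"
  proof (intro equalityI subsetI)
    fix v assume "v \<in> {v \<in> perms A. map ?g v = map ?g w}"
    then have v: "mset v = image_mset ?f M" "map ?g v = map ?g w" by (auto simp: permutations_of_multiset_def A_def)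
    from v(1) obtain w' where w': "mset w' = M" "map ?f w' = v" by (rule mset_map_eq_lift)
    have "map ?g w' = map ?g v" unfolding w'(2)[symmetric] map_map comp_def gf ..
    then show "v \<in> map ?f ` ?S" using w' v(2) by auto
  next
    fix v assume "v \<in> map ?f ` ?S"
    then obtain w' where w': "mset w' = M" "map ?g w' = map ?g w" "v = map ?f w'" by auto
    then show "v \<in> {v \<in> perms A. map ?g v = map ?g w}"
      by (simp only: permutations_of_multiset_def A_def map_map comp_def gf mem_Collect_eq mset_map simp_thms)
  qed
  then have e1: "card (map ?f ` ?S) = card {v \<in> perms A. map ?g v = map ?g w}" by (rule arg_cong)
  have "mset (map ?g w) = image_mset ?g A" unfolding gA using w by simp
  from card_fibre_permutations[OF this]
  have "card (perms A) =
      card {v \<in> perms A. map ?g v = map ?g w} * card (perms (image_mset ?g M))"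
    unfolding gA by (rule sym)
  moreover have "card (perms (image_mset ?g M)) \<noteq> 0" by simp
  ultimately show ?thesis unfolding fibre_card_def A_def[symmetric] e1
    by (simp only: nonzero_mult_div_cancel_right simp_thms not_False_eq_True)
qed

text \<open>Interchanging the two letters supplied by irreducibility changes the arrangement at
  \<open>i\<close> but not below \<open>i\<close>. Both letters have to occur, hence the assumption
  that \<open>M\<close> contains all of \<open>E\<close>.\<close>

lemma fibre_card_ge:
  assumes M: "set_mset M = E"
  shows "2 \<le> fibre_card M i"
proof -
  let ?f = "\<lambda>a. restrict a (lower i)" and ?g = "\<lambda>a. restrict a (below i)"
  obtain a b where ab: "a \<in> E" "b \<in> E" "a i \<noteq> b i" "\<And>j. a j \<noteq> b j \<Longrightarrow> \<theta> i \<le> \<theta> j"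
    using irr[of i] by blast
  obtain w where w: "mset w = M - {#a#} - {#b#}" using ex_mset by blast
  have "a \<in># M" using ab M by simp
  moreover have "b \<in># M - {#a#}" using ab M by (simp add: in_diff_count) (metis ab(3) count_eq_zero_iff gr0I)
  ultimately have "mset (a # b # w) = M" by (simp only: mset.simps w insert_DiffM)
  then have Mw: "mset (a # b # w) = M" "mset (b # a # w) = M" by (auto simp: add_mset_commute)
  have "?g a = ?g b" using ab(4) by (force simp: fun_eq_iff restrict_def)
  then have g: "map ?g (b # a # w) = map ?g (a # b # w)" by simp
  have ne: "?f a \<noteq> ?f b" using ab(3) by (auto dest: fun_cong[where x = i])
  have "card {map ?f (a # b # w), map ?f (b # a # w)} \<le> fibre_card M i"
    unfolding card_word_fibre[OF Mw(1), symmetric]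
  proof (rule card_mono)
    show "finite (map ?f ` {w'. mset w' = M \<and> map ?g w' = map ?g (a # b # w)})"
      by (rule finite_imageI, rule finite_subset[OF _ finite_permutations_of_multiset[of M]])
        (unfold permutations_of_multiset_def, blast)
    show "{map ?f (a # b # w), map ?f (b # a # w)} \<subseteq> map ?f ` {w'. mset w' = M \<and> map ?g w' = map ?g (a # b # w)}"
      using Mw g by blast
  qed
  then show ?thesis using ne by simp
qed

text \<open>\<open>good_words\<close> is applied to the prefixes, at points already moved into the
  open cube by \<open>z\<close>. Being common to all words, \<open>z\<close> changes neither the
  coincidences of digits nor the fibres. The hypothesis \<open>r\<close> translates the order of
  exponents into the reversed order of ratios.\<close>

lemma hom_sponge_words:
  fixes M :: "('n \<Rightarrow> 'a) multiset" and z :: "('n \<Rightarrow> 'a) list" and enc :: "'a list \<Rightarrow> nat"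
  defines "W \<equiv> {w @ z | w. mset w = M}"
    and "r \<equiv> \<lambda>i. (\<Prod>a\<in>#M. ifs_ratio \<Phi> a i) * word_ratio \<Phi> z i"
  assumes M: "set_mset M = E" and z: "set z \<subseteq> E"
    and interior: "\<And>i x. x \<in> {0..1} \<Longrightarrow> wmap \<Phi> i (word_coord i z) x \<in> {0<..<1}"
    and r: "\<And>i j. r i < r j \<longleftrightarrow> \<theta> j < \<theta> i"
    and enc: "inj_on enc (\<Union>i. word_coord i ` W)"
  shows "hom_sponge (word_ifs \<Phi> W enc) r (fibre_card M)"
    and "limit_set (word_ifs \<Phi> W enc) \<subseteq> limit_set \<Phi>"
proof -
  let ?\<Psi> = "word_ifs \<Phi> W enc"
  have finite_M: "finite {w. mset w = M}"
    using finite_permutations_of_multiset[of M] by (simp add: permutations_of_multiset_def)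
  have WI: "\<exists>w. v = w @ z \<and> mset w = M" if "v \<in> W" for v using that by (auto simp: W_def)
  interpret word_system \<Phi> W enc "size M + length z"
  proof
    show "set v \<subseteq> E" if "v \<in> W" for v
      using WI[OF that] M z by (metis Un_least set_append set_mset_mset subset_refl)
    show "length v = size M + length z" if "v \<in> W" for v
      using WI[OF that] by auto
    have "M \<noteq> {#}" using M ifs by (auto simp: diagonal_ifs_def)
    then show "0 < size M + length z" by (simp add: nonempty_has_size)
    show "W \<noteq> {}" using ex_mset[of M] by (auto simp: W_def)
    have "W = (\<lambda>w. w @ z) ` {w. mset w = M}" by (auto simp: W_def)
    then show "finite W" using finite_M by simp
  qed (use ifs enc in auto)
  show "limit_set ?\<Psi> \<subseteq> limit_set \<Phi>" by (rule limit_set_word_ifs)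
  let ?D = "\<lambda>w i. enc (word_coord i w)"
  have D_eq: "?D (w @ z) j = ?D (w' @ z) j \<longleftrightarrow> map (\<lambda>a. a j) w = map (\<lambda>a. a j) w'" if "mset w = M" "mset w' = M" for w w' j
  proof -
    have "w @ z \<in> W" "w' @ z \<in> W" using that by (auto simp: W_def)
    then have "?D (w @ z) j = ?D (w' @ z) j \<longleftrightarrow> word_coord j (w @ z) = word_coord j (w' @ z)"
      using inj_on_eq_iff[OF enc] by blast
    then show ?thesis by simp
  qed
  have map_res: "map (\<lambda>a. restrict a J) w = map (\<lambda>a. restrict a J) w' \<longleftrightarrow> (\<forall>j\<in>J. map (\<lambda>a. a j) w = map (\<lambda>a. a j) w')"
    if "length w = length w'" for J and w w' :: "('n \<Rightarrow> 'a) list"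
    using that by (induction w w' rule: list_induct2) (auto simp: fun_eq_iff restrict_def)
  have res_D: "restrict (?D (w @ z)) J = restrict (?D (w' @ z)) J \<longleftrightarrow> map (\<lambda>a. restrict a J) w = map (\<lambda>a. restrict a J) w'"
    if "mset w = M" "mset w' = M" for w w' J
  proof -
    have "length w = length w'" using that by (metis size_mset)
    note map_res[OF this, of J]
    moreover have "restrict (?D (w @ z)) J = restrict (?D (w' @ z)) J \<longleftrightarrow> (\<forall>j\<in>J. ?D (w @ z) j = ?D (w' @ z) j)"
      by (auto simp: fun_eq_iff restrict_def)
    ultimately show ?thesis using D_eq[OF that] by simp
  qed
  have sets: "{j. r i \<le> r j} = lower i" "{j. r i < r j} = below i" for i
    using r by (auto simp: not_less[symmetric])
  show "hom_sponge ?\<Psi> r (fibre_card M)"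
  proof
    show "diagonal_ifs ?\<Psi>" by (rule diagonal_word_ifs)
    show "ifs_ratio ?\<Psi> a i = r i" if a: "a \<in> index_set ?\<Psi>" for a i
    proof -
      obtain v where v: "v \<in> W" "a = ?D v" using a by (auto simp: index_set_word_ifs)
      obtain w where w: "v = w @ z" "mset w = M" using WI[OF v(1)] by auto
      have "ifs_ratio ?\<Psi> a i = word_ratio \<Phi> v i"
        unfolding v(2) by (rule ifs_ratio_word_ifs[OF v(1)])
      also have "\<dots> = word_ratio \<Phi> w i * word_ratio \<Phi> z i" by (simp add: w(1) word_ratio_def)
      also have "word_ratio \<Phi> w i = (\<Prod>a\<in>#M. ifs_ratio \<Phi> a i)"
        by (simp add: word_ratio_def w(2)[symmetric] prod_mset_prod_list[symmetric])
      finally show ?thesis by (simp add: r_def)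
    qed
    show "inj r"
    proof (rule injI)
      fix i j assume "r i = r j"
      then have "\<theta> i = \<theta> j" using r[of i j] r[of j i] by linarith
      then show "i = j" using inj_theta by (rule injD[rotated])
    qed
    show "2 \<le> fibre_card M i" for i by (rule fibre_card_ge[OF M])
    show "card ((\<lambda>b. restrict b {j. r i \<le> r j}) ` {b \<in> index_set ?\<Psi>. \<forall>j. r i < r j \<longrightarrow> b j = a j}) =
        fibre_card M i" if a: "a \<in> index_set ?\<Psi>" for a i
    proof -
      obtain v where v: "v \<in> W" "a = ?D v" using a by (auto simp: index_set_word_ifs)
      obtain w where w: "v = w @ z" "mset w = M" using WI[OF v(1)] by auto
      let ?f = "\<lambda>a. restrict a (lower i)" and ?g = "\<lambda>a. restrict a (below i)"
      define S where "S = {w'. mset w' = M \<and> map ?g w' = map ?g w}"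
      \<comment> \<open>The condition on a digit is rewritten as one on the word behind it, by
        injectivity of \<open>enc\<close> and cancellation of the suffix.\<close>
      have "{b \<in> index_set ?\<Psi>. \<forall>j. r i < r j \<longrightarrow> b j = a j} = (\<lambda>w'. ?D (w' @ z)) ` S"
      proof -
        have "(\<forall>j. r i < r j \<longrightarrow> ?D (w' @ z) j = a j) \<longleftrightarrow> map ?g w' = map ?g w" if "mset w' = M" for w'
        proof -
          have "length w' = length w" using that w(2) by (metis size_mset)
          then show ?thesis unfolding map_res[OF \<open>length w' = length w\<close>] v(2) w(1)
            using D_eq[OF that w(2)] r by auto
        qed
        then have S: "S = {w'. mset w' = M \<and> (\<forall>j. r i < r j \<longrightarrow> ?D (w' @ z) j = a j)}"
          unfolding S_def by (intro Collect_cong conj_cong refl) simp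
        have "W = (\<lambda>w'. w' @ z) ` {w'. mset w' = M}" by (auto simp: W_def)
        then have "?D ` W = (\<lambda>w'. ?D (w' @ z)) ` {w'. mset w' = M}" by (simp only: image_image)
        then have "index_set ?\<Psi> = (\<lambda>w'. ?D (w' @ z)) ` {w'. mset w' = M}"
          by (rule trans[OF index_set_word_ifs])
        moreover have "{b \<in> f ` {x. A x}. P b} = f ` {x. A x \<and> P (f x)}" for f :: "('n \<Rightarrow> 'a) list \<Rightarrow> 'n \<Rightarrow> nat" and A P
          by auto
        ultimately show ?thesis unfolding S by (simp only:)
      qed
      then have "card ((\<lambda>b. restrict b {j. r i \<le> r j}) ` {b \<in> index_set ?\<Psi>. \<forall>j. r i < r j \<longrightarrow> b j = a j}) =
          card ((\<lambda>w'. restrict (?D (w' @ z)) (lower i)) ` S)"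
        unfolding sets by (simp only: image_image)
      also have "\<dots> = card (map ?f ` S)"
        by (rule card_image_cong_kernel) (use res_D in \<open>auto simp only: S_def mem_Collect_eq\<close>)
      also have "\<dots> = fibre_card M i" unfolding S_def by (rule card_word_fibre[OF w(2)])
      finally show ?thesis .
    qed
    show "strongly_good_set ?\<Psi> {j. r i \<le> r j}" for i
      unfolding strongly_good_set_def disjoint_images_def disjoint_family_on_def sets
    proof (intro ballI impI, rule ccontr)
      let ?I = "lower i"
      fix a b
      assume "a \<in> (\<lambda>a. restrict a ?I) ` index_set ?\<Psi>"
        and "b \<in> (\<lambda>a. restrict a ?I) ` index_set ?\<Psi>" and ne: "a \<noteq> b"
        and meet: "sub_map ?\<Psi> ?I a ` (?I \<rightarrow>\<^sub>E {0..1}) \<inter> sub_map ?\<Psi> ?I b ` (?I \<rightarrow>\<^sub>E {0..1}) \<noteq> {}"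
      then obtain v v' where "v \<in> W" "v' \<in> W" and av: "a = restrict (?D v) ?I" "b = restrict (?D v') ?I"
        by (auto simp: index_set_word_ifs)
      then obtain w w' where w: "v = w @ z" "mset w = M" "v' = w' @ z" "mset w' = M" using WI by blast
      obtain x y where xy: "x \<in> ?I \<rightarrow>\<^sub>E {0..1}" "y \<in> ?I \<rightarrow>\<^sub>E {0..1}"
        "sub_map ?\<Psi> ?I a x = sub_map ?\<Psi> ?I b y" using meet by blast
      have "wmap \<Phi> j (word_coord j w) (wmap \<Phi> j (word_coord j z) (x j)) =
          wmap \<Phi> j (word_coord j w') (wmap \<Phi> j (word_coord j z) (y j))" if j: "\<theta> j \<le> \<theta> i" for j
        using fun_cong[OF xy(3), of j] j base_map_word_ifs[OF \<open>v \<in> W\<close>, of j] base_map_word_ifs[OF \<open>v' \<in> W\<close>, of j]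
        by (simp add: sub_map_def av w wmap_append)
      then have "map (\<lambda>a. restrict a ?I) w = map (\<lambda>a. restrict a ?I) w'"
      proof (rule good_words[rotated 5])
        show "length w = length w'" using w by (metis size_mset)
        show "set w \<subseteq> E" "set w' \<subseteq> E" using w M by (metis set_mset_mset subset_refl)+
        show "wmap \<Phi> j (word_coord j z) (x j) \<in> {0<..<1}" "wmap \<Phi> j (word_coord j z) (y j) \<in> {0<..<1}" if "\<theta> j \<le> \<theta> i" for j
          using interior PiE_mem[OF xy(1), of j] PiE_mem[OF xy(2), of j] that by blast+
      qed
      then show False using res_D[OF w(2,4), of ?I] ne av w by simp
    qed
  qed
qed

end

section \<open>Entropy and the number of words\<close>

text \<open>Stirling up to an error \<open>ln k + 1\<close>, negligible after division by the word
  length. The induction rests on \<open>x * ln ((x + 1) / x) \<le> 1 \<le> (x + 1) * ln ((x + 1) /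
  x)\<close>.\<close>

lemma ln_fact_bounds:
  "real k * ln k - k \<le> ln (fact k)"
  "ln (fact k) \<le> real k * ln k - k + ln k + 1"
proof -
  have "real k * ln k - k \<le> ln (fact k) \<and> ln (fact k) \<le> real k * ln k - k + ln k + 1" if "1 \<le> k"
    using that
  proof (induction k rule: nat_induct_at_least)
    case (Suc k)
    define x where "x = real k"
    have x: "x \<ge> 1" using Suc.hyps by (simp add: x_def)
    have f: "ln (fact (Suc k)) = ln (x + 1) + ln (fact k :: real)"
      using ln_mult[of "x + 1" "fact k"] x by (simp add: x_def algebra_simps)
    have "ln ((x + 1) / x) \<le> (x + 1) / x - 1" by (rule ln_le_minus_one) (use x in auto)
    moreover have "(x + 1) / x - 1 = 1 / x" using x by (simp add: field_simps)
    ultimately have "ln (x + 1) - ln x \<le> 1 / x" using x ln_div[of "x + 1" x] by simp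
    then have "x * (ln (x + 1) - ln x) \<le> x * (1 / x)" using x by (intro mult_left_mono) auto
    then have 1: "x * ln (x + 1) - x * ln x \<le> 1" using x by (simp add: algebra_simps)
    have "ln (x / (x + 1)) \<le> x / (x + 1) - 1" by (rule ln_le_minus_one) (use x in auto)
    also have "\<dots> = - (1 / (x + 1))" using x by (simp add: field_simps)
    finally have "1 / (x + 1) \<le> ln (x + 1) - ln x" using x by (simp add: ln_div)
    then have "(x + 1) * (1 / (x + 1)) \<le> (x + 1) * (ln (x + 1) - ln x)" using x by (intro mult_left_mono) auto
    then have 2: "1 \<le> (x + 1) * ln (x + 1) - (x + 1) * ln x" using x by (simp add: algebra_simps)
    have IH: "x * ln x - x \<le> ln (fact k)" "ln (fact k) \<le> x * ln x - x + ln x + 1" using Suc.IH by (simp_all add: x_def)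
    have S: "real (Suc k) = x + 1" by (simp add: x_def)
    show ?case unfolding S f using IH 1 2 by (simp add: algebra_simps)
  qed simp
  then show "real k * ln k - k \<le> ln (fact k)" "ln (fact k) \<le> real k * ln k - k + ln k + 1"
    by (cases "k = 0"; simp)+
qed

lemma tendsto_x_ln_x_0: "((\<lambda>x::real. x * ln x) \<longlongrightarrow> 0) (at_right 0)"
proof (rule Lim_null_comparison[where g = "\<lambda>x. 2 * sqrt x"])
  show "\<forall>\<^sub>F x in at_right (0::real). norm (x * ln x) \<le> 2 * sqrt x"
  proof (rule eventually_at_rightI[of 0 1])
    fix x :: real assume x: "x \<in> {0<..<1}"
    have "ln (1 / sqrt x) \<le> 1 / sqrt x - 1" using x by (intro ln_le_minus_one) auto
    then have "- ln x / 2 \<le> 1 / sqrt x" using x by (simp add: ln_div ln_sqrt)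
    then have "x * (- ln x / 2) \<le> x * (1 / sqrt x)" using x by (intro mult_left_mono) auto
    also have "x * (1 / sqrt x) = sqrt x" using x by (simp add: real_div_sqrt)
    finally show "norm (x * ln x) \<le> 2 * sqrt x" using x by (simp add: abs_mult)
  qed simp
  have "((\<lambda>x. 2 * sqrt x) \<longlongrightarrow> 2 * sqrt 0) (at_right (0::real))" by (intro tendsto_intros)
  then show "((\<lambda>x. 2 * sqrt x) \<longlongrightarrow> 0) (at_right (0::real))" by simp
qed

text \<open>The limit \<open>q = 0\<close> belongs to letters of measure zero; there the convergence
  has to come from the right, hence the positivity.\<close>

lemma tendsto_x_ln_x:
  fixes x :: "nat \<Rightarrow> real"
  assumes x: "x \<longlonglongrightarrow> q" and pos: "\<forall>\<^sub>F n in sequentially. 0 < x n"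
  shows "(\<lambda>n. x n * ln (x n)) \<longlonglongrightarrow> q * ln q"
proof (cases "q = 0")
  case True
  have "filterlim x (at_right 0) sequentially"
    by (rule tendsto_imp_filterlim_at_right) (use x True pos in auto)
  from filterlim_compose[OF tendsto_x_ln_x_0 this] show ?thesis using True by simp
next
  case False
  then show ?thesis using x by (intro tendsto_intros) auto
qed

text \<open>The term \<open>k n * ln n\<close> is subtracted because in a multinomial coefficient
  such terms cancel, the counts adding up to the size; what remains is of order
  \<open>n\<close>.\<close>

lemma tendsto_ln_fact:
  fixes k :: "nat \<Rightarrow> nat"
  assumes k: "(\<lambda>n. real (k n) / n) \<longlonglongrightarrow> q" and k1: "\<And>n. 1 \<le> k n"
  shows "(\<lambda>n. (ln (fact (k n)) - real (k n) * ln n) / n) \<longlonglongrightarrow> q * ln q - q"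
proof -
  have lnn: "(\<lambda>n. ln (real n) / real n) \<longlonglongrightarrow> 0"
    by (rule filterlim_compose[OF ln_x_over_x_tendsto_0 filterlim_real_sequentially])
  have inv: "(\<lambda>n. 1 / real n) \<longlonglongrightarrow> 0" by (rule lim_1_over_n)
  have pos: "\<forall>\<^sub>F n in sequentially. 0 < real (k n) / n"
    using eventually_gt_at_top[of 0]
  proof eventually_elim
    case (elim n)
    then show ?case using k1[of n] by simp
  qed
  have main: "(\<lambda>n. real (k n) / n * ln (real (k n) / n) - real (k n) / n) \<longlonglongrightarrow> q * ln q - q"
    by (intro tendsto_diff tendsto_x_ln_x k pos)
  \<comment> \<open>\<open>k n\<close> is eventually below \<open>(\<bar>q\<bar> + 1) * n\<close>,
    so its logarithm exceeds \<open>ln n\<close> at most by a constant.\<close>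
  have lnk: "(\<lambda>n. ln (real (k n)) / n) \<longlonglongrightarrow> 0"
  proof (rule tendsto_sandwich[where f = "\<lambda>_. 0" and h = "\<lambda>n. ln (\<bar>q\<bar> + 1) * (1 / real n) + ln (real n) / real n"])
    show "\<forall>\<^sub>F n in sequentially. 0 \<le> ln (real (k n)) / n"
      using k1 by (intro always_eventually allI divide_nonneg_nonneg) auto
    have "\<forall>\<^sub>F n in sequentially. real (k n) / n < \<bar>q\<bar> + 1"
      using k by (rule order_tendstoD) simp
    then show "\<forall>\<^sub>F n in sequentially. ln (real (k n)) / n \<le> ln (\<bar>q\<bar> + 1) * (1 / real n) + ln (real n) / real n"
      using eventually_gt_at_top[of 0]
    proof eventually_elim
      case (elim n)
      then have "real (k n) < (\<bar>q\<bar> + 1) * n" by (simp add: divide_less_eq)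
      then have "ln (real (k n)) \<le> ln ((\<bar>q\<bar> + 1) * n)" using k1[of n] by simp
      also have "\<dots> = ln (\<bar>q\<bar> + 1) + ln n" using elim by (simp add: ln_mult)
      finally show ?case using elim by (simp add: add_divide_distrib[symmetric] divide_right_mono)
    qed
    have "(\<lambda>n. ln (\<bar>q\<bar> + 1) * (1 / real n) + ln (real n) / real n) \<longlonglongrightarrow> ln (\<bar>q\<bar> + 1) * 0 + 0"
      by (intro tendsto_intros inv lnn)
    then show "(\<lambda>n. ln (\<bar>q\<bar> + 1) * (1 / real n) + ln (real n) / real n) \<longlonglongrightarrow> 0" by simp
  qed simp
  have up: "(\<lambda>n. real (k n) / n * ln (real (k n) / n) - real (k n) / n + (ln (real (k n)) / n + 1 / n)) \<longlonglongrightarrow> q * ln q - q + (0 + 0)"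
    by (intro tendsto_add main lnk inv)
  have eq: "(real (k n) * ln (k n) - k n - real (k n) * ln n) / n = real (k n) / n * ln (real (k n) / n) - real (k n) / n" if "n > 0" for n
    using that k1[of n] by (simp add: ln_div algebra_simps diff_divide_distrib add_divide_distrib)
  show ?thesis
  proof (rule tendsto_sandwich[OF _ _ main])
    show "\<forall>\<^sub>F n in sequentially. real (k n) / n * ln (real (k n) / n) - real (k n) / n \<le> (ln (fact (k n)) - real (k n) * ln n) / n"
      using eventually_gt_at_top[of 0]
    proof eventually_elim
      case (elim n)
      show ?case unfolding eq[OF elim, symmetric] using ln_fact_bounds(1)[of "k n"] by (intro divide_right_mono) auto
    qed
    show "(\<lambda>n. real (k n) / n * ln (real (k n) / n) - real (k n) / n + (ln (real (k n)) / n + 1 / n)) \<longlonglongrightarrow> q * ln q - q"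
      using up by simp
    show "\<forall>\<^sub>F n in sequentially. (ln (fact (k n)) - real (k n) * ln n) / n \<le>
        real (k n) / n * ln (real (k n) / n) - real (k n) / n + (ln (real (k n)) / n + 1 / n)"
      using eventually_gt_at_top[of 0]
    proof eventually_elim
      case (elim n)
      have "(ln (fact (k n)) - real (k n) * ln n) / n \<le> ((real (k n) * ln (k n) - k n - real (k n) * ln n) + (ln (k n) + 1)) / n"
        using ln_fact_bounds(2)[of "k n"] by (intro divide_right_mono) auto
      also have "\<dots> = (real (k n) * ln (k n) - k n - real (k n) * ln n) / n + (ln (real (k n)) / n + 1 / n)"
        by (simp add: add_divide_distrib)
      finally show ?case unfolding eq[OF elim] .
    qed
  qed
qed

lemma (in ordered_sponge) fibre_card_mult:
  "fibre_card M i * card (perms (image_mset (\<lambda>a. restrict a (below i)) M)) =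
    card (perms (image_mset (\<lambda>a. restrict a (lower i)) M))"
proof -
  let ?f = "\<lambda>a. restrict a (lower i)" and ?g = "\<lambda>a. restrict a (below i)"
  have gf: "?g (?f a) = ?g a" for a :: "'n \<Rightarrow> 'a" by (auto simp: restrict_def fun_eq_iff)
  define A where "A = image_mset ?f M"
  have gA: "image_mset ?g A = image_mset ?g M" unfolding A_def multiset.map_comp comp_def gf ..
  obtain c where c: "mset c = image_mset ?g A" using ex_mset by blast
  note e = card_fibre_permutations[OF c, unfolded gA]
  have "card (perms (image_mset ?g M)) \<noteq> 0" by simp
  then have "fibre_card M i = card {v \<in> perms A. map ?g v = c}"
    unfolding fibre_card_def A_def[symmetric] e[symmetric]
    by (simp only: nonzero_mult_div_cancel_right simp_thms not_False_eq_True)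
  then show ?thesis using e by (simp only: A_def)
qed

section \<open>Entropy of the coordinate projections\<close>

definition marginal :: "('n \<Rightarrow> 'a) set \<Rightarrow> (('n \<Rightarrow> 'a) \<Rightarrow> real) \<Rightarrow> 'n set \<Rightarrow> ('n \<Rightarrow> 'a) \<Rightarrow> real" where
  "marginal E q J b = (\<Sum>a | a \<in> E \<and> restrict a J = restrict b J. q a)"

text \<open>The Shannon entropy of the image of \<open>q\<close> under restriction to
  \<open>J\<close>. As a sum over letters, not over their projections, it is the expectation of
  \<open>- ln (marginal E q J a)\<close>, to which Hoeffding's inequality will be applied.\<close>

definition entropy_on :: "('n \<Rightarrow> 'a) set \<Rightarrow> (('n \<Rightarrow> 'a) \<Rightarrow> real) \<Rightarrow> 'n set \<Rightarrow> real" where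
  "entropy_on E q J = - (\<Sum>a\<in>E. q a * ln (marginal E q J a))"

text \<open>Kept outside the locales: positivity of the exponents is needed already to obtain their
  assumption \<open>good\<close> from \<open>good_measure\<close>, which speaks of
  \<open>x > 0\<close>.\<close>

lemma weighted_ln_ratio_neg:
  assumes "diagonal_ifs \<Phi>" and nonneg: "\<And>a. a \<in> index_set \<Phi> \<Longrightarrow> 0 \<le> q a"
    and sum1: "(\<Sum>a\<in>index_set \<Phi>. q a) = 1"
  shows "(\<Sum>a\<in>index_set \<Phi>. q a * ln (ifs_ratio \<Phi> a i)) < 0"
proof -
  have "\<exists>a\<in>index_set \<Phi>. q a \<noteq> 0"
  proof (rule ccontr)
    assume "\<not> ?thesis"
    then have "(\<Sum>a\<in>index_set \<Phi>. q a) = 0" by (intro sum.neutral) auto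
    then show False using sum1 by simp
  qed
  then obtain a where a: "a \<in> index_set \<Phi>" "0 < q a" using nonneg by force
  have neg: "ln (ifs_ratio \<Phi> b i) < 0" if "b \<in> index_set \<Phi>" for b
    using ifs_ratio_bounds(1,2)[OF assms(1) that, of i] by simp
  have "0 < (\<Sum>a\<in>index_set \<Phi>. q a * - ln (ifs_ratio \<Phi> a i))"
    by (rule sum_pos2[OF finite_index_set[OF assms(1)] a(1)])
      (use a neg nonneg in \<open>auto intro!: mult_pos_neg intro: mult_nonneg_nonpos less_imp_le\<close>)
  then show ?thesis by (simp add: sum_negf)
qed

locale weighted_sponge = ordered_sponge \<Phi> \<theta> for \<Phi> :: "('n::finite, 'a) diag_ifs" and \<theta> :: "'n \<Rightarrow> real" +
  fixes q :: "('n \<Rightarrow> 'a) \<Rightarrow> real"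
  assumes q_nonneg: "\<And>a. a \<in> index_set \<Phi> \<Longrightarrow> 0 \<le> q a"
    and q_sum: "(\<Sum>a\<in>index_set \<Phi>. q a) = 1"
    and theta_eq: "\<And>i. \<theta> i = - (\<Sum>a\<in>index_set \<Phi>. q a * ln (ifs_ratio \<Phi> a i))"
begin

lemma finite_E: "finite E" by (rule finite_index_set[OF ifs])

lemma theta_pos: "0 < \<theta> i"
  using weighted_ln_ratio_neg[OF ifs q_nonneg q_sum] by (simp add: theta_eq)

text \<open>The summand 1 makes every letter occur, also those of measure zero, as irreducibility requires.\<close>

definition cnt :: "nat \<Rightarrow> ('n \<Rightarrow> 'a) \<Rightarrow> nat" where
  "cnt n a = nat \<lfloor>n * q a\<rfloor> + 1"

definition Mn :: "nat \<Rightarrow> ('n \<Rightarrow> 'a) multiset" where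
  "Mn n = (\<Sum>a\<in>E. replicate_mset (cnt n a) a)"

lemma count_Mn: "count (Mn n) a = (if a \<in> E then cnt n a else 0)"
proof -
  have "count (Mn n) a = (\<Sum>b\<in>E. if a = b then cnt n b else 0)"
    by (simp add: Mn_def count_sum)
  then show ?thesis using finite_E by (simp add: sum.delta)
qed

lemma set_Mn: "set_mset (Mn n) = E"
  by (auto simp: set_mset_def count_Mn cnt_def)

lemma cnt_bounds:
  assumes "a \<in> E" shows "n * q a \<le> cnt n a" "cnt n a \<le> n * q a + 1"
proof -
  have "0 \<le> n * q a" using q_nonneg[OF assms] by simp
  then have "real (cnt n a) = of_int \<lfloor>n * q a\<rfloor> + 1" by (simp add: cnt_def)
  then show "n * q a \<le> cnt n a" "cnt n a \<le> n * q a + 1" by linarith+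
qed

text \<open>A sequence \<open>m\<close> is allowed because the suffix of the words will have type
  \<open>Mn (m n)\<close>.\<close>

lemma tendsto_cnt:
  fixes m :: "nat \<Rightarrow> nat"
  assumes m: "(\<lambda>n. real (m n) / n) \<longlonglongrightarrow> t" and a: "a \<in> E"
  shows "(\<lambda>n. real (cnt (m n) a) / n) \<longlonglongrightarrow> t * q a"
proof (rule tendsto_sandwich)
  show "(\<lambda>n. real (m n) / n * q a) \<longlonglongrightarrow> t * q a" by (intro tendsto_intros m)
  have "(\<lambda>n. real (m n) / n * q a + 1 / n) \<longlonglongrightarrow> t * q a + 0"
    by (intro tendsto_intros m lim_1_over_n)
  then show "(\<lambda>n. real (m n) / n * q a + 1 / n) \<longlonglongrightarrow> t * q a" by simp
  show "\<forall>\<^sub>F n in sequentially. real (m n) / n * q a \<le> real (cnt (m n) a) / n"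
    using cnt_bounds(1)[OF a] by (intro always_eventually allI) (simp add: divide_right_mono)
  show "\<forall>\<^sub>F n in sequentially. real (cnt (m n) a) / n \<le> real (m n) / n * q a + 1 / n"
  proof (intro always_eventually allI)
    fix n
    have "real (cnt (m n) a) / real n \<le> (real (m n) * q a + 1) / real n"
      using cnt_bounds(2)[OF a] by (intro divide_right_mono) auto
    then show "real (cnt (m n) a) / n \<le> real (m n) / n * q a + 1 / n" by (simp add: add_divide_distrib)
  qed
qed

lemma tendsto_n_over_n: "(\<lambda>n. real n / real n) \<longlonglongrightarrow> 1"
  by (rule tendsto_eventually) (use eventually_gt_at_top[of 0] in \<open>eventually_elim, simp\<close>)

text \<open>A multinomial coefficient grows exponentially at the rate of the entropy: Stirling
  applies to every factorial, and the linear terms cancel because the limiting frequencies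
  \<open>Q\<close> sum to 1.\<close>

lemma ln_card_permutations:
  "(\<lambda>n. ln (card (perms (image_mset (\<lambda>a. restrict a J) (Mn n)))) / n) \<longlonglongrightarrow> entropy_on E q J"
proof -
  let ?f = "\<lambda>a. restrict a J"
  define B where "B = ?f ` E"
  define A where "A = (\<lambda>n. image_mset ?f (Mn n))"
  have finB: "finite B" using finite_E by (simp add: B_def)
  have setA: "set_mset (A n) = B" for n by (simp add: A_def B_def set_Mn)
  have cA: "count (A n) b = (\<Sum>a | a \<in> E \<and> ?f a = b. cnt n a)" if "b \<in> B" for n b
    unfolding A_def count_image_mset' set_Mn by (rule sum.cong) (auto simp: count_Mn)
  define Q where "Q = (\<lambda>b. \<Sum>a | a \<in> E \<and> ?f a = b. q a)"
  have lim_b: "(\<lambda>n. real (count (A n) b) / n) \<longlonglongrightarrow> Q b" if "b \<in> B" for b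
  proof -
    have "(\<lambda>n. \<Sum>a | a \<in> E \<and> ?f a = b. real (cnt n a) / n) \<longlonglongrightarrow> (\<Sum>a | a \<in> E \<and> ?f a = b. 1 * q a)"
      by (intro tendsto_sum tendsto_cnt[OF tendsto_n_over_n]) auto
    then show ?thesis by (simp add: cA[OF that] Q_def sum_divide_distrib)
  qed
  have sumQ: "(\<Sum>b\<in>B. Q b) = 1"
    unfolding Q_def B_def q_sum[symmetric] by (rule sum.image_gen[OF finite_E, symmetric])
  have size: "size (A n) = (\<Sum>b\<in>B. count (A n) b)" for n
    by (simp add: size_multiset_overloaded_eq setA)
  have lim_s: "(\<lambda>n. real (size (A n)) / n) \<longlonglongrightarrow> 1"
    using tendsto_sum[of B "\<lambda>b n. real (count (A n) b) / n" Q sequentially, OF lim_b]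
    by (simp add: size sumQ sum_divide_distrib)
  have cnt1: "1 \<le> count (A n) b" if "b \<in> B" for n b
    using that setA[of n] by (metis Suc_leI One_nat_def count_greater_zero_iff)
  have "E \<noteq> {}" using ifs by (simp add: diagonal_ifs_def)
  then obtain b0 where b0: "b0 \<in> B" by (auto simp: B_def)
  have size1: "1 \<le> size (A n)" for n
  proof -
    have "count (A n) b0 \<le> size (A n)" by (rule count_le_size)
    then show ?thesis by (rule order_trans[OF cnt1[OF b0]])
  qed
  have eq: "ln (card (perms (A n))) / n =
      (ln (fact (size (A n))) - real (size (A n)) * ln n) / n -
      (\<Sum>b\<in>B. (ln (fact (count (A n) b)) - real (count (A n) b) * ln n) / n)" for n
  proof -
    define P where "P = real (card (perms (A n)))"
    have P0: "P \<noteq> 0" by (simp add: P_def)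
    have "real (card (perms (A n)) * (\<Prod>b\<in>set_mset (A n). fact (count (A n) b))) = real (fact (size (A n)))"
      using card_permutations_of_multiset_aux[of "A n"] by simp
    then have e: "P * (\<Prod>b\<in>B. fact (count (A n) b)) = fact (size (A n))" by (simp add: P_def setA)
    have "ln P + ln (\<Prod>b\<in>B. fact (count (A n) b)) = ln (P * (\<Prod>b\<in>B. fact (count (A n) b)))"
      using P0 finB by (subst ln_mult) auto
    then have "ln P + (\<Sum>b\<in>B. ln (fact (count (A n) b))) = ln (fact (size (A n)))"
      unfolding e using finB by (simp add: ln_prod)
    \<comment> \<open>The counts sum to the size, so the inserted multiples of \<open>ln n\<close>
      cancel.\<close>
    then have "ln P = (ln (fact (size (A n))) - real (size (A n)) * ln n) - (\<Sum>b\<in>B. ln (fact (count (A n) b)) - real (count (A n) b) * ln n)"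
      by (simp add: sum_subtractf size sum_distrib_right)
    then show ?thesis by (simp add: P_def diff_divide_distrib sum_divide_distrib)
  qed
  have "(\<lambda>n. ln (card (perms (A n))) / n) \<longlonglongrightarrow> (1 * ln 1 - 1) - (\<Sum>b\<in>B. Q b * ln (Q b) - Q b)"
    unfolding eq by (intro tendsto_diff tendsto_sum tendsto_ln_fact lim_s lim_b size1 cnt1)
  moreover have "(1 * ln 1 - 1) - (\<Sum>b\<in>B. Q b * ln (Q b) - Q b) = entropy_on E q J"
  proof -
    have "(\<Sum>a\<in>E. q a * ln (marginal E q J a)) = (\<Sum>b\<in>B. \<Sum>a | a \<in> E \<and> ?f a = b. q a * ln (marginal E q J a))"
      unfolding B_def by (rule sum.image_gen[OF finite_E])
    also have "\<dots> = (\<Sum>b\<in>B. \<Sum>a | a \<in> E \<and> ?f a = b. q a * ln (Q b))"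
      by (intro sum.cong refl) (auto simp: marginal_def Q_def)
    also have "\<dots> = (\<Sum>b\<in>B. Q b * ln (Q b))" by (simp add: Q_def sum_distrib_right)
    finally show ?thesis by (simp add: entropy_on_def sum_subtractf sumQ)
  qed
  ultimately show ?thesis by (simp add: A_def)
qed

lemma ln_fibre_card:
  "(\<lambda>n. ln (fibre_card (Mn n) i) / n) \<longlonglongrightarrow>
    entropy_on E q (lower i) - entropy_on E q (below i)"
proof -
  let ?c = "\<lambda>J n. real (card (perms (image_mset (\<lambda>a. restrict a J) (Mn n))))"
  have "ln (fibre_card (Mn n) i) / n = ln (?c (lower i) n) / n - ln (?c (below i) n) / n" for n
  proof -
    have f: "real (fibre_card (Mn n) i) \<noteq> 0" using fibre_card_ge[OF set_Mn, of n i] by simp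
    have c: "?c (below i) n \<noteq> 0" by simp
    have "?c (lower i) n = real (fibre_card (Mn n) i) * ?c (below i) n"
      unfolding fibre_card_mult[symmetric] by simp
    then show ?thesis using f c by (simp only: ln_mult) (simp add: add_divide_distrib)
  qed
  then show ?thesis by (simp only:) (intro tendsto_diff ln_card_permutations)
qed

definition delta :: real where
  "delta = (\<Sum>i\<in>UNIV. (entropy_on E q (lower i) - entropy_on E q (below i)) / \<theta> i)"

section \<open>Subsponges with dimension near a prescribed value\<close>

lemma ln_ratio_Mn: "- ln (\<Prod>a\<in>#Mn n. ifs_ratio \<Phi> a i) = (\<Sum>a\<in>E. cnt n a * - ln (ifs_ratio \<Phi> a i))"
proof -
  have pos: "0 < ifs_ratio \<Phi> a i" if "a \<in> E" for a using ifs_ratio_bounds(1)[OF ifs that] .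
  have "(\<Prod>a\<in>#Mn n. ifs_ratio \<Phi> a i) = (\<Prod>a\<in>E. ifs_ratio \<Phi> a i ^ cnt n a)"
    unfolding image_prod_mset_multiplicity set_Mn by (rule prod.cong) (auto simp: count_Mn)
  also have "ln \<dots> = (\<Sum>a\<in>E. ln (ifs_ratio \<Phi> a i ^ cnt n a))"
    by (rule ln_prod[OF finite_E]) (use pos in \<open>simp add: less_imp_neq[THEN not_sym]\<close>)
  also have "\<dots> = (\<Sum>a\<in>E. cnt n a * ln (ifs_ratio \<Phi> a i))"
    by (intro sum.cong refl) (simp add: ln_realpow)
  finally show ?thesis by (simp add: sum_negf)
qed

lemma tendsto_ratio_Mn:
  fixes m :: "nat \<Rightarrow> nat"
  assumes m: "(\<lambda>n. real (m n) / n) \<longlonglongrightarrow> t"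
  shows "(\<lambda>n. - ln (\<Prod>a\<in>#Mn (m n). ifs_ratio \<Phi> a i) / n) \<longlonglongrightarrow> t * \<theta> i"
proof -
  have "(\<lambda>n. \<Sum>a\<in>E. real (cnt (m n) a) / n * - ln (ifs_ratio \<Phi> a i)) \<longlonglongrightarrow> (\<Sum>a\<in>E. t * q a * - ln (ifs_ratio \<Phi> a i))"
    by (intro tendsto_sum tendsto_mult tendsto_cnt[OF m] tendsto_const)
  then show ?thesis
    unfolding ln_ratio_Mn by (simp add: theta_eq sum_divide_distrib sum_distrib_left sum_negf mult.assoc)
qed

text \<open>After division by \<open>n\<close>, the logarithms of the fibre sizes tend to the
  entropy increments and \<open>- ln (r n i)\<close> to \<open>(1 + t) * \<theta> i\<close>. The
  factor \<open>1 + t\<close> is common to all coordinates, so their order stays intact; the fixed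
  word \<open>u\<close> disappears in the limit.\<close>

lemma ex_sponge_near_scaled:
  assumes t: "0 \<le> t" and e: "0 < e"
  shows "\<exists>\<Psi> :: ('n, nat) diag_ifs. diagonal_ifs \<Psi> \<and> strongly_lalley_gatzouras \<Psi> \<and>
    limit_set \<Psi> \<subseteq> limit_set \<Phi> \<and> hyperplane_diffuse (limit_set \<Psi>) \<and>
    \<bar>lower_assouad_dim (limit_set \<Psi>) - delta / (1 + t)\<bar> < e"
proof -
  obtain u where u: "set u \<subseteq> E" "\<And>i x. x \<in> {0..1} \<Longrightarrow> wmap \<Phi> i (word_coord i u) x \<in> {0<..<1}"
    using ex_interior_word by blast
  define m where "m = (\<lambda>n::nat. nat \<lfloor>t * n\<rfloor>)"
  have m: "(\<lambda>n. real (m n) / n) \<longlonglongrightarrow> t"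
  proof (rule tendsto_sandwich)
    have b: "t * n - 1 \<le> real (m n)" "real (m n) \<le> t * n" for n
    proof -
      have "real (m n) = of_int \<lfloor>t * n\<rfloor>" using t by (simp add: m_def)
      then show "t * n - 1 \<le> real (m n)" "real (m n) \<le> t * n" by linarith+
    qed
    show "\<forall>\<^sub>F n in sequentially. t - 1 / n \<le> real (m n) / n"
      using eventually_gt_at_top[of 0]
    proof eventually_elim
      case (elim n)
      have "(t * n - 1) / n \<le> real (m n) / n" using b(1) by (rule divide_right_mono) simp
      then show ?case using elim by (simp add: diff_divide_distrib)
    qed
    show "\<forall>\<^sub>F n in sequentially. real (m n) / n \<le> t"
      using eventually_gt_at_top[of 0]
    proof eventually_elim
      case (elim n)
      then show ?case using b(2)[of n] by (simp add: divide_le_eq)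
    qed
    have "(\<lambda>n. t - 1 / real n) \<longlonglongrightarrow> t - 0" by (intro tendsto_intros lim_1_over_n)
    then show "(\<lambda>n. t - 1 / real n) \<longlonglongrightarrow> t" by simp
  qed simp
  \<comment> \<open>This suffix multiplies all logarithmic ratios by about \<open>1 + t\<close> without adding any words.\<close>
  define x0 where "x0 = (\<lambda>n. SOME w. mset w = Mn (m n))"
  have x0: "mset (x0 n) = Mn (m n)" for n unfolding x0_def using ex_mset by (rule someI_ex)
  define z where "z = (\<lambda>n. x0 n @ u)"
  have x0E: "set (x0 n) \<subseteq> E" for n using x0[of n] set_Mn by (metis set_mset_mset subset_refl)
  have z: "set (z n) \<subseteq> E" for n using x0E u(1) by (simp add: z_def)
  have interior: "wmap \<Phi> i (word_coord i (z n)) x \<in> {0<..<1}" if "x \<in> {0..1}" for n i x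
    using wmap_open_mem[OF ifs x0E u(2)[OF that]] by (simp add: z_def wmap_append)
  define r where "r = (\<lambda>n i. (\<Prod>a\<in>#Mn n. ifs_ratio \<Phi> a i) * word_ratio \<Phi> (z n) i)"
  have pm_pos: "0 < (\<Prod>a\<in>#Mn n. ifs_ratio \<Phi> a i)" for n i
    unfolding image_prod_mset_multiplicity set_Mn
    by (intro prod_pos zero_less_power) (use ifs_ratio_bounds(1)[OF ifs] in blast)
  have wu: "0 < word_ratio \<Phi> u i" for i
  proof -
    have "0 < word_ratio \<Phi> v i" if "set v \<subseteq> E" for v
      using that by (induction v) (auto simp: word_ratio_def ifs_ratio_bounds(1)[OF ifs])
    then show ?thesis using u(1) .
  qed
  have z_ratio: "word_ratio \<Phi> (z n) i = (\<Prod>a\<in>#Mn (m n). ifs_ratio \<Phi> a i) * word_ratio \<Phi> u i" for n i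
  proof -
    have "word_ratio \<Phi> (x0 n) i = (\<Prod>a\<in>#Mn (m n). ifs_ratio \<Phi> a i)"
      by (simp add: word_ratio_def x0[symmetric] prod_mset_prod_list[symmetric])
    then show ?thesis by (simp add: z_def word_ratio_def)
  qed
  have r_pos: "0 < r n i" for n i unfolding r_def z_ratio using pm_pos wu by simp
  have lim_r: "(\<lambda>n. - ln (r n i) / n) \<longlonglongrightarrow> (1 + t) * \<theta> i" for i
  proof -
    have eq: "- ln (r n i) / n = - ln (\<Prod>a\<in>#Mn n. ifs_ratio \<Phi> a i) / n +
        - ln (\<Prod>a\<in>#Mn (m n). ifs_ratio \<Phi> a i) / n + - ln (word_ratio \<Phi> u i) * (1 / n)" for n
    proof -
      have "ln (r n i) = ln (\<Prod>a\<in>#Mn n. ifs_ratio \<Phi> a i) + (ln (\<Prod>a\<in>#Mn (m n). ifs_ratio \<Phi> a i) + ln (word_ratio \<Phi> u i))"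
        unfolding r_def z_ratio using pm_pos wu by (simp add: ln_mult_pos)
      then show ?thesis by (simp add: add_divide_distrib diff_divide_distrib)
    qed
    have "(\<lambda>n. - ln (\<Prod>a\<in>#Mn n. ifs_ratio \<Phi> a i) / n +
        - ln (\<Prod>a\<in>#Mn (m n). ifs_ratio \<Phi> a i) / n + - ln (word_ratio \<Phi> u i) * (1 / n)) \<longlonglongrightarrow>
        1 * \<theta> i + t * \<theta> i + - ln (word_ratio \<Phi> u i) * 0"
      by (intro tendsto_add tendsto_mult tendsto_const lim_1_over_n tendsto_ratio_Mn[OF m]
          tendsto_ratio_Mn[OF tendsto_n_over_n])
    then show ?thesis unfolding eq by (simp add: distrib_right)
  qed
  \<comment> \<open>Distinct limits decide the order of the two ratios from some \<open>n\<close>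
    on; there are finitely many pairs.\<close>
  have ord1: "\<forall>\<^sub>F n in sequentially. \<theta> i < \<theta> j \<longrightarrow> r n j < r n i" for i j
  proof (cases "\<theta> i < \<theta> j")
    case True
    then have "0 < (1 + t) * \<theta> j - (1 + t) * \<theta> i" using t by simp
    moreover have "(\<lambda>n. - ln (r n j) / n - - ln (r n i) / n) \<longlonglongrightarrow> (1 + t) * \<theta> j - (1 + t) * \<theta> i"
      by (intro tendsto_diff lim_r)
    ultimately have "\<forall>\<^sub>F n in sequentially. 0 < - ln (r n j) / n - - ln (r n i) / n"
      by (rule order_tendstoD(1)[rotated])
    then show ?thesis
      using eventually_gt_at_top[of 0]
    proof eventually_elim
      case (elim n)
      then have "ln (r n j) / n < ln (r n i) / n" by simp
      then have "ln (r n j) < ln (r n i)" using elim(2) by (simp add: divide_less_cancel)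
      then show ?case using r_pos by simp
    qed
  qed simp
  have ord: "\<forall>\<^sub>F n in sequentially. \<forall>i j. \<theta> i < \<theta> j \<longrightarrow> r n j < r n i"
    by (intro eventually_all_finite ord1)
  define dm where "dm = (\<lambda>n. \<Sum>i\<in>UNIV. ln (fibre_card (Mn n) i) / - ln (r n i))"
  have "dm \<longlonglongrightarrow> delta / (1 + t)"
  proof -
    have lim: "(\<lambda>n. \<Sum>i\<in>UNIV. (ln (fibre_card (Mn n) i) / n) / (- ln (r n i) / n)) \<longlonglongrightarrow>
        (\<Sum>i\<in>UNIV. (entropy_on E q (lower i) - entropy_on E q (below i)) / ((1 + t) * \<theta> i))"
      using t theta_pos by (intro tendsto_sum tendsto_divide ln_fibre_card lim_r) (simp add: less_imp_neq[THEN not_sym])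
    have sum: "(\<Sum>i\<in>UNIV. (entropy_on E q (lower i) - entropy_on E q (below i)) / ((1 + t) * \<theta> i)) = delta / (1 + t)"
      by (simp add: delta_def sum_divide_distrib mult.commute)
    have ev: "\<forall>\<^sub>F n in sequentially. (\<Sum>i\<in>UNIV. (ln (fibre_card (Mn n) i) / n) / (- ln (r n i) / n)) = dm n"
      using eventually_gt_at_top[of 0] by eventually_elim (simp add: dm_def)
    show ?thesis by (rule Lim_transform_eventually[OF lim[unfolded sum] ev])
  qed
  then have "\<forall>\<^sub>F n in sequentially. dist (dm n) (delta / (1 + t)) < e" using e by (rule tendstoD)
  with ord have "\<forall>\<^sub>F n in sequentially. dist (dm n) (delta / (1 + t)) < e \<and> (\<forall>i j. \<theta> i < \<theta> j \<longrightarrow> r n j < r n i)"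
    by eventually_elim blast
  then obtain n where n: "dist (dm n) (delta / (1 + t)) < e" "\<And>i j. \<theta> i < \<theta> j \<Longrightarrow> r n j < r n i"
    using eventually_happens' sequentially_bot by blast
  have order: "r n i < r n j \<longleftrightarrow> \<theta> j < \<theta> i" for i j
  proof
    assume lt: "r n i < r n j"
    then have "i \<noteq> j" by auto
    then have "\<theta> i \<noteq> \<theta> j" using inj_theta by (auto dest: injD)
    then show "\<theta> j < \<theta> i" using n(2)[of i j] lt by linarith
  qed (rule n(2))
  define W where "W = {w @ z n | w. mset w = Mn n}"
  have "finite W"
  proof -
    have "W = (\<lambda>w. w @ z n) ` {w. mset w = Mn n}" by (auto simp: W_def)
    then show ?thesis using finite_permutations_of_multiset[of "Mn n"] by (simp add: permutations_of_multiset_def)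
  qed
  then have "finite (\<Union>i. word_coord i ` W)" by auto
  then obtain enc :: "'a list \<Rightarrow> nat" where enc: "inj_on enc (\<Union>i. word_coord i ` W)"
    by (metis finite_imp_inj_to_nat_seg)
  have hs: "hom_sponge (word_ifs \<Phi> W enc) (r n) (fibre_card (Mn n))"
    and sub: "limit_set (word_ifs \<Phi> W enc) \<subseteq> limit_set \<Phi>"
    unfolding W_def r_def
    by (rule hom_sponge_words[OF set_Mn z interior order[unfolded r_def] enc[unfolded W_def]], assumption)+
  interpret hom_sponge "word_ifs \<Phi> W enc" "r n" "fibre_card (Mn n)" by (rule hs)
  have "lower_assouad_dim (limit_set (word_ifs \<Phi> W enc)) = dm n"
    by (simp add: lower_assouad_dim_limit_set dimval_def dm_def)
  then show ?thesis
    using n(1) sub hom_sponge.ifs[OF hs] strongly_lalley_gatzouras_sponge hyperplane_diffuse_limit_set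
    by (intro exI[of _ "word_ifs \<Phi> W enc"]) (simp add: dist_real_def)
qed

lemma ex_sponge_near:
  assumes t: "0 \<le> t" "t \<le> delta" and e: "0 < e"
  shows "\<exists>\<Psi> :: ('n, nat) diag_ifs. diagonal_ifs \<Psi> \<and> strongly_lalley_gatzouras \<Psi> \<and>
    limit_set \<Psi> \<subseteq> limit_set \<Phi> \<and> hyperplane_diffuse (limit_set \<Psi>) \<and>
    \<bar>lower_assouad_dim (limit_set \<Psi>) - t\<bar> < e"
proof -
  obtain s where s: "0 \<le> s" "\<bar>delta / (1 + s) - t\<bar> < e / 2"
  proof (cases "t = 0")
    case True
    \<comment> \<open>For \<open>delta > 0\<close> no \<open>s\<close> gives the value 0 exactly;
      this one brings \<open>delta / (1 + s)\<close> below \<open>e / 2\<close>.\<close>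
    define s where "s = 2 * delta / e"
    have "0 \<le> s" using t e by (simp add: s_def)
    moreover have "delta / (1 + s) < e / 2"
      using t e by (simp add: s_def field_simps)
    moreover have "0 \<le> delta / (1 + s)" using t \<open>0 \<le> s\<close> by simp
    ultimately show ?thesis using that True by simp
  next
    case False
    then have "0 \<le> delta / t - 1" using t by (simp add: le_divide_eq)
    moreover have "delta / (1 + (delta / t - 1)) = t" using False t by simp
    ultimately show ?thesis using that[of "delta / t - 1"] e by simp
  qed
  from ex_sponge_near_scaled[OF s(1), of "e / 2"] e obtain \<Psi> :: "('n, nat) diag_ifs" where \<Psi>: "diagonal_ifs \<Psi>"
    "strongly_lalley_gatzouras \<Psi>" "limit_set \<Psi> \<subseteq> limit_set \<Phi>" "hyperplane_diffuse (limit_set \<Psi>)"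
    "\<bar>lower_assouad_dim (limit_set \<Psi>) - delta / (1 + s)\<bar> < e / 2" by auto
  have "\<bar>lower_assouad_dim (limit_set \<Psi>) - t\<bar> < e" using \<Psi>(5) s(2) by linarith
  then show ?thesis using \<Psi> by blast
qed

text \<open>Read off from counting: the increment is a limit of logarithms of positive integers
  divided by \<open>n\<close>.\<close>

lemma entropy_increment_nonneg: "0 \<le> entropy_on E q (lower i) - entropy_on E q (below i)"
proof -
  have "1 \<le> real (fibre_card (Mn n) i)" for n using fibre_card_ge[OF set_Mn, of n i] by simp
  then have "0 \<le> ln (fibre_card (Mn n) i) / n" for n by simp
  then show ?thesis by (intro LIMSEQ_le_const[OF ln_fibre_card]) auto
qed

end

section \<open>Hausdorff measure and Bernoulli measures\<close>

lemma hausdorff_premeasure_le_double: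
  fixes f :: "nat \<Rightarrow> nat \<Rightarrow> 'v::euclidean_space set"
  assumes "S \<subseteq> (\<Union>n m. f n m)" "\<And>n m. bounded (f n m)" "\<And>n m. diameter (f n m) \<le> \<delta>"
  shows "hausdorff_premeasure s \<delta> S \<le> (\<Sum>n. \<Sum>m. hausdorff_gauge s (f n m))"
proof -
  define U where "U = (\<lambda>k. case_prod f (prod_decode k))"
  have "x \<in> (\<Union>k. U k)" if x: "x \<in> S" for x
  proof -
    obtain n m where "x \<in> f n m" using assms(1) x by auto
    then have "x \<in> U (prod_encode (n, m))" by (simp add: U_def)
    then show ?thesis by blast
  qed
  then have "hausdorff_premeasure s \<delta> S \<le> (\<Sum>k. hausdorff_gauge s (U k))"
    unfolding hausdorff_premeasure_def
    by (intro INF_lower) (use assms(2,3) in \<open>auto simp: U_def split: prod.split\<close>)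
  also have "\<dots> = (\<Sum>k. (\<lambda>(n, m). hausdorff_gauge s (f n m)) (prod_decode k))"
    by (intro suminf_cong) (simp add: U_def split: prod.split)
  also have "\<dots> = (\<Sum>n. \<Sum>m. hausdorff_gauge s (f n m))"
    by (rule suminf_ennreal_2dimen) simp
  finally show ?thesis .
qed

lemma hausdorff_gauge_le:
  assumes "0 < s" "bounded U" "diameter U \<le> d"
  shows "hausdorff_gauge s U \<le> ennreal (d powr s)"
proof -
  have "diameter U powr s \<le> d powr s"
    using assms diameter_ge_0[OF assms(2)] by (intro powr_mono2) auto
  then show ?thesis using assms(1) by (auto simp: hausdorff_gauge_def intro: ennreal_leI)
qed

lemma hausdorff_premeasure_le_families:
  fixes C :: "nat \<Rightarrow> 'v::euclidean_space set set"
  assumes s: "0 < s" and fin: "\<And>n. finite (C n)"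
    and diam: "\<And>n U. U \<in> C n \<Longrightarrow> bounded U \<and> diameter U \<le> d n" and d: "\<And>n. d n \<le> \<delta>" "0 \<le> \<delta>"
    and S: "S \<subseteq> (\<Union>n. \<Union>(C n))"
    and b: "\<And>n. card (C n) * d n powr s \<le> b n" "summable b"
  shows "hausdorff_premeasure s \<delta> S \<le> ennreal (suminf b)"
proof -
  have "\<forall>n. \<exists>e. bij_betw e {0..<card (C n)} (C n)" using ex_bij_betw_nat_finite[OF fin] by blast
  from choice[OF this] obtain e where e: "\<And>n. bij_betw (e n) {0..<card (C n)} (C n)" by auto
  \<comment> \<open>Each finite family becomes a sequence, filled up with the empty set, whose gauge
    is 0.\<close>
  define f where "f = (\<lambda>n m. if m < card (C n) then e n m else {})"
  have fC: "f n m \<in> C n \<or> f n m = {}" for n m using bij_betwE[OF e[of n]] by (auto simp: f_def)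
  have bn: "0 \<le> b n" for n using b(1)[of n] by (rule order_trans[rotated]) simp
  have "hausdorff_premeasure s \<delta> S \<le> (\<Sum>n. \<Sum>m. hausdorff_gauge s (f n m))"
  proof (rule hausdorff_premeasure_le_double)
    show "S \<subseteq> (\<Union>n m. f n m)"
    proof
      fix x assume "x \<in> S"
      then obtain n U where U: "x \<in> U" "U \<in> C n" using S by auto
      have "U \<in> e n ` {0..<card (C n)}" using U(2) bij_betw_imp_surj_on[OF e[of n]] by simp
      then obtain m where "m \<in> {0..<card (C n)}" "U = e n m" by blast
      then have "x \<in> f n m" using U by (simp add: f_def)
      then show "x \<in> (\<Union>n m. f n m)" by blast
    qed
    show "bounded (f n m)" for n m using fC[of n m] diam by auto
    show "diameter (f n m) \<le> \<delta>" for n m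
    proof (cases "f n m = {}")
      case False
      then have "diameter (f n m) \<le> d n" using fC[of n m] diam[of "f n m" n] by blast
      then show ?thesis using d(1)[of n] by (rule order_trans)
    qed (use d(2) in simp)
  qed
  also have "\<dots> \<le> (\<Sum>n. ennreal (b n))"
  proof (intro suminf_le)
    fix n
    have "(\<Sum>m. hausdorff_gauge s (f n m)) = (\<Sum>m<card (C n). hausdorff_gauge s (f n m))"
      by (rule suminf_finite) (auto simp: f_def hausdorff_gauge_def)
    also have "\<dots> \<le> (\<Sum>m<card (C n). ennreal (d n powr s))"
    proof (rule sum_mono)
      fix m assume "m \<in> {..<card (C n)}"
      then have "f n m \<in> C n" using bij_betwE[OF e[of n]] by (auto simp: f_def)
      then show "hausdorff_gauge s (f n m) \<le> ennreal (d n powr s)"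
        using diam hausdorff_gauge_le[OF s] by blast
    qed
    also have "\<dots> = ennreal (card (C n) * d n powr s)" by (simp add: ennreal_mult ennreal_of_nat_eq_real_of_nat)
    also have "\<dots> \<le> ennreal (b n)" using b(1) by (rule ennreal_leI)
    finally show "(\<Sum>m. hausdorff_gauge s (f n m)) \<le> ennreal (b n)" .
  qed auto
  also have "\<dots> = ennreal (suminf b)" by (rule suminf_ennreal2[OF bn b(2)])
  finally show ?thesis .
qed

lemma hausdorff_measure_zeroI:
  assumes "\<And>\<delta> e. 0 < \<delta> \<Longrightarrow> 0 < e \<Longrightarrow> hausdorff_premeasure s \<delta> S \<le> ennreal e"
  shows "hausdorff_measure s S = 0"
proof -
  have "hausdorff_premeasure s \<delta> S \<le> 0" if "0 < \<delta>" for \<delta>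
    by (rule ennreal_le_epsilon) (use assms[OF that] in simp)
  then show ?thesis unfolding hausdorff_measure_def by (auto intro!: antisym SUP_least)
qed

text \<open>Makes the set in \<open>hausdorff_dim\<close> nonempty, so that its \<open>Inf\<close>
  is meaningful. The cube of half-side \<open>R n\<close> is cut into \<open>N n ^ CARD('n)\<close>
  pieces; with an exponent larger by 1 their total is of order \<open>1 / N n\<close>.\<close>

lemma hausdorff_measure_above_dim:
  fixes S :: "(real ^ 'n::finite) set"
  shows "hausdorff_measure (real CARD('n) + 1) S = 0"
proof (rule hausdorff_measure_zeroI)
  fix \<delta> e :: real assume \<delta>: "0 < \<delta>" and e: "0 < e"
  define d where "d = real CARD('n)"
  have d: "d \<ge> 1" by (simp add: d_def)
  define R where "R = (\<lambda>n. real n + 1)"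
  \<comment> \<open>The first summand bounds the diameters by \<open>\<delta>\<close>, the second
    makes the \<open>n\<close>-th cube contribute at most \<open>e / 2 * (1 / 2) ^ n\<close>, and
    the final 1 keeps \<open>N n\<close> positive.\<close>
  define N where "N = (\<lambda>n. nat \<lceil>2 * R n * d / \<delta> + (2 * R n * d) powr (d + 1) / (e / 2 * (1 / 2) ^ n)\<rceil> + 1)"
  have N: "2 * R n * d / N n \<le> \<delta>" "(2 * R n * d) powr (d + 1) / N n \<le> e / 2 * (1 / 2) ^ n" "0 < N n" for n
  proof -
    define u v where "u = 2 * R n * d / \<delta>" and "v = (2 * R n * d) powr (d + 1) / (e / 2 * (1 / 2) ^ n)"
    have uv: "0 \<le> u" "0 \<le> v" using \<delta> e d by (auto simp: u_def v_def R_def)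
    have "real (N n) \<ge> u + v" unfolding N_def u_def[symmetric] v_def[symmetric] using uv by linarith
    then have "u \<le> N n" "v \<le> N n" using uv by auto
    moreover show N0: "0 < N n" by (simp add: N_def)
    ultimately show "2 * R n * d / N n \<le> \<delta>" "(2 * R n * d) powr (d + 1) / N n \<le> e / 2 * (1 / 2) ^ n"
      using \<delta> e by (simp_all add: u_def v_def field_simps)
  qed
  define h where "h = (\<lambda>n. 2 * R n / N n)"
  define box where "box = (\<lambda>n (g :: 'n \<Rightarrow> nat). {x :: real ^ 'n. \<forall>i. - R n + h n * real (g i) \<le> x $ i \<and> x $ i \<le> - R n + h n * (real (g i) + 1)})"
  define C where "C = (\<lambda>n. box n ` (UNIV \<rightarrow>\<^sub>E {..<N n}))"
  have h: "0 < h n" for n using N(3)[of n] by (simp add: h_def R_def)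
  have "hausdorff_premeasure (d + 1) \<delta> S \<le> ennreal (\<Sum>n. e / 2 * (1 / 2) ^ n)"
  proof (rule hausdorff_premeasure_le_families[where C = C and d = "\<lambda>n. d * h n"])
    show "0 < d + 1" using d by simp
    show "finite (C n)" for n unfolding C_def by (intro finite_imageI finite_PiE) auto
    show "d * h n \<le> \<delta>" for n using N(1)[of n] by (simp add: h_def mult_ac)
    show "0 \<le> \<delta>" using \<delta> by simp
    show "bounded U \<and> diameter U \<le> d * h n" if UC: "U \<in> C n" for U n
    proof -
      obtain g where U: "U = box n g" using UC unfolding C_def by blast
      have dist: "dist x y \<le> d * h n" if "x \<in> U" "y \<in> U" for x y
      proof -
        have "\<bar>(x - y) $ i\<bar> \<le> h n" for i
        proof -
          have "- R n + h n * real (g i) \<le> x $ i" "x $ i \<le> - R n + (h n * real (g i) + h n)"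
            "- R n + h n * real (g i) \<le> y $ i" "y $ i \<le> - R n + (h n * real (g i) + h n)"
            using that by (auto simp: U box_def distrib_left)
          then show ?thesis by (simp add: abs_le_iff)
        qed
        then have "(\<Sum>i\<in>UNIV. \<bar>(x - y) $ i\<bar>) \<le> (\<Sum>i\<in>(UNIV :: 'n set). h n)" by (intro sum_mono) auto
        then show ?thesis using norm_le_l1_cart[of "x - y"] by (simp add: dist_norm d_def)
      qed
      have "bounded U" unfolding bounded_def using dist by blast
      moreover have "diameter U \<le> d * h n"
        by (rule diameter_le) (use dist d h[of n] in \<open>auto simp: dist_norm\<close>)
      ultimately show ?thesis ..
    qed
    show "S \<subseteq> (\<Union>n. \<Union> (C n))"
    proof
      fix x :: "real ^ 'n"
      obtain n :: nat where n: "norm x < n" using reals_Archimedean2 by blast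
      have xi: "\<bar>x $ i\<bar> < R n" for i using component_le_norm_cart[of x i] n by (simp add: R_def)
      define g where "g = (\<lambda>i. nat \<lfloor>(x $ i + R n) / h n\<rfloor>)"
      have g: "g i < N n" "h n * real (g i) \<le> x $ i + R n" "x $ i + R n \<le> h n * (real (g i) + 1)" for i
      proof -
        define y where "y = (x $ i + R n) / h n"
        have y: "0 \<le> y" using xi[of i] h[of n] by (simp add: y_def)
        then have gi: "real (g i) = of_int \<lfloor>y\<rfloor>" by (simp add: g_def y_def)
        have "x $ i + R n < N n * h n" using xi[of i] N(3)[of n] by (simp add: h_def)
        then have "y < N n" using h[of n] by (simp add: y_def divide_less_eq)
        then have "real (g i) < N n" using gi of_int_floor_le[of y] by linarith
        then show "g i < N n" by simp
        have "real (g i) \<le> y" "y \<le> g i + 1" using gi by linarith+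
        then show "h n * real (g i) \<le> x $ i + R n" "x $ i + R n \<le> h n * (real (g i) + 1)"
          using h[of n] by (simp_all add: y_def field_simps)
      qed
      have "x \<in> box n g"
        unfolding box_def
      proof (intro CollectI allI)
        fix i
        show "- R n + h n * real (g i) \<le> x $ i \<and> x $ i \<le> - R n + h n * (real (g i) + 1)" using g(2,3)[of i] by linarith
      qed
      moreover have "box n g \<in> C n" unfolding C_def using g(1) by auto
      ultimately show "x \<in> (\<Union>n. \<Union> (C n))" by blast
    qed
    show "card (C n) * (d * h n) powr (d + 1) \<le> e / 2 * (1 / 2) ^ n" for n
    proof -
      have "card (C n) \<le> card ((UNIV :: 'n set) \<rightarrow>\<^sub>E {..<N n})"
        unfolding C_def by (intro card_image_le finite_PiE) auto
      also have "\<dots> = N n ^ CARD('n)" by (simp add: card_PiE)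
      finally have c: "real (card (C n)) \<le> N n powr d"
        unfolding d_def using N(3)[of n] by (subst powr_realpow) (auto simp flip: of_nat_power)
      have "(d * h n) powr (d + 1) = (2 * R n * d) powr (d + 1) / N n powr (d + 1)"
        using d N(3)[of n] by (subst powr_divide[symmetric]) (auto simp: h_def R_def mult_ac)
      also have "\<dots> = (2 * R n * d) powr (d + 1) / (N n powr d * N n)"
        using N(3)[of n] by (simp add: powr_add)
      finally have "card (C n) * (d * h n) powr (d + 1) \<le> N n powr d * ((2 * R n * d) powr (d + 1) / (N n powr d * N n))"
        by (intro mult_mono c) auto
      also have "\<dots> = (2 * R n * d) powr (d + 1) / N n" using N(3)[of n] by simp
      finally show ?thesis using N(2)[of n] by linarith
    qed
    show "summable (\<lambda>n. e / 2 * (1 / 2) ^ n)" by (intro summable_mult summable_geometric) simp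
  qed
  also have "(\<Sum>n. e / 2 * (1 / 2) ^ n) = e"
    by (subst suminf_mult) (simp_all add: suminf_geometric summable_geometric)
  finally show "hausdorff_premeasure (real CARD('n) + 1) \<delta> S \<le> ennreal e" by (simp add: d_def)
qed

lemma hausdorff_dim_nonneg: "0 \<le> hausdorff_dim (S :: (real ^ 'n::finite) set)"
  unfolding hausdorff_dim_def
  by (rule cInf_greatest) (auto intro!: exI[of _ "real CARD('n) + 1"] hausdorff_measure_above_dim)

lemma hausdorff_dim_le: "0 \<le> s \<Longrightarrow> hausdorff_measure s S = 0 \<Longrightarrow> hausdorff_dim S \<le> s"
  unfolding hausdorff_dim_def by (rule cInf_lower) (auto intro: bdd_belowI[of _ 0])


section \<open>The product measure behind a Bernoulli measure\<close>

lemma integral_finite_space: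
  fixes f :: "'b \<Rightarrow> real"
  assumes "finite_measure p" and sets: "sets p = Pow A" and fin: "finite A"
  shows "(\<integral>a. f a \<partial>p) = (\<Sum>a\<in>A. measure p {a} * f a)"
proof -
  interpret p: finite_measure p by (rule assms(1))
  have space: "space p = A" using sets_eq_imp_space_eq[of p "count_space A"] sets by simp
  have "(\<integral>a. f a \<partial>p) = (\<integral>a. (\<Sum>b\<in>A. f b * indicator {b} a) \<partial>p)"
  proof (rule Bochner_Integration.integral_cong[OF refl])
    fix a assume "a \<in> space p"
    then show "f a = (\<Sum>b\<in>A. f b * indicator {b} a)"
      using fin by (simp add: space indicator_def sum.delta if_distrib[of "\<lambda>x. _ * x"] cong: if_cong)
  qed
  also have "\<dots> = (\<Sum>b\<in>A. (\<integral>a. f b * indicator {b} a \<partial>p))"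
    by (rule Bochner_Integration.integral_sum)
      (auto simp: sets p.emeasure_eq_measure intro!: integrable_mult_right integrable_real_indicator)
  also have "\<dots> = (\<Sum>b\<in>A. measure p {b} * f b)"
    by (intro sum.cong refl) (simp add: sets space mult.commute Int_absorb1)
  finally show ?thesis .
qed

locale bernoulli_sponge = weighted_sponge \<Phi> \<theta> q
  for \<Phi> :: "('n::finite, 'a) diag_ifs" and \<theta> :: "'n \<Rightarrow> real" and q :: "('n \<Rightarrow> 'a) \<Rightarrow> real" +
  fixes p :: "('n \<Rightarrow> 'a) measure"
  assumes p: "prob_space p" and sets_p: "sets p = Pow (index_set \<Phi>)"
    and q_eq: "\<And>a. q a = measure p {a}"
begin

interpretation p: prob_space p by (rule p)

lemma space_p: "space p = E"
  using sets_eq_imp_space_eq[of p "count_space E"] sets_p by simp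

lemma measurable_p: "f \<in> E \<rightarrow> space N \<Longrightarrow> f \<in> measurable p N"
  by (rule measurableI) (auto simp: space_p sets_p)

lemma integral_p: "(\<integral>a. (f a :: real) \<partial>p) = (\<Sum>a\<in>E. q a * f a)"
  unfolding q_eq by (rule integral_finite_space[OF _ sets_p finite_E]) unfold_locales

abbreviation "PM \<equiv> \<Pi>\<^sub>M k\<in>(UNIV :: nat set). p"

sublocale PM: prob_space PM by (rule prob_space_PiM) (rule p)

lemma space_PM: "space PM = UNIV \<rightarrow> E"
  by (simp add: space_PiM space_p PiE_UNIV_domain)

lemma indep_coordinates: "PM.indep_vars (\<lambda>_. p) (\<lambda>k \<omega>. \<omega> k) (UNIV :: nat set)"
proof (subst PM.indep_vars_iff_distr_eq_PiM)
  have "distr PM PM (\<lambda>\<omega>. \<lambda>i\<in>UNIV. \<omega> i) = PM" by (simp add: restrict_def)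
  moreover have "(\<Pi>\<^sub>M i\<in>UNIV. distr PM p (\<lambda>\<omega>. \<omega> i)) = PM"
    by (intro PiM_cong refl distr_PiM_component) (auto simp: p)
  ultimately show "distr PM PM (\<lambda>\<omega>. \<lambda>i\<in>UNIV. \<omega> i) = (\<Pi>\<^sub>M i\<in>UNIV. distr PM p (\<lambda>\<omega>. \<omega> i))" by simp
qed auto

text \<open>The functions may vary with \<open>k\<close> because the set \<open>Js n k\<close> of
  coordinates recorded at level \<open>k\<close> does; the summands are independent but not
  identically distributed.\<close>

lemma Hoeffding_coordinates:
  fixes f :: "nat \<Rightarrow> ('n \<Rightarrow> 'a) \<Rightarrow> real"
  assumes B: "\<And>k a. a \<in> E \<Longrightarrow> \<bar>f k a\<bar> \<le> B" "0 < B" and K: "0 < K" and e: "0 \<le> e"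
  shows "PM.prob {\<omega> \<in> space PM. (\<Sum>k<K. \<Sum>a\<in>E. q a * f k a) + e \<le> (\<Sum>k<K. f k (\<omega> k))}
    \<le> exp (- 2 * e\<^sup>2 / (real K * (2 * B)\<^sup>2))"
proof -
  have meas: "f k \<in> borel_measurable p" for k by (rule measurable_p) simp
  have ind: "PM.indep_vars (\<lambda>_. borel) (\<lambda>k \<omega>. f k (\<omega> k)) {..<K}"
    by (rule PM.indep_vars_compose2[OF PM.indep_vars_subset[OF indep_coordinates]]) (use meas in auto)
  have ex: "PM.expectation (\<lambda>\<omega>. f k (\<omega> k)) = (\<Sum>a\<in>E. q a * f k a)" for k
  proof -
    have "distr PM p (\<lambda>\<omega>. \<omega> k) = p" by (rule distr_PiM_component) (auto simp: p)
    then have "(\<integral>a. f k a \<partial>p) = (\<integral>a. f k a \<partial>distr PM p (\<lambda>\<omega>. \<omega> k))" by simp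
    also have "\<dots> = PM.expectation (\<lambda>\<omega>. f k (\<omega> k))" by (rule integral_distr) (use meas in auto)
    finally show ?thesis by (simp add: integral_p)
  qed
  interpret H: Hoeffding_ineq PM "{..<K}" "\<lambda>k \<omega>. f k (\<omega> k)" "\<lambda>_. - B" "\<lambda>_. B" "\<Sum>k<K. \<Sum>a\<in>E. q a * f k a"
  proof unfold_locales
    show "PM.indep_vars (\<lambda>_. borel) (\<lambda>k \<omega>. f k (\<omega> k)) {..<K}" by (rule ind)
    show "AE x in PM. f k (x k) \<in> {- B..B}" for k
    proof (rule AE_I2)
      fix x assume "x \<in> space PM"
      then have "x k \<in> E" by (auto simp: space_PM)
      from B(1)[OF this, of k] show "f k (x k) \<in> {- B..B}" by (simp add: abs_le_iff)
    qed
    show "(\<Sum>k<K. \<Sum>a\<in>E. q a * f k a) \<equiv> (\<Sum>k<K. PM.expectation (\<lambda>\<omega>. f k (\<omega> k)))" by (simp add: ex)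
  qed simp
  show ?thesis using H.Hoeffding_ineq_ge[OF e] B(2) K by simp
qed

text \<open>Each finite composition depends on finitely many letters from a finite set. The
  induction runs over all starting points \<open>x\<close>, since the last letter acts on the point
  first.\<close>

lemma measurable_coding_map: "coding_map \<Phi> \<in> borel_measurable PM"
proof (rule borel_measurable_LIMSEQ_metric)
  show "(\<lambda>\<omega>. ifs_comp \<Phi> \<omega> n x) \<in> borel_measurable PM" for n x
  proof (induction n arbitrary: x)
    case (Suc n)
    have "(\<lambda>\<omega>. ifs_comp \<Phi> \<omega> n (ifs_map \<Phi> (\<omega> n) x)) \<in> borel_measurable PM"
    proof (rule measurable_compose_countable'[where I = E and g = "\<lambda>\<omega>. \<omega> n" and f = "\<lambda>a \<omega>. ifs_comp \<Phi> \<omega> n (ifs_map \<Phi> a x)"])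
      show "(\<lambda>\<omega>. \<omega> n) \<in> measurable PM (count_space E)"
        by (rule measurable_compose[OF measurable_component_singleton[of n UNIV]]) (auto intro!: measurable_p)
      show "countable E" using finite_E by (rule countable_finite)
    qed (rule Suc.IH)
    then show ?case by simp
  qed simp
  show "(\<lambda>n. ifs_comp \<Phi> \<omega> n 0) \<longlonglongrightarrow> coding_map \<Phi> \<omega>" if "\<omega> \<in> space PM" for \<omega>
    by (rule tendsto_coding_map(1)[OF ifs]) (use that in \<open>auto simp: space_PM\<close>)
qed

end

section \<open>Covering typical points by approximate cubes\<close>

context bernoulli_sponge
begin

definition incr :: "'n \<Rightarrow> real" where
  "incr i = entropy_on E q (lower i) - entropy_on E q (below i)"

text \<open>The chain rule along the order of exponents: a nonempty downward closed set is
  \<open>lower i\<close> for its largest element, whose removal leaves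
  \<open>below i\<close>.\<close>

lemma entropy_telescope:
  "(\<And>i j. i \<in> J \<Longrightarrow> \<theta> j \<le> \<theta> i \<Longrightarrow> j \<in> J) \<Longrightarrow> entropy_on E q J = (\<Sum>i\<in>J. incr i)"
proof (induction "card J" arbitrary: J)
  case 0
  then have "J = {}" by simp
  then show ?case by (simp add: entropy_on_def marginal_def q_sum restrict_def)
next
  case (Suc n)
  then have "J \<noteq> {}" by auto
  then obtain i where i: "i \<in> J" "\<And>j. j \<in> J \<Longrightarrow> \<theta> j \<le> \<theta> i"
    using finite_obtain_min[of J "\<lambda>j. - \<theta> j"] by auto
  have J: "J = lower i" using Suc.prems i by blast
  have Ji: "J - {i} = below i"
    using inj_theta unfolding J by (auto simp: less_le inj_def)
  have "entropy_on E q (J - {i}) = (\<Sum>j\<in>J - {i}. incr j)"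
  proof (rule Suc.hyps(1))
    show "n = card (J - {i})" using Suc.hyps(2) i(1) by simp
    show "\<And>k j. k \<in> J - {i} \<Longrightarrow> \<theta> j \<le> \<theta> k \<Longrightarrow> j \<in> J - {i}" unfolding Ji by auto
  qed
  then have "entropy_on E q J = incr i + (\<Sum>j\<in>J - {i}. incr j)"
    unfolding Ji by (simp add: incr_def J)
  then show ?case using i(1) by (simp add: sum.remove[of J i])
qed

text \<open>After this many letters the expected logarithmic contraction in coordinate
  \<open>i\<close> reaches \<open>n\<close>. Unlike the true number of letters for a given side
  length it does not depend on the point, so codes live in a product set; \<open>Good\<close>
  absorbs the fluctuation in \<open>e * n\<close>.\<close>

definition L :: "nat \<Rightarrow> 'n \<Rightarrow> nat" where
  "L n i = nat \<lceil>n / \<theta> i\<rceil>"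

definition Js :: "nat \<Rightarrow> nat \<Rightarrow> 'n set" where
  "Js n k = {i. k < L n i}"

text \<open>A common bound of the levels, linear in \<open>n\<close>. Above the largest
  \<open>L n i\<close> the set \<open>Js n k\<close> is empty and contributes no entropy.\<close>

definition K :: "nat \<Rightarrow> nat" where
  "K n = (\<Sum>i\<in>UNIV. L n i)"

lemma L_bounds: "n / \<theta> i \<le> L n i" "L n i \<le> n / \<theta> i + 1"
proof -
  have "0 \<le> n / \<theta> i" using theta_pos[of i] by simp
  then have "real (L n i) = of_int \<lceil>n / \<theta> i\<rceil>" by (simp add: L_def)
  then show "n / \<theta> i \<le> L n i" "L n i \<le> n / \<theta> i + 1" by linarith+
qed

lemma L_theta: "n \<le> L n i * \<theta> i"
  using L_bounds(1)[of n i] theta_pos[of i] by (simp add: divide_le_eq)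

lemma L_pos: "0 < n \<Longrightarrow> 0 < L n i"
  using L_theta[of n i] by (cases "L n i") auto

lemma L_le_K: "L n i \<le> K n"
  unfolding K_def by (rule member_le_sum) auto

lemma K_pos: "0 < n \<Longrightarrow> 0 < K n"
  using L_pos L_le_K by (metis less_le_trans)

lemma K_le: "0 < n \<Longrightarrow> K n \<le> (\<Sum>i\<in>UNIV. 1 / \<theta> i + 1) * n"
proof -
  assume n: "0 < n"
  have "real (K n) \<le> (\<Sum>i\<in>UNIV. n / \<theta> i + 1)" unfolding K_def of_nat_sum by (rule sum_mono) (rule L_bounds(2))
  also have "\<dots> \<le> (\<Sum>i\<in>UNIV. (1 / \<theta> i + 1) * n)" using n by (intro sum_mono) (simp add: algebra_simps)
  finally show ?thesis by (simp add: sum_distrib_right)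
qed

lemma Js_down: "i \<in> Js n k \<Longrightarrow> \<theta> j \<le> \<theta> i \<Longrightarrow> j \<in> Js n k"
proof -
  assume i: "i \<in> Js n k" and ji: "\<theta> j \<le> \<theta> i"
  have "n / \<theta> i \<le> n / \<theta> j" using theta_pos[of j] ji by (intro divide_left_mono) (auto intro: mult_pos_pos theta_pos)
  then have "L n i \<le> L n j" unfolding L_def by (intro nat_mono ceiling_mono)
  then show "j \<in> Js n k" using i by (simp add: Js_def)
qed

text \<open>Exchange of summation: coordinate \<open>i\<close> is recorded at \<open>L n i\<close>
  levels and gains \<open>incr i\<close> at each. Rounding up costs at most one further
  \<open>incr i\<close>.\<close>

lemma sum_entropy_le: "(\<Sum>k<K n. entropy_on E q (Js n k)) \<le> n * delta + (\<Sum>i\<in>UNIV. incr i)"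
proof -
  have "(\<Sum>k<K n. entropy_on E q (Js n k)) = (\<Sum>k<K n. \<Sum>i\<in>Js n k. incr i)"
    by (intro sum.cong refl entropy_telescope) (rule Js_down)
  also have "\<dots> = (\<Sum>k<K n. \<Sum>i\<in>UNIV. if k < L n i then incr i else 0)"
    by (simp add: Js_def sum.If_cases)
  also have "\<dots> = (\<Sum>i\<in>UNIV. \<Sum>k<K n. if k < L n i then incr i else 0)" by (rule sum.swap)
  also have "\<dots> = (\<Sum>i\<in>UNIV. L n i * incr i)"
  proof (intro sum.cong refl)
    fix i
    have "{..<K n} \<inter> {k. k < L n i} = {..<L n i}" using L_le_K[of n i] by auto
    then show "(\<Sum>k<K n. if k < L n i then incr i else 0) = L n i * incr i" by (simp add: sum.If_cases)
  qed
  also have "\<dots> \<le> (\<Sum>i\<in>UNIV. (n / \<theta> i + 1) * incr i)"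
    using L_bounds(2) entropy_increment_nonneg by (intro sum_mono mult_right_mono) (auto simp: incr_def)
  also have "\<dots> = n * delta + (\<Sum>i\<in>UNIV. incr i)"
    by (simp add: delta_def incr_def[symmetric] sum.distrib sum_distrib_left algebra_simps)
  finally show ?thesis .
qed

text \<open>The estimates are one-sided: sides of the cube not too long, its code not too
  improbable. Positivity of \<open>q (\<omega> k)\<close> keeps all marginals positive, so that
  \<open>exp\<close> undoes \<open>ln\<close>.\<close>

definition Good :: "nat \<Rightarrow> real \<Rightarrow> (nat \<Rightarrow> 'n \<Rightarrow> 'a) set" where
  "Good n e = {\<omega> \<in> UNIV \<rightarrow> E. (\<forall>k. 0 < q (\<omega> k)) \<and>
     (\<forall>i. (\<Sum>k<L n i. ln (ifs_ratio \<Phi> (\<omega> k) i)) < - L n i * \<theta> i + e * n) \<and>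
     (\<Sum>k<K n. - ln (marginal E q (Js n k) (\<omega> k))) < (\<Sum>k<K n. entropy_on E q (Js n k)) + e * n}"

definition box :: "nat \<Rightarrow> (nat \<Rightarrow> 'n \<Rightarrow> 'a) \<Rightarrow> (real ^ 'n) set" where
  "box n \<omega> = {x. \<forall>i. x $ i \<in> scomp (coord \<Phi> \<omega> i) (L n i) ` {0..1}}"

text \<open>
  An approximate cube of side about \<open>exp (- n)\<close>: coordinate \<open>i\<close> is recorded for the first \<open>L n i\<close>
  letters only.
\<close>

definition code :: "nat \<Rightarrow> (nat \<Rightarrow> 'n \<Rightarrow> 'a) \<Rightarrow> nat \<Rightarrow> 'n \<Rightarrow> 'a" where
  "code n \<omega> = (\<lambda>k\<in>{..<K n}. restrict (\<omega> k) (Js n k))"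

text \<open>The detour through \<open>code\<close> gives finiteness and a count, as the elements of
  \<open>Good n e\<close> are infinite sequences; by \<open>box_code\<close> the box is
  unaffected.\<close>

definition Cov :: "nat \<Rightarrow> real \<Rightarrow> (real ^ 'n) set set" where
  "Cov n e = box n ` code n ` Good n e"

lemma box_code: "box n (code n \<omega>) = box n \<omega>"
proof -
  have "scomp (\<lambda>k. base_map \<Phi> i (code n \<omega> k i)) (L n i) = scomp (coord \<Phi> \<omega> i) (L n i)" for i
  proof (rule scomp_cong)
    fix k assume "k < L n i"
    then show "base_map \<Phi> i (code n \<omega> k i) = base_map \<Phi> i (\<omega> k i)"
      using L_le_K[of n i] by (simp add: code_def Js_def)
  qed
  then show ?thesis by (simp add: box_def)
qed

lemma CovE: "U \<in> Cov n e \<Longrightarrow> \<exists>\<omega>\<in>Good n e. U = box n \<omega>"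
  by (auto simp: Cov_def box_code)

lemma code_subset: "code n ` Good n e \<subseteq> (\<Pi>\<^sub>E k\<in>{..<K n}. (\<lambda>a. restrict a (Js n k)) ` E)"
  by (auto simp: code_def Good_def Pi_def intro!: imageI)

lemma finite_codes: "finite (\<Pi>\<^sub>E k\<in>{..<K n}. (\<lambda>a. restrict a (Js n k)) ` E)"
  using finite_E by (intro finite_PiE) auto

lemma finite_Cov: "finite (Cov n e)"
  unfolding Cov_def using finite_subset[OF code_subset finite_codes] by blast

lemma card_Cov: "card (Cov n e) \<le> exp ((\<Sum>k<K n. entropy_on E q (Js n k)) + e * n)"
proof -
  define T where "T = (\<Sum>k<K n. entropy_on E q (Js n k)) + e * n"
  define Q where "Q = (\<lambda>k b. \<Sum>a | a \<in> E \<and> restrict a (Js n k) = b. q a)"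
  define P where "P = (\<Pi>\<^sub>E k\<in>{..<K n}. (\<lambda>a. restrict a (Js n k)) ` E)"
  define G where "G = code n ` Good n e"
  have Q0: "0 \<le> Q k b" for k b unfolding Q_def by (intro sum_nonneg) (use q_nonneg in auto)
  \<comment> \<open>The product is the probability of the code; the last condition in
    \<open>Good\<close> bounds it from below.\<close>
  have ge: "exp (- T) \<le> (\<Prod>k<K n. Q k (g k))" if g: "g \<in> G" for g
  proof -
    obtain \<omega> where \<omega>: "\<omega> \<in> Good n e" "g = code n \<omega>" using g by (auto simp: G_def)
    have m: "Q k (g k) = marginal E q (Js n k) (\<omega> k)" if "k < K n" for k
      using that by (simp add: \<omega>(2) code_def Q_def marginal_def)
    have pos: "0 < marginal E q (Js n k) (\<omega> k)" for k
    proof -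
      have "q (\<omega> k) \<le> marginal E q (Js n k) (\<omega> k)"
        unfolding marginal_def using \<omega>(1) finite_E q_nonneg by (intro member_le_sum) (auto simp: Good_def)
      moreover have "0 < q (\<omega> k)" using \<omega>(1) by (simp add: Good_def)
      ultimately show ?thesis by linarith
    qed
    have "- T \<le> (\<Sum>k<K n. ln (marginal E q (Js n k) (\<omega> k)))"
      using \<omega>(1) by (simp add: Good_def T_def sum_negf)
    then have "exp (- T) \<le> exp (\<Sum>k<K n. ln (marginal E q (Js n k) (\<omega> k)))" by simp
    also have "\<dots> = (\<Prod>k<K n. marginal E q (Js n k) (\<omega> k))" using pos by (simp add: exp_sum)
    also have "\<dots> = (\<Prod>k<K n. Q k (g k))" using m by simp
    finally show ?thesis .
  qed
  have GP: "G \<subseteq> P" unfolding G_def P_def by (rule code_subset)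
  have finP: "finite P" unfolding P_def by (rule finite_codes)
  have "card G * exp (- T) = (\<Sum>g\<in>G. exp (- T))" by simp
  also have "\<dots> \<le> (\<Sum>g\<in>G. \<Prod>k<K n. Q k (g k))" using ge by (rule sum_mono)
  also have "\<dots> \<le> (\<Sum>g\<in>P. \<Prod>k<K n. Q k (g k))"
    using finP GP Q0 by (intro sum_mono2 prod_nonneg) auto
  \<comment> \<open>The probabilities of all codes factor over the levels, and at each level they
    sum to 1.\<close>
  also have "\<dots> = (\<Prod>k<K n. \<Sum>b\<in>(\<lambda>a. restrict a (Js n k)) ` E. Q k b)"
    unfolding P_def using finite_E by (intro prod_sum_PiE[symmetric]) auto
  also have "\<dots> = (\<Prod>k<K n. 1)"
    unfolding Q_def using sum.image_gen[OF finite_E, of q "\<lambda>a. restrict a (Js n k)" for k] q_sum by simp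
  finally have "card G * exp (- T) \<le> 1" by simp
  then have "card G \<le> exp T" by (simp add: exp_minus field_simps)
  moreover have "card (Cov n e) \<le> card G"
    unfolding Cov_def G_def[symmetric] using finite_subset[OF GP finP] by (rule card_image_le)
  ultimately show ?thesis unfolding T_def by linarith
qed

lemma diam_box:
  assumes \<omega>: "\<omega> \<in> Good n e" and x: "x \<in> box n \<omega>" and y: "y \<in> box n \<omega>"
  shows "dist x y \<le> CARD('n) * exp (- (1 - e) * n)"
proof -
  have \<omega>E: "\<omega> k \<in> E" for k using \<omega> by (auto simp: Good_def)
  have "\<bar>(x - y) $ i\<bar> \<le> exp (- (1 - e) * n)" for i
  proof -
    interpret similarity_seq "coord \<Phi> \<omega> i" "ratio_bound \<Phi>"
      by (rule similarity_seq_coordinate[OF ifs \<omega>E])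
    obtain u v where u: "u \<in> {0..1}" "x $ i = scomp (coord \<Phi> \<omega> i) (L n i) u"
      and v: "v \<in> {0..1}" "y $ i = scomp (coord \<Phi> \<omega> i) (L n i) v"
      using x y unfolding box_def by blast
    have pos: "0 < ifs_ratio \<Phi> (\<omega> k) i" for k using ifs_ratio_bounds(1)[OF ifs \<omega>E] .
    have "\<bar>(x - y) $ i\<bar> = (\<Prod>k<L n i. ifs_ratio \<Phi> (\<omega> k) i) * \<bar>u - v\<bar>"
      using scomp_dist[OF u(1) v(1)] by (simp add: u(2) v(2) ifs_ratio_def)
    also have "\<dots> \<le> (\<Prod>k<L n i. ifs_ratio \<Phi> (\<omega> k) i) * 1"
      using u(1) v(1) pos by (intro mult_left_mono prod_nonneg) (auto intro: less_imp_le)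
    also have "\<dots> = exp (\<Sum>k<L n i. ln (ifs_ratio \<Phi> (\<omega> k) i))" using pos by (simp add: exp_sum)
    also have "\<dots> \<le> exp (- L n i * \<theta> i + e * n)" using \<omega> by (simp add: Good_def less_imp_le)
    \<comment> \<open>\<open>L n i * \<theta> i\<close> is at least \<open>n\<close> because
      \<open>L\<close> rounds up.\<close>
    also have "\<dots> \<le> exp (- (1 - e) * n)" using L_theta[of n i] by (simp add: algebra_simps)
    finally show ?thesis .
  qed
  then have "(\<Sum>i\<in>UNIV. \<bar>(x - y) $ i\<bar>) \<le> (\<Sum>i\<in>(UNIV :: 'n set). exp (- (1 - e) * n))" by (intro sum_mono) auto
  then show ?thesis using norm_le_l1_cart[of "x - y"] by (simp add: dist_norm)
qed

lemma coding_in_box: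
  assumes "\<And>k. \<omega> k \<in> E" shows "coding_map \<Phi> \<omega> \<in> box n \<omega>"
  unfolding box_def
proof (intro CollectI allI)
  fix i
  have "coding_map \<Phi> (\<lambda>k. \<omega> (L n i + k)) $ i \<in> {0..1}" using coding_map_mem[OF ifs] assms by simp
  then show "coding_map \<Phi> \<omega> $ i \<in> scomp (coord \<Phi> \<omega> i) (L n i) ` {0..1}"
    using coding_map_shift_nth[where \<omega> = \<omega> and i = i and n = "L n i", OF ifs assms] by blast
qed

lemma closed_box:
  assumes "\<And>k. \<omega> k \<in> E" shows "closed (box n \<omega>)"
proof -
  have "closed ((\<lambda>x. x $ i) -` (scomp (coord \<Phi> \<omega> i) (L n i) ` {0..1}) :: (real ^ 'n) set)" for i
  proof -
    interpret similarity_seq "coord \<Phi> \<omega> i" "ratio_bound \<Phi>"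
      by (rule similarity_seq_coordinate[OF ifs assms])
    have "compact (scomp (coord \<Phi> \<omega> i) (L n i) ` {0..1})"
      by (intro compact_continuous_image scomp_continuous) simp
    then show ?thesis by (intro closed_vimage compact_imp_closed) (auto intro: continuous_intros)
  qed
  then have "closed (\<Inter>i. (\<lambda>x. x $ i) -` (scomp (coord \<Phi> \<omega> i) (L n i) ` {0..1}) :: (real ^ 'n) set)"
    by (intro closed_INT) auto
  moreover have "(\<Inter>i. (\<lambda>x. x $ i) -` (scomp (coord \<Phi> \<omega> i) (L n i) ` {0..1})) = box n \<omega>"
    by (auto simp: box_def)
  ultimately show ?thesis by simp
qed

text \<open>\<open>hausdorff_dim_measure\<close> admits measurable sets of full measure; closedness
  makes the limsup set of the coverings Borel.\<close>

lemma closed_Union_Cov: "closed (\<Union>(Cov n e))"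
proof (rule closed_Union[OF finite_Cov], rule ballI)
  fix U assume "U \<in> Cov n e"
  then obtain \<omega> where "\<omega> \<in> Good n e" "U = box n \<omega>" using CovE by blast
  then show "closed U" using closed_box[of \<omega> n] by (auto simp: Good_def)
qed

lemma measurable_coord_sum:
  fixes f :: "nat \<Rightarrow> ('n \<Rightarrow> 'a) \<Rightarrow> real"
  shows "(\<lambda>\<omega>. \<Sum>k<m. f k (\<omega> k)) \<in> borel_measurable PM"
proof (rule borel_measurable_sum)
  fix k
  show "(\<lambda>\<omega>. f k (\<omega> k)) \<in> borel_measurable PM"
    by (rule measurable_compose[OF measurable_component_singleton[of k UNIV]]) (auto intro!: measurable_p)
qed

text \<open>A deviation \<open>e * n\<close> against at most \<open>K n\<close> summands, a number
  linear in \<open>n\<close>, has exponentially small probability by Hoeffding's inequality;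
  Borel--Cantelli then applies.\<close>

lemma AE_eventually_Good:
  assumes e: "0 < e"
  shows "AE \<omega> in PM. \<forall>\<^sub>F n in sequentially. \<omega> \<in> Good n e"
proof -
  \<comment> \<open>One bound for the finitely many logarithms that occur; the 1 makes it positive.
    A marginal may be 0 here, and the value of \<open>ln\<close> at 0 is then covered too.\<close>
  define B where "B = 1 + (\<Sum>a\<in>E. \<Sum>i\<in>UNIV. \<bar>ln (ifs_ratio \<Phi> a i)\<bar>) + (\<Sum>a\<in>E. \<Sum>J\<in>UNIV. \<bar>ln (marginal E q J a)\<bar>)"
  have B1: "\<bar>ln (ifs_ratio \<Phi> a i)\<bar> \<le> B" if "a \<in> E" for a i
  proof -
    have "\<bar>ln (ifs_ratio \<Phi> a i)\<bar> \<le> (\<Sum>i\<in>UNIV. \<bar>ln (ifs_ratio \<Phi> a i)\<bar>)" by (rule member_le_sum) auto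
    also have "\<dots> \<le> (\<Sum>a\<in>E. \<Sum>i\<in>UNIV. \<bar>ln (ifs_ratio \<Phi> a i)\<bar>)"
      using that finite_E by (intro member_le_sum[of a E "\<lambda>a. \<Sum>i\<in>UNIV. \<bar>ln (ifs_ratio \<Phi> a i)\<bar>"] sum_nonneg) auto
    also have "\<dots> \<le> B" unfolding B_def by (simp add: sum_nonneg)
    finally show ?thesis .
  qed
  have B2: "\<bar>- ln (marginal E q J a)\<bar> \<le> B" if "a \<in> E" for a J
  proof -
    have "\<bar>- ln (marginal E q J a)\<bar> \<le> (\<Sum>J\<in>UNIV. \<bar>ln (marginal E q J a)\<bar>)"
      using member_le_sum[of J UNIV "\<lambda>J. \<bar>ln (marginal E q J a)\<bar>"] by simp
    also have "\<dots> \<le> (\<Sum>a\<in>E. \<Sum>J\<in>UNIV. \<bar>ln (marginal E q J a)\<bar>)"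
      using that finite_E by (intro member_le_sum[of a E "\<lambda>a. \<Sum>J\<in>UNIV. \<bar>ln (marginal E q J a)\<bar>"] sum_nonneg) auto
    also have "\<dots> \<le> B" unfolding B_def by (simp add: sum_nonneg)
    finally show ?thesis .
  qed
  have B0: "0 < B" unfolding B_def by (intro add_pos_nonneg sum_nonneg) auto
  define c where "c = (\<Sum>i\<in>UNIV. 1 / \<theta> i + 1)"
  have c: "0 < c" unfolding c_def using theta_pos by (intro sum_pos add_pos_pos divide_pos_pos) auto
  \<comment> \<open>Hoeffding's exponent
    \<open>2 * (e * n)\<^sup>2 / (c * n * (2 * B)\<^sup>2)\<close>, divided by
    \<open>n\<close>.\<close>
  define \<gamma> where "\<gamma> = e\<^sup>2 / (2 * c * B\<^sup>2)"
  have \<gamma>: "0 < \<gamma>" using e c B0 by (simp add: \<gamma>_def)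
  have hb: "exp (- 2 * (e * n)\<^sup>2 / (real k * (2 * B)\<^sup>2)) \<le> exp (- \<gamma>) ^ n" if n: "0 < n" and k: "0 < k" "k \<le> K n" for n k
  proof -
    have "real k \<le> c * n" using K_le[OF n] k(2) unfolding c_def by linarith
    then have "2 * (e * n)\<^sup>2 / ((c * n) * (2 * B)\<^sup>2) \<le> 2 * (e * n)\<^sup>2 / (real k * (2 * B)\<^sup>2)"
      using k(1) B0 n c by (intro divide_left_mono mult_right_mono mult_pos_pos) auto
    moreover have "2 * (e * n)\<^sup>2 / ((c * n) * (2 * B)\<^sup>2) = \<gamma> * n"
      using n c B0 by (simp add: \<gamma>_def power2_eq_square field_simps)
    ultimately have "- 2 * (e * n)\<^sup>2 / (real k * (2 * B)\<^sup>2) \<le> n * (- \<gamma>)" by (simp add: mult.commute)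
    then show ?thesis unfolding exp_of_nat_mult[symmetric] by simp
  qed
  define Bad1 where "Bad1 = (\<lambda>n i. {\<omega> \<in> space PM. (\<Sum>k<L n i. \<Sum>a\<in>E. q a * ln (ifs_ratio \<Phi> a i)) + e * n \<le> (\<Sum>k<L n i. ln (ifs_ratio \<Phi> (\<omega> k) i))})"
  define Bad2 where "Bad2 = (\<lambda>n. {\<omega> \<in> space PM. (\<Sum>k<K n. \<Sum>a\<in>E. q a * - ln (marginal E q (Js n k) a)) + e * n \<le> (\<Sum>k<K n. - ln (marginal E q (Js n k) (\<omega> k)))})"
  have sets1: "Bad1 n i \<in> sets PM" for n i
    unfolding Bad1_def using measurable_coord_sum[of "\<lambda>k a. ln (ifs_ratio \<Phi> a i)" "L n i"] by measurable
  have sets2: "Bad2 n \<in> sets PM" for n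
    unfolding Bad2_def using measurable_coord_sum[of "\<lambda>k a. - ln (marginal E q (Js n k) a)" "K n"] by measurable
  have p1: "PM.prob (Bad1 n i) \<le> exp (- \<gamma>) ^ n" if "0 < n" for n i
    unfolding Bad1_def
    by (rule order_trans[OF Hoeffding_coordinates[OF _ B0] hb]) (use B1 that e L_pos L_le_K in auto)
  have p2: "PM.prob (Bad2 n) \<le> exp (- \<gamma>) ^ n" if "0 < n" for n
    unfolding Bad2_def
    by (rule order_trans[OF Hoeffding_coordinates[OF _ B0] hb]) (use B2 that e K_pos in auto)
  define Bad where "Bad = (\<lambda>n. (\<Union>i. Bad1 n i) \<union> Bad2 n)"
  have setsB: "Bad n \<in> sets PM" for n unfolding Bad_def using sets1 sets2 by auto
  have pB: "PM.prob (Bad n) \<le> (CARD('n) + 1) * exp (- \<gamma>) ^ n" if "0 < n" for n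
  proof -
    have "PM.prob (Bad n) \<le> PM.prob (\<Union>i. Bad1 n i) + PM.prob (Bad2 n)"
      unfolding Bad_def by (rule measure_Un_le) (use sets1 sets2 in auto)
    also have "PM.prob (\<Union>i. Bad1 n i) \<le> (\<Sum>i\<in>UNIV. PM.prob (Bad1 n i))"
      by (rule PM.finite_measure_subadditive_finite) (use sets1 in auto)
    also have "\<dots> \<le> (\<Sum>i\<in>(UNIV :: 'n set). exp (- \<gamma>) ^ n)" by (rule sum_mono) (rule p1[OF that])
    finally show ?thesis using p2[OF that] by (simp add: algebra_simps)
  qed
  have "AE \<omega> in PM. \<forall>\<^sub>F n in sequentially. \<omega> \<in> space PM - Bad n"
  proof (rule borel_cantelli_AE1)
    show "summable (\<lambda>n. PM.prob (Bad n))"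
    proof (rule summable_comparison_test')
      show "summable (\<lambda>n. (CARD('n) + 1) * exp (- \<gamma>) ^ n)"
        using \<gamma> by (intro summable_mult summable_geometric) simp
      show "\<And>n. n \<ge> 1 \<Longrightarrow> norm (PM.prob (Bad n)) \<le> (CARD('n) + 1) * exp (- \<gamma>) ^ n" using pB by simp
    qed
  qed (use setsB in \<open>auto simp: PM.emeasure_eq_measure\<close>)
  \<comment> \<open>Letters of measure zero almost surely never occur, as there are countably many
    positions.\<close>
  moreover have "AE \<omega> in PM. \<forall>k. 0 < q (\<omega> k)"
  proof (subst AE_all_countable, rule allI)
    fix k :: nat
    have "AE a in p. 0 < q a"
    proof (rule AE_I)
      define Z where "Z = {a \<in> E. q a = 0}"
      show "{a \<in> space p. \<not> 0 < q a} \<subseteq> Z" using q_nonneg by (force simp: Z_def space_p)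
      have "finite Z" using finite_E by (simp add: Z_def)
      have "emeasure p Z = (\<Sum>a\<in>Z. emeasure p {a})"
        by (rule emeasure_eq_sum_singleton) (use \<open>finite Z\<close> in \<open>auto simp: sets_p Z_def\<close>)
      also have "\<dots> = 0"
        by (rule sum.neutral) (auto simp: Z_def q_eq finite_measure.emeasure_eq_measure[OF prob_space.finite_measure[OF p]])
      finally show "emeasure p Z = 0" .
      show "Z \<in> sets p" by (auto simp: sets_p Z_def)
    qed
    then show "AE \<omega> in PM. 0 < q (\<omega> k)" by (rule AE_PiM_component[rotated 2]) (auto simp: p)
  qed
  ultimately show ?thesis
  proof eventually_elim
    case (elim \<omega>)
    from elim(1) show ?case
    proof eventually_elim
      case (elim n)
      have th: "(\<Sum>k<L n i. \<Sum>a\<in>E. q a * ln (ifs_ratio \<Phi> a i)) = - L n i * \<theta> i" for i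
        by (simp add: theta_eq)
      have en: "(\<Sum>k<K n. \<Sum>a\<in>E. q a * - ln (marginal E q (Js n k) a)) = (\<Sum>k<K n. entropy_on E q (Js n k))"
        by (simp add: entropy_on_def sum_negf)
      have "\<omega> \<in> space PM" "\<And>i. \<omega> \<notin> Bad1 n i" "\<omega> \<notin> Bad2 n" using elim by (auto simp: Bad_def)
      then show ?case
        using \<open>\<forall>k. 0 < q (\<omega> k)\<close> unfolding Good_def Bad1_def Bad2_def th en by (auto simp: space_PM not_le)
    qed
  qed
qed

lemma delta_nonneg: "0 \<le> delta"
  unfolding delta_def using entropy_increment_nonneg theta_pos
  by (intro sum_nonneg divide_nonneg_nonneg) (auto intro: less_imp_le)

text \<open>Up to constants, stage \<open>n\<close> has at most \<open>exp (n * (delta + e))\<close>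
  boxes of diameter at most \<open>exp (- (1 - e) * n)\<close>, so their \<open>s\<close>-sum is of
  order \<open>x ^ n\<close>. The stages from \<open>m\<close> on cover the limsup set, and a
  geometric tail is small.\<close>

lemma hausdorff_measure_limsup_Cov:
  assumes s: "delta < s" and e: "0 < e" "e < 1" "delta + e < s * (1 - e)"
  shows "hausdorff_measure s (\<Inter>m. \<Union>n\<in>{m..}. \<Union>(Cov n e)) = 0"
proof (rule hausdorff_measure_zeroI)
  fix \<delta> \<epsilon> :: real assume \<delta>: "0 < \<delta>" and \<epsilon>: "0 < \<epsilon>"
  have s0: "0 < s" using s delta_nonneg by simp
  define d where "d = real CARD('n)"
  have d: "1 \<le> d" by (simp add: d_def)
  define x where "x = exp (- (s * (1 - e) - (delta + e)))"
  define y where "y = exp (- (1 - e))"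
  have x: "0 < x" "x < 1" using e(3) by (auto simp: x_def)
  have y: "0 < y" "y < 1" using e(2) by (auto simp: y_def)
  define A where "A = exp (\<Sum>i\<in>UNIV. incr i) * d powr s"
  have "(\<lambda>m. A * x ^ m / (1 - x)) \<longlonglongrightarrow> A * 0 / (1 - x)"
    using x by (intro tendsto_intros LIMSEQ_realpow_zero) auto
  then have "\<forall>\<^sub>F m in sequentially. A * x ^ m / (1 - x) < \<epsilon>" by (rule order_tendstoD) (use \<epsilon> in simp)
  moreover have "(\<lambda>m. d * y ^ m) \<longlonglongrightarrow> d * 0"
    using y by (intro tendsto_intros LIMSEQ_realpow_zero) auto
  then have "\<forall>\<^sub>F m in sequentially. d * y ^ m < \<delta>" by (rule order_tendstoD) (use \<delta> in simp)
  ultimately have "\<forall>\<^sub>F m in sequentially. A * x ^ m / (1 - x) < \<epsilon> \<and> d * y ^ m < \<delta>" by eventually_elim simp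
  then obtain m where m: "A * x ^ m / (1 - x) < \<epsilon>" "d * y ^ m < \<delta>"
    using eventually_happens' sequentially_bot by blast
  have exp_y: "exp (- (1 - e) * real n) = y ^ n" for n
    by (simp add: y_def exp_of_nat_mult[symmetric] mult.commute)
  have "hausdorff_premeasure s \<delta> (\<Inter>m. \<Union>n\<in>{m..}. \<Union>(Cov n e)) \<le> ennreal (\<Sum>j. A * x ^ m * x ^ j)"
  proof (rule hausdorff_premeasure_le_families[where C = "\<lambda>j. Cov (m + j) e" and d = "\<lambda>j. d * y ^ (m + j)"])
    show "0 < s" by (rule s0)
    show "finite (Cov (m + j) e)" for j by (rule finite_Cov)
    show "d * y ^ (m + j) \<le> \<delta>" for j
    proof -
      have "d * y ^ (m + j) \<le> d * y ^ m" using y d by (intro mult_left_mono power_decreasing) auto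
      then show ?thesis using m(2) by simp
    qed
    show "0 \<le> \<delta>" using \<delta> by simp
    show "bounded U \<and> diameter U \<le> d * y ^ (m + j)" if UC: "U \<in> Cov (m + j) e" for U j
    proof -
      obtain \<omega> where \<omega>: "\<omega> \<in> Good (m + j) e" "U = box (m + j) \<omega>" using CovE[OF UC] by blast
      have dist: "dist u v \<le> d * y ^ (m + j)" if "u \<in> U" "v \<in> U" for u v
        using diam_box[OF \<omega>(1)] that unfolding \<omega>(2) exp_y d_def by blast
      then have "bounded U" unfolding bounded_def by blast
      moreover have "diameter U \<le> d * y ^ (m + j)"
        by (rule diameter_le) (use dist y d in \<open>auto simp: dist_norm\<close>)
      ultimately show ?thesis ..
    qed
    show "(\<Inter>m. \<Union>n\<in>{m..}. \<Union>(Cov n e)) \<subseteq> (\<Union>j. \<Union>(Cov (m + j) e))"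
    proof
      fix u assume "u \<in> (\<Inter>m. \<Union>n\<in>{m..}. \<Union>(Cov n e))"
      then obtain n where "m \<le> n" "u \<in> \<Union>(Cov n e)" by blast
      then have "u \<in> \<Union>(Cov (m + (n - m)) e)" by simp
      then show "u \<in> (\<Union>j. \<Union>(Cov (m + j) e))" by blast
    qed
    show "card (Cov (m + j) e) * (d * y ^ (m + j)) powr s \<le> A * x ^ m * x ^ j" for j
    proof -
      define n where "n = m + j"
      have "card (Cov n e) \<le> exp (n * delta + (\<Sum>i\<in>UNIV. incr i) + e * n)"
        by (rule order_trans[OF card_Cov]) (use sum_entropy_le[of n] in simp)
      moreover have pw: "(d * y ^ n) powr s = d powr s * exp (- (s * (1 - e)) * n)"
        using d y unfolding exp_y[symmetric] by (simp add: powr_mult powr_def[of "exp _"] algebra_simps)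
      ultimately have "card (Cov n e) * (d * y ^ n) powr s \<le>
          exp (n * delta + (\<Sum>i\<in>UNIV. incr i) + e * n) * (d powr s * exp (- (s * (1 - e)) * n))"
        by (simp only: pw) (rule mult_right_mono, simp_all)
      also have "exp (n * delta + (\<Sum>i\<in>UNIV. incr i) + e * n) * (d powr s * exp (- (s * (1 - e)) * n)) =
          A * exp (n * - (s * (1 - e) - (delta + e)))"
        by (simp add: A_def exp_add[symmetric] mult_exp_exp algebra_simps)
      also have "exp (n * - (s * (1 - e) - (delta + e))) = x ^ n" unfolding x_def by (rule exp_of_nat_mult)
      finally show ?thesis by (simp add: n_def power_add mult.assoc)
    qed
    show "summable (\<lambda>j. A * x ^ m * x ^ j)" using x by (intro summable_mult summable_geometric) simp
  qed
  also have "(\<Sum>j. A * x ^ m * x ^ j) = A * x ^ m / (1 - x)"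
    using x by (subst suminf_mult) (simp_all add: suminf_geometric summable_geometric)
  also have "ennreal \<dots> \<le> ennreal \<epsilon>" using m(1) by (intro ennreal_leI) simp
  finally show "hausdorff_premeasure s \<delta> (\<Inter>m. \<Union>n\<in>{m..}. \<Union>(Cov n e)) \<le> ennreal \<epsilon>" .
qed

lemma hausdorff_dim_measure_bdd:
  "bdd_below {hausdorff_dim S | S. S \<in> sets (bernoulli_measure \<Phi> p) \<and> (AE x in bernoulli_measure \<Phi> p. x \<in> S)}"
  by (rule bdd_belowI[of _ 0]) (auto intro: hausdorff_dim_nonneg)

lemma hausdorff_dim_measure_le: "hausdorff_dim_measure (bernoulli_measure \<Phi> p) \<le> delta"
proof (rule dense_ge)
  fix s assume s: "delta < s"
  have s0: "0 < s" using s delta_nonneg by simp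
  \<comment> \<open>Half of the available room: \<open>delta + e < s * (1 - e)\<close> says
    \<open>e * (1 + s) < s - delta\<close>, and here the left side is
    \<open>(s - delta) / 2\<close>.\<close>
  define e where "e = (s - delta) / (2 * (1 + s))"
  have e: "0 < e" "e < 1" "delta + e < s * (1 - e)"
  proof -
    show e0: "0 < e" using s s0 by (simp add: e_def)
    show "e < 1" using s s0 delta_nonneg by (simp add: e_def divide_less_eq)
    have "e * (1 + s) = (s - delta) / 2" using s0 by (simp add: e_def field_simps)
    then show "delta + e < s * (1 - e)" using s by (simp add: algebra_simps)
  qed
  define S where "S = (\<Inter>m. \<Union>n\<in>{m..}. \<Union>(Cov n e))"
  have "closed (\<Union>(Cov n e))" for n by (rule closed_Union_Cov)
  then have "\<Union>(Cov n e) \<in> sets borel" for n by (rule borel_closed)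
  then have S_borel: "S \<in> sets borel" unfolding S_def by (intro sets.countable_INT' sets.countable_UN') auto
  have ae: "AE x in bernoulli_measure \<Phi> p. x \<in> S"
    unfolding bernoulli_measure_def
  proof (subst AE_distr_iff)
    show "coding_map \<Phi> \<in> borel_measurable PM" by (rule measurable_coding_map)
    show "{x \<in> space borel. x \<in> S} \<in> sets borel" using S_borel by simp
    show "AE \<omega> in PM. coding_map \<Phi> \<omega> \<in> S"
      using AE_eventually_Good[OF e(1)]
    proof eventually_elim
      case (elim \<omega>)
      then obtain N where N: "\<And>n. N \<le> n \<Longrightarrow> \<omega> \<in> Good n e" by (auto simp: eventually_sequentially)
      show ?case
        unfolding S_def
      proof
        fix m
        have G: "\<omega> \<in> Good (max m N) e" by (rule N) simp
        then have "box (max m N) \<omega> \<in> Cov (max m N) e" unfolding Cov_def using box_code by (metis imageI)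
        moreover have "coding_map \<Phi> \<omega> \<in> box (max m N) \<omega>"
          by (rule coding_in_box) (use G in \<open>auto simp: Good_def\<close>)
        ultimately show "coding_map \<Phi> \<omega> \<in> (\<Union>n\<in>{m..}. \<Union>(Cov n e))" by (intro UN_I[of "max m N"]) auto
      qed
    qed
  qed
  have "hausdorff_dim_measure (bernoulli_measure \<Phi> p) \<le> hausdorff_dim S"
    unfolding hausdorff_dim_measure_def
    by (rule cInf_lower[OF _ hausdorff_dim_measure_bdd]) (use S_borel ae in \<open>auto simp: bernoulli_measure_def\<close>)
  also have "\<dots> \<le> s"
    unfolding S_def using s0 by (intro hausdorff_dim_le hausdorff_measure_limsup_Cov[OF s e]) auto
  finally show "hausdorff_dim_measure (bernoulli_measure \<Phi> p) \<le> s" .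
qed

lemma hausdorff_dim_measure_nonneg: "0 \<le> hausdorff_dim_measure (bernoulli_measure \<Phi> p)"
  unfolding hausdorff_dim_measure_def
proof (rule cInf_greatest)
  have "hausdorff_dim (UNIV :: (real ^ 'n) set) \<in> {hausdorff_dim S | S. S \<in> sets (bernoulli_measure \<Phi> p) \<and> (AE x in bernoulli_measure \<Phi> p. x \<in> S)}"
    by (intro CollectI exI[of _ UNIV]) (simp add: bernoulli_measure_def)
  then show "{hausdorff_dim S | S. S \<in> sets (bernoulli_measure \<Phi> p) \<and> (AE x in bernoulli_measure \<Phi> p. x \<in> S)} \<noteq> {}"
    by blast
qed (auto intro: hausdorff_dim_nonneg)

end

theorem theorem2p7:
  fixes \<Phi> :: "('n::finite, 'a) diag_ifs" and p :: "('n \<Rightarrow> 'a) measure"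
  assumes "diagonal_ifs \<Phi>"
    and "prob_measure_on (index_set \<Phi>) p"
    and "irreducible_measure \<Phi> p"
    and "good_measure \<Phi> p"
    and "distinct_lyapunov \<Phi> p"
  shows "\<exists>\<Psi> :: nat \<Rightarrow> ('n, nat) diag_ifs.
           (\<forall>N. diagonal_ifs (\<Psi> N) \<and> strongly_lalley_gatzouras (\<Psi> N) \<and>
                limit_set (\<Psi> N) \<subseteq> limit_set \<Phi> \<and> hyperplane_diffuse (limit_set (\<Psi> N))) \<and>
           (\<lambda>N. lower_assouad_dim (limit_set (\<Psi> N)))
             \<longlonglongrightarrow> hausdorff_dim_measure (bernoulli_measure \<Phi> p)"
proof -
  define q where "q a = measure p {a}" for a
  have ps: "prob_space p" and sets: "sets p = Pow (index_set \<Phi>)"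
    using assms(2) by (auto simp: prob_measure_on_def)
  interpret p: prob_space p by (rule ps)
  note int = integral_finite_space[OF p.finite_measure_axioms sets finite_index_set[OF assms(1)], folded q_def]
  have q_sum: "(\<Sum>a\<in>index_set \<Phi>. q a) = 1" using int[of "\<lambda>_. 1"] p.prob_space by simp
  have q_nonneg: "0 \<le> q a" for a by (simp add: q_def)
  have lyap: "lyapunov \<Phi> p i = - (\<Sum>a\<in>index_set \<Phi>. q a * ln (ifs_ratio \<Phi> a i))" for i
    by (simp add: lyapunov_def int)
  have lyap_pos: "0 < lyapunov \<Phi> p i" for i
    using weighted_ln_ratio_neg[OF assms(1) q_nonneg q_sum] by (simp add: lyap)
  interpret bernoulli_sponge \<Phi> "lyapunov \<Phi> p" q p
  proof
    show "diagonal_ifs \<Phi>" by (rule assms(1))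
    show "inj (lyapunov \<Phi> p)" using assms(5) by (simp add: distinct_lyapunov_def)
    \<comment> \<open>The level \<open>x\<close> of \<open>good_measure\<close> is the exponent of
      \<open>i\<close> itself, positive by \<open>lyap_pos\<close>.\<close>
    show "good_set \<Phi> {j. lyapunov \<Phi> p j \<le> lyapunov \<Phi> p i}" for i
      using assms(4) lyap_pos[of i] by (auto simp: good_measure_def)
    show "\<exists>a\<in>index_set \<Phi>. \<exists>b\<in>index_set \<Phi>. a i \<noteq> b i \<and> (\<forall>j. a j \<noteq> b j \<longrightarrow> lyapunov \<Phi> p i \<le> lyapunov \<Phi> p j)" for i
      using assms(3) unfolding irreducible_measure_def by blast
  qed (use q_nonneg q_sum lyap sets ps in \<open>auto simp: q_def\<close>)
  define t where "t = hausdorff_dim_measure (bernoulli_measure \<Phi> p)"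
  define P where "P = (\<lambda>N (\<Psi> :: ('n, nat) diag_ifs). diagonal_ifs \<Psi> \<and> strongly_lalley_gatzouras \<Psi> \<and>
    limit_set \<Psi> \<subseteq> limit_set \<Phi> \<and> hyperplane_diffuse (limit_set \<Psi>) \<and>
    \<bar>lower_assouad_dim (limit_set \<Psi>) - t\<bar> < 1 / real (Suc N))"
  \<comment> \<open>The target \<open>t\<close> lies between 0 and \<open>delta\<close>, so any
    accuracy can be requested, here \<open>1 / (N + 1)\<close>.\<close>
  have "\<forall>N. \<exists>\<Psi>. P N \<Psi>"
    unfolding P_def t_def
    by (intro allI ex_sponge_near hausdorff_dim_measure_nonneg hausdorff_dim_measure_le) simp
  from choice[OF this] obtain \<Psi> where \<Psi>: "\<And>N. P N (\<Psi> N)" by blast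
  have "(\<lambda>N. lower_assouad_dim (limit_set (\<Psi> N)) - t) \<longlonglongrightarrow> 0"
    by (rule Lim_null_comparison[OF _ lim_1_over_n[THEN LIMSEQ_Suc]])
      (use \<Psi> in \<open>auto simp: P_def intro!: always_eventually less_imp_le\<close>)
  then have "(\<lambda>N. lower_assouad_dim (limit_set (\<Psi> N))) \<longlonglongrightarrow> t" by (rule LIM_zero_cancel)
  then show ?thesis using \<Psi> unfolding P_def t_def by blast
qed

end
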